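(* Let $0<2k\le n\le N$ with $k<n$. Let $A\in\mathbb{R}^{n\times N}$ have i.i.d. $\mathcal{N}(0,1/n)$ entries, let $x^*\in\mathbb{R}^N$ have support $\Lambda$ with $|\Lambda|=k$, with $A$ independent of $x^*$, and let $e\in\mathbb{R}^n$ have i.i.d. $\mathcal{N}(0,\sigma^2/n)$ entries, independently of $A$ and $x^*$. Let $\Gamma\subseteq\{1,\dots,N\}$ be a (fixed) index set with $|\Gamma|=k$ and $\Gamma\neq\Lambda$. Then $$\frac{\|A_{\Gamma}^{\dagger}A_{\Lambda\setminus\Gamma}x^*_{\Lambda\setminus\Gamma}\|}{\|x^*_{\Lambda\setminus\Gamma}\|}=\sqrt{F_{\Gamma}},\quad\text{where } F_{\Gamma}\sim\frac{k}{n-k+1}\mathcal{F}(k,n-k+1);$$ $$\frac{\|A_{\Lambda\setminus\Gamma}^T(I-A_{\Gamma}A^{\dagger}_{\Gamma})A_{\Lambda\setminus\Gamma}x^*_{\Lambda\setminus\Gamma}\|}{\|x^*_{\Lambda\setminus\Gamma}\|}\geq\left(\frac{n-k}{n}\right)R_{\Gamma},\quad\text{where } R_{\Gamma}\sim\frac{1}{n-k}\chi^2_{n-k};$$ $$\|A_{\Gamma}^{\dagger}e\|\le\sigma\sqrt{G_{\Gamma}},\quad\text{where } G_{\Gamma}\sim\frac{k}{n-k+1}\mathcal{F}(k,n-k+1);$$ $$\|A_{\Lambda\setminus\Gamma}^T(I-A_{\Gamma}A_{\Gamma}^{\dagger})e\|\le\sigma\sqrt{\frac{k(n-k)}{n^2}\,S_{\Gamma}T_{\Gamma}},\quad\text{where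 } S_{\Gamma}\sim\frac{1}{n-k}\chi^2_{n-k},\; T_{\Gamma}\sim\frac{1}{k}\chi^2_k.$$
   Context: $\|\cdot\|$ is the Euclidean norm; $x_\Gamma$, $A_\Gamma$ denote restriction to entries, respectively columns, indexed by $\Gamma$; $A_\Gamma^\dagger=(A_\Gamma^TA_\Gamma)^{-1}A_\Gamma^T$ (well-defined with probability 1). $\chi^2_s$ is the chi-squared distribution with $s$ degrees of freedom; $\mathcal{F}(s,t)$ is the distribution of $P/Q$ for independent $P\sim\frac1s\chi^2_s$, $Q\sim\frac1t\chi^2_t$; and $X\sim cD$ means that $X$ has the law of $c$ times a variable with distribution $D$. Each line asserts the existence of random variables with the stated marginal laws (on a possibly enlarged probability space) for which the stated equality or inequality holds almost surely. *)

theory Defs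
  imports
    "HOL-Probability.Probability"
    "Jordan_Normal_Form.Gauss_Jordan_Elimination"
    "Jordan_Normal_Form.DL_Submatrix"
begin

(* Vectors and matrices are those of Jordan_Normal_Form, whose dimensions are natural numbers:
   the order of A_Gamma^T A_Gamma is the cardinality of the index set Gamma.
   Indices are 0-based, so index sets are subsets of {..<N} rather than of {1..N}. *)

section \<open>Linear algebra\<close>

definition vnorm :: "real Matrix.vec \<Rightarrow> real" where
  "vnorm v = sqrt (v \<bullet> v)"

definition vsupp :: "real Matrix.vec \<Rightarrow> nat set" where
  "vsupp v = {j. j < dim_vec v \<and> vec_index v j \<noteq> 0}"

(* pick J i is the i-th smallest element of J, as in the definition of submatrix, so that the
   entries of subvec x J are ordered like the columns of restrict_cols A J. *)
definition subvec :: "real Matrix.vec \<Rightarrow> nat set \<Rightarrow> real Matrix.vec" where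
  "subvec x J = Matrix.vec (card {j. j < dim_vec x \<and> j \<in> J}) (\<lambda>i. vec_index x (pick J i))"

definition restrict_cols :: "real Matrix.mat \<Rightarrow> nat set \<Rightarrow> real Matrix.mat" where
  "restrict_cols A J = submatrix A UNIV J"

(* Unspecified if B^T B is singular. *)
definition pinv :: "real Matrix.mat \<Rightarrow> real Matrix.mat" where
  "pinv B = the (mat_inverse (transpose_mat B * B)) * transpose_mat B"

section \<open>Random vectors and matrices\<close>

definition vec_borel :: "nat \<Rightarrow> real Matrix.vec measure" where
  "vec_borel n = vimage_algebra (carrier_vec n)
     (\<lambda>v. \<lambda>i\<in>{..<n}. vec_index v i) (Pi\<^sub>M {..<n} (\<lambda>_. borel))"

definition mat_borel :: "nat \<Rightarrow> nat \<Rightarrow> real Matrix.mat measure" where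
  "mat_borel n m = vimage_algebra (carrier_mat n m)
     (\<lambda>B. \<lambda>p\<in>{..<n} \<times> {..<m}. B $$ p) (Pi\<^sub>M ({..<n} \<times> {..<m}) (\<lambda>_. borel))"

lemma measurable_vec_borel_iff:
  "X \<in> M \<rightarrow>\<^sub>M vec_borel n \<longleftrightarrow>
     X \<in> space M \<rightarrow> carrier_vec n \<and> (\<forall>i<n. (\<lambda>\<omega>. vec_index (X \<omega>) i) \<in> borel_measurable M)"
proof
  assume X: "X \<in> M \<rightarrow>\<^sub>M vec_borel n"
  have *: "(\<lambda>v. \<lambda>i\<in>{..<n}. vec_index v i) \<in> vec_borel n \<rightarrow>\<^sub>M Pi\<^sub>M {..<n} (\<lambda>_. borel)"
    unfolding vec_borel_def by (rule measurable_vimage_algebra1) (auto simp: space_PiM)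
  have "(\<lambda>\<omega>. vec_index (X \<omega>) i) \<in> borel_measurable M" if "i < n" for i
    using measurable_compose[OF measurable_compose[OF X *]
        measurable_component_singleton[of i "{..<n}" "\<lambda>_. borel"]] that by simp
  moreover have "X \<in> space M \<rightarrow> carrier_vec n"
    using measurable_space[OF X] by (auto simp: vec_borel_def)
  ultimately show "X \<in> space M \<rightarrow> carrier_vec n \<and>
      (\<forall>i<n. (\<lambda>\<omega>. vec_index (X \<omega>) i) \<in> borel_measurable M)" by blast
next
  assume "X \<in> space M \<rightarrow> carrier_vec n \<and>
      (\<forall>i<n. (\<lambda>\<omega>. vec_index (X \<omega>) i) \<in> borel_measurable M)"
  then show "X \<in> M \<rightarrow>\<^sub>M vec_borel n"
    unfolding vec_borel_def
    by (intro measurable_vimage_algebra2 measurable_restrict) auto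
qed

lemma measurable_mat_borel_iff:
  "X \<in> M \<rightarrow>\<^sub>M mat_borel n m \<longleftrightarrow>
     X \<in> space M \<rightarrow> carrier_mat n m \<and>
     (\<forall>p\<in>{..<n} \<times> {..<m}. (\<lambda>\<omega>. X \<omega> $$ p) \<in> borel_measurable M)"
proof
  assume X: "X \<in> M \<rightarrow>\<^sub>M mat_borel n m"
  have *: "(\<lambda>B. \<lambda>p\<in>{..<n} \<times> {..<m}. B $$ p)
      \<in> mat_borel n m \<rightarrow>\<^sub>M Pi\<^sub>M ({..<n} \<times> {..<m}) (\<lambda>_. borel)"
    unfolding mat_borel_def by (rule measurable_vimage_algebra1) (auto simp: space_PiM)
  have "(\<lambda>\<omega>. X \<omega> $$ p) \<in> borel_measurable M" if "p \<in> {..<n} \<times> {..<m}" for p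
    using measurable_compose[OF measurable_compose[OF X *]
        measurable_component_singleton[OF that, of "\<lambda>_. borel"]] that by simp
  moreover have "X \<in> space M \<rightarrow> carrier_mat n m"
    using measurable_space[OF X] by (auto simp: mat_borel_def)
  ultimately show "X \<in> space M \<rightarrow> carrier_mat n m \<and>
     (\<forall>p\<in>{..<n} \<times> {..<m}. (\<lambda>\<omega>. X \<omega> $$ p) \<in> borel_measurable M)" by blast
next
  assume "X \<in> space M \<rightarrow> carrier_mat n m \<and>
     (\<forall>p\<in>{..<n} \<times> {..<m}. (\<lambda>\<omega>. X \<omega> $$ p) \<in> borel_measurable M)"
  then show "X \<in> M \<rightarrow>\<^sub>M mat_borel n m"
    unfolding mat_borel_def
    by (intro measurable_vimage_algebra2 measurable_restrict) auto
qed

(* indep_var requires both variables to have values in the same type; this is the same notion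
   (see indep_var_eq) for variables with values in different types. *)
definition indep_rv ::
  "'a measure \<Rightarrow> 'b measure \<Rightarrow> ('a \<Rightarrow> 'b) \<Rightarrow> 'c measure \<Rightarrow> ('a \<Rightarrow> 'c) \<Rightarrow> bool" where
  "indep_rv M S X T Y \<longleftrightarrow> X \<in> M \<rightarrow>\<^sub>M S \<and> Y \<in> M \<rightarrow>\<^sub>M T \<and>
     prob_space.indep_set M
       (sigma_sets (space M) {X -` B \<inter> space M | B. B \<in> sets S})
       (sigma_sets (space M) {Y -` B \<inter> space M | B. B \<in> sets T})"

lemma (in prob_space) indep_rv_iff_indep_var: "indep_rv M S X T Y \<longleftrightarrow> indep_var S X T Y"
  by (simp add: indep_rv_def indep_var_eq conj_ac)

section \<open>Distributions\<close>

(* N(0, v) with variance v \<ge> 0; v = 0 gives the point mass at 0. *)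
definition normal_law :: "real \<Rightarrow> real measure" where
  "normal_law v = distr std_normal_distribution borel (\<lambda>z. sqrt v * z)"

lemma normal_law_eq_density:
  assumes "v > 0"
  shows "normal_law v = density lborel (normal_density 0 (sqrt v))"
proof -
  interpret S: real_distribution std_normal_distribution
    by (rule real_dist_normal_dist)
  have "distributed std_normal_distribution lborel (\<lambda>x. x) std_normal_density"
    by (auto simp: distributed_def distr_id2)
  from S.normal_density_affine[OF this, of "sqrt v" 0]
  have "distributed std_normal_distribution lborel (\<lambda>x. sqrt v * x) (normal_density 0 (sqrt v))"
    using assms by (simp add: less_imp_le)
  then show ?thesis
    by (auto simp: distributed_def normal_law_def cong: distr_cong)
qed

definition chi_squared :: "nat \<Rightarrow> real measure" where
  "chi_squared s =
     distr (Pi\<^sub>M {..<s} (\<lambda>_. std_normal_distribution)) borel (\<lambda>z. \<Sum>i<s. (z i)\<^sup>2)"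

definition scale_law :: "real \<Rightarrow> real measure \<Rightarrow> real measure" where
  "scale_law c D = distr D borel (\<lambda>x. c * x)"

definition F_law :: "nat \<Rightarrow> nat \<Rightarrow> real measure" where
  "F_law s t = distr (scale_law (1 / real s) (chi_squared s) \<Otimes>\<^sub>M scale_law (1 / real t) (chi_squared t))
     borel (\<lambda>(p, q). p / q)"

definition has_law :: "'a measure \<Rightarrow> ('a \<Rightarrow> real) \<Rightarrow> real measure \<Rightarrow> bool" where
  "has_law M X D \<longleftrightarrow> X \<in> borel_measurable M \<and> distr M borel X = D"

(* M' enlarges M along the measure-preserving map \<pi>: a random variable X on M
   is read on M' as the composition of X with \<pi>. *)
definition enlargement :: "'a measure \<Rightarrow> 'b measure \<Rightarrow> ('b \<Rightarrow> 'a) \<Rightarrow> bool" where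
  "enlargement M M' \<pi> \<longleftrightarrow> prob_space M' \<and> \<pi> \<in> M' \<rightarrow>\<^sub>M M \<and> distr M' M \<pi> = M"

end

theory Submission
  imports Defs "Jordan_Normal_Form.Determinant"
begin

text \<open>Rescale everything to standard normal variables and let \<open>B\<close> be the matrix of the columns in \<open>\<Gamma>\<close>.
  Since \<open>x\<close> is independent of \<open>A\<close> and \<open>A\<^sub>\<Delta> x\<^sub>\<Delta> = A y\<close> for the vector \<open>y\<close> that agrees with \<open>x\<close> off \<open>\<Gamma>\<close>,
  the direction \<open>A y / \<parallel>y\<parallel>\<close> is, like the noise, a standard Gaussian vector \<open>g\<close> independent of \<open>B\<close>. Hence all
  claims are about a Gaussian pair \<open>(B, g)\<close>.

  The residual of \<open>g\<close> is its image under a projection of rank \<open>n - k\<close>, so its squared norm is chi-squared.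
  For the coefficient vector \<open>w = (B\<^sup>T B)\<inverse> B\<^sup>T g\<close>, conditioning on \<open>B\<close> gives
  \<open>E exp (i \<zeta> \<bullet> w) = E exp (- \<zeta> \<bullet> (B\<^sup>T B)\<inverse> \<zeta> / 2)\<close>; rotating the columns of \<open>B\<close> so that \<open>\<zeta>\<close> becomes a multiple of
  a basis vector, \<open>\<zeta> \<bullet> (B\<^sup>T B)\<inverse> \<zeta> = \<parallel>\<zeta>\<parallel>\<^sup>2 / \<rho>\<close> with \<open>\<rho>\<close> the squared residual norm of the last column on the
  other ones. So \<open>w\<close> has the law of \<open>h / sqrt \<rho>\<close> for an independent standard Gaussian vector \<open>h\<close>, and
  \<open>\<parallel>w\<parallel>\<^sup>2\<close> that of a quotient of independent chi-squared variables.

  The auxiliary normal variables of the enlarged space are used as \<open>k\<close> further columns, which complete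
  \<open>\<Delta>\<close> to exactly \<open>k\<close> columns in the last claim, and as noise if \<open>\<sigma> = 0\<close>.\<close>

section \<open>Uniqueness of characteristic functions on finite products\<close>

text \<open>Unlike the residual, the coefficient vector is not a fixed orthonormal image of Gaussian
  data: the inverse Gram matrix is random and couples its entries. Characteristic functions avoid
  the density of that inverse, because each direction zeta only sees one scalar rho, whose law is
  the same for all directions. Hence uniqueness in several dimensions is proved first. The number n
  - k + 1 arises because rho comes from fitting one column by k - 1 others. The signal and its
  support are random, but the conditional laws do not depend on them, so conditioning reduces to
  \<open>distr_pair_kernel\<close>. Inverses written as adjugate over determinant keep every
  function total and measurable; singular realizations form a null set. In the last claim both
  factors come from the noise residual: S from its squared norm, T from the correlations of the
  normalized residual with k columns. The normalization is what gives T the same law for every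
  residual. The size of \<Delta> may vary with the signal, hence the padding to k columns.\<close>

lemma finite_measure_char_unique:
  fixes P Q :: "real measure"
  assumes "finite_measure P" "finite_measure Q"
    and P: "sets P = sets borel" and Q: "sets Q = sets borel"
    and eq: "\<And>t. char P t = char Q t"
  shows "P = Q"
proof -
  interpret P: finite_measure P by fact
  interpret Q: finite_measure Q by fact
  \<comment> \<open>The characteristic function at 0 is the total mass.\<close>
  have mass: "measure P UNIV = measure Q UNIV"
    using eq[of 0] sets_eq_imp_space_eq[OF P] sets_eq_imp_space_eq[OF Q]
    by (simp add: char_def)
  show ?thesis
  proof (cases "measure P UNIV = 0")
    case True
    have "emeasure P UNIV = 0" "emeasure Q UNIV = 0"
      using True mass by (auto simp: P.emeasure_eq_measure Q.emeasure_eq_measure)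
    then have "emeasure P B = 0" "emeasure Q B = 0" for B
      using emeasure_space[of P B] emeasure_space[of Q B]
        sets_eq_imp_space_eq[OF P] sets_eq_imp_space_eq[OF Q] by auto
    then show ?thesis by (intro measure_eqI) (auto simp: P Q)
  next
    case False
    \<comment> \<open>Levy's theorem concerns probability measures, so both measures are divided by
      their common mass, which is positive in this case.\<close>
    define a where "a = measure P UNIV"
    have a: "a > 0" using False measure_nonneg[of P UNIV] unfolding a_def by linarith
    define P' Q' where "P' = density P (\<lambda>_. ennreal (1 / a))" and "Q' = density Q (\<lambda>_. ennreal (1 / a))"
    have one: "ennreal (1 / a) * ennreal a = 1" using a by (simp flip: ennreal_mult)
    have sp: "space P = UNIV" "space Q = UNIV"
      using sets_eq_imp_space_eq[OF P] sets_eq_imp_space_eq[OF Q] by auto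
    have "emeasure P' UNIV = 1" "emeasure Q' UNIV = 1"
      using one mass by (auto simp: P'_def Q'_def emeasure_density P Q sp nn_integral_cmult_indicator
        a_def P.emeasure_eq_measure Q.emeasure_eq_measure)
    then have rd: "real_distribution P'" "real_distribution Q'"
      by (auto intro!: prob_spaceI simp: P'_def Q'_def real_distribution_def
          real_distribution_axioms_def P Q sp)
    have "char P' t = char P t / a" for t
      using a P by (simp add: char_def P'_def integral_density scaleR_conv_of_real)
    moreover have "char Q' t = char Q t / a" for t
      using a Q by (simp add: char_def Q'_def integral_density scaleR_conv_of_real)
    ultimately have "char P' = char Q'" by (auto simp: eq)
    from Levy_uniqueness[OF rd this] have PQ: "P' = Q'" .
    have "emeasure P B = emeasure Q B" if [measurable]: "B \<in> sets borel" for B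
    proof -
      have "ennreal a * (ennreal (1/a) * emeasure P B) = ennreal a * (ennreal (1/a) * emeasure Q B)"
        using arg_cong[OF PQ, of "\<lambda>M. emeasure M B"]
        by (simp add: P'_def Q'_def emeasure_density P Q nn_integral_cmult_indicator)
      then show ?thesis using one by (metis mult.assoc mult.commute mult_1)
    qed
    then show ?thesis by (intro measure_eqI) (auto simp: P Q)
  qed
qed

text \<open>The phases 0 and - pi / 2 turn the cosine integrals into real and imaginary part of the
  characteristic function of \<open>f\<close> under the density \<open>V\<close>. This exchanges one
  cosine for an indicator while the weight is kept.\<close>

lemma weighted_char_unique:
  fixes f V :: "'a \<Rightarrow> real"
  assumes "finite_measure P" "finite_measure Q" and PQ: "sets P = sets Q"
    and f[measurable]: "f \<in> borel_measurable P"
    and V[measurable]: "V \<in> borel_measurable P" and V0: "\<And>y. 0 \<le> V y" and VC: "\<And>y. V y \<le> C"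
    and eq: "\<And>s d. (LINT y|P. V y * cos (s * f y + d)) = (LINT y|Q. V y * cos (s * f y + d))"
    and B[measurable]: "B \<in> sets borel"
  shows "(LINT y|P. V y * indicat_real B (f y)) = (LINT y|Q. V y * indicat_real B (f y))"
proof -
  have [measurable]: "f \<in> borel_measurable Q" "V \<in> borel_measurable Q"
    using f V by (auto simp: measurable_cong_sets[OF PQ refl])
  define law where "law M = distr (density M (\<lambda>y. ennreal (V y))) borel f" for M
  have law: "finite_measure (law M)" "sets (law M) = sets borel"
      "char (law M) s = Complex (LINT y|M. V y * cos (s * f y + 0)) (LINT y|M. V y * cos (s * f y + - pi / 2))"
      "measure (law M) B = (LINT y|M. V y * indicat_real B (f y))"
    if "finite_measure M" and [measurable]: "f \<in> borel_measurable M" "V \<in> borel_measurable M" for M s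
  proof -
    interpret M: finite_measure M by fact
    have int: "integrable M (\<lambda>y. V y *\<^sub>R g y)"
      if [measurable]: "g \<in> borel_measurable M" and "\<And>y. norm (g y) \<le> 1"
      for g :: "'a \<Rightarrow> 'b::{banach, second_countable_topology}"
    proof (rule M.integrable_const_bound[of _ C])
      show "AE y in M. norm (V y *\<^sub>R g y) \<le> C"
      proof (rule AE_I2)
        fix y
        have "norm (V y *\<^sub>R g y) \<le> C * 1"
          unfolding norm_scaleR using V0[of y] VC[of y] that(2)[of y] by (intro mult_mono) auto
        then show "norm (V y *\<^sub>R g y) \<le> C" by simp
      qed
    qed measurable
    have fin: "finite_measure (density M (\<lambda>y. ennreal (V y)))"
      using int[of "\<lambda>_. 1::real"]
      by (intro finite_measureI) (auto simp: emeasure_density space_density nn_integral_eq_integral V0)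
    show "finite_measure (law M)" "sets (law M) = sets borel"
      unfolding law_def by (auto intro!: finite_measure.finite_measure_distr[OF fin])
    have "char (law M) s = (LINT y|M. V y *\<^sub>R iexp (s * f y))"
      by (simp add: char_def law_def integral_distr integral_density V0)
    also have "\<dots> = Complex (LINT y|M. V y * cos (s * f y)) (LINT y|M. V y * sin (s * f y))"
    proof -
      have i: "integrable M (\<lambda>y. V y *\<^sub>R iexp (s * f y))" by (rule int) auto
      have "Re (LINT y|M. V y *\<^sub>R iexp (s * f y)) = (LINT y|M. V y * cos (s * f y))"
        using integral_Re[OF i] by (simp add: Re_exp)
      moreover have "Im (LINT y|M. V y *\<^sub>R iexp (s * f y)) = (LINT y|M. V y * sin (s * f y))"
        using integral_Im[OF i] by (simp add: Im_exp)
      ultimately show ?thesis by (simp add: complex_eq_iff)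
    qed
    finally show "char (law M) s =
        Complex (LINT y|M. V y * cos (s * f y + 0)) (LINT y|M. V y * cos (s * f y + - pi / 2))"
      by (simp add: cos_diff)
    interpret L: finite_measure "law M" by fact
    have "measure (law M) B = (LINT z|law M. indicat_real B z)"
      by (simp add: law_def del: measure_distr)
    also have "\<dots> = (LINT y|M. V y * indicat_real B (f y))"
      unfolding law_def
      by (subst integral_distr; simp add: integral_density V0 del: integral_indicator)
    finally show "measure (law M) B = (LINT y|M. V y * indicat_real B (f y))" .
  qed
  have "char (law P) s = char (law Q) s" for s
    using law(3)[of P s] law(3)[of Q s] assms(1,2) by (simp only: eq) measurable
  then have "law P = law Q"
    using law(1,2)[of P] law(1,2)[of Q] assms(1,2) by (intro finite_measure_char_unique) auto
  then show ?thesis using law(4)[of P] law(4)[of Q] assms(1,2) by simp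
qed

text \<open>Coordinates move one at a time from the exponent into indicators. Once all have moved,
  the cosine is the constant 1 and the measures agree on boxes.\<close>

lemma PiM_char_unique:
  assumes I: "finite I" and "prob_space P" "prob_space Q"
    and P: "sets P = sets (Pi\<^sub>M I (\<lambda>_. borel :: real measure))"
    and Q: "sets Q = sets (Pi\<^sub>M I (\<lambda>_. borel :: real measure))"
    and eq: "\<And>t. (LINT y|P. iexp (\<Sum>i\<in>I. t i * y i)) = (LINT y|Q. iexp (\<Sum>i\<in>I. t i * y i))"
  shows "P = Q"
proof -
  interpret P: prob_space P by fact
  interpret Q: prob_space Q by fact
  note [measurable_cong] = P Q
  \<comment> \<open>Induction invariant: coordinates in \<open>J\<close> occur through indicators,
    the others through a cosine whose free phase \<open>c\<close> carries real and imaginary part at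
    once.\<close>
  have *: "(LINT y|P. (\<Prod>i\<in>J. indicat_real (A i) (y i)) * cos ((\<Sum>i\<in>I-J. t i * y i) + c)) =
           (LINT y|Q. (\<Prod>i\<in>J. indicat_real (A i) (y i)) * cos ((\<Sum>i\<in>I-J. t i * y i) + c))"
    if "J \<subseteq> I" and A: "\<And>i. A i \<in> sets borel" for J A t c
  proof -
    have "finite J" using I that(1) finite_subset by blast
    then show ?thesis using that(1)
    proof (induction J arbitrary: t c)
      case empty
      have "(LINT y|M. cos ((\<Sum>i\<in>I. t i * y i) + c)) = Re (iexp c * (LINT y|M. iexp (\<Sum>i\<in>I. t i * y i)))"
        if "prob_space M" and [measurable_cong]: "sets M = sets (Pi\<^sub>M I (\<lambda>_. borel :: real measure))" for M
      proof -
        interpret M: prob_space M by fact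
        have i: "integrable M (\<lambda>y. iexp (\<Sum>i\<in>I. t i * y i))"
          by (rule M.integrable_const_bound[of _ 1]) auto
        have "Re (iexp c * (LINT y|M. iexp (\<Sum>i\<in>I. t i * y i))) =
            Re (LINT y|M. iexp c * iexp (\<Sum>i\<in>I. t i * y i))"
          by simp
        also have "\<dots> = (LINT y|M. Re (iexp c * iexp (\<Sum>i\<in>I. t i * y i)))"
          using i by (intro integral_Re[symmetric]) auto
        also have "\<dots> = (LINT y|M. cos ((\<Sum>i\<in>I. t i * y i) + c))"
          by (intro Bochner_Integration.integral_cong refl)
             (simp add: Re_exp cos_add Im_exp mult_ac)
        finally show ?thesis ..
      qed
      from this[OF assms(2) P] this[OF assms(3) Q] show ?case
        unfolding prod.empty mult_1 Diff_empty eq by presburger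
    next
      case (insert j J)
      have JI: "J \<subseteq> I" "j \<in> I" using insert.prems by auto
      define \<theta> where "\<theta> y = (\<Sum>i\<in>I - insert j J. t i * y i)" for y :: "'a \<Rightarrow> real"
      define X where "X y = (\<Prod>i\<in>J. indicat_real (A i) (y i))" for y :: "'a \<Rightarrow> real"
      have X01: "0 \<le> X y" "X y \<le> 1" for y
        unfolding X_def by (auto intro!: prod_nonneg prod_le_1 simp: indicator_def)
      have meas[measurable]: "\<theta> \<in> borel_measurable (Pi\<^sub>M I (\<lambda>_. borel))"
        "X \<in> borel_measurable (Pi\<^sub>M I (\<lambda>_. borel))" "(\<lambda>y. y j) \<in> borel_measurable (Pi\<^sub>M I (\<lambda>_. borel))"
      proof -
        have [measurable]: "(\<lambda>y. y i) \<in> borel_measurable (Pi\<^sub>M I (\<lambda>_. borel))" if "i \<in> I" for i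
          using that by measurable
        show "\<theta> \<in> borel_measurable (Pi\<^sub>M I (\<lambda>_. borel))" unfolding \<theta>_def by (intro borel_measurable_sum) simp
        have "(\<lambda>y. indicat_real (A i) (y i)) \<in> borel_measurable (Pi\<^sub>M I (\<lambda>_. borel))" if "i \<in> I" for i
        proof -
          have [measurable]: "A i \<in> sets borel" by (rule A)
          show ?thesis using that by measurable
        qed
        then show "X \<in> borel_measurable (Pi\<^sub>M I (\<lambda>_. borel))"
          unfolding X_def using JI by (intro borel_measurable_prod) auto
        show "(\<lambda>y. y j) \<in> borel_measurable (Pi\<^sub>M I (\<lambda>_. borel))" using JI by measurable
      qed
      have IJ: "I - J = insert j (I - insert j J)" using insert JI by auto
      have sum_eq: "(\<Sum>i\<in>I-J. (t(j := s)) i * y i) = s * y j + \<theta> y" for s and y :: "'a \<Rightarrow> real"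
        unfolding IJ \<theta>_def using I by (auto simp: insert.hyps intro!: sum.cong)
      \<comment> \<open>Frequency \<open>s\<close> at coordinate \<open>j\<close> with the remaining
        frequencies kept; \<open>IH0\<close> below sets the remaining ones to 0.\<close>
      have IH: "(LINT y|P. X y * cos (s * y j + \<theta> y + c)) = (LINT y|Q. X y * cos (s * y j + \<theta> y + c))" for s c
        using insert.IH[OF JI(1), of "t(j := s)" c] unfolding sum_eq X_def .
      have sum_eq0: "(\<Sum>i\<in>I-J. ((\<lambda>i. 0)(j := s)) i * y i) = s * y j" for s and y :: "'a \<Rightarrow> real"
        unfolding IJ using I by (auto simp: insert.hyps intro!: sum.neutral)
      have IH0: "(LINT y|P. X y * cos (s * y j + c)) = (LINT y|Q. X y * cos (s * y j + c))" for s c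
        using insert.IH[OF JI(1), of "(\<lambda>i. 0)(j := s)" c] unfolding sum_eq0 X_def .
      have int: "integrable M (\<lambda>y. X y * g y)"
        if "prob_space M" and [measurable_cong]: "sets M = sets (Pi\<^sub>M I (\<lambda>_. borel :: real measure))"
          and [measurable]: "g \<in> borel_measurable (Pi\<^sub>M I (\<lambda>_. borel))" and g: "\<And>y. \<bar>g y\<bar> \<le> 2" for M g
      proof -
        interpret M: prob_space M by fact
        have "\<bar>X y * g y\<bar> \<le> 1 * 2" for y
          unfolding abs_mult using X01[of y] g[of y] by (intro mult_mono) auto
        then show ?thesis by (intro M.integrable_const_bound[of _ 2]) auto
      qed
      note intP = int[OF assms(2) P] and intQ = int[OF assms(3) Q]
      have c2: "\<bar>cos a\<bar> \<le> 2" for a :: real using abs_cos_le_one[of a] by linarith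
      have bas: "(LINT y|P. X y * indicat_real (A j) (y j)) = (LINT y|Q. X y * indicat_real (A j) (y j))"
        by (rule weighted_char_unique[of P Q "\<lambda>y. y j" X 1])
           (use X01 IH0 A P Q in \<open>auto intro: P.finite_measure_axioms Q.finite_measure_axioms\<close>)
      \<comment> \<open>A weight has to be nonnegative, which \<open>X * cos\<close> is not. Adding
        1 to the cosine repairs this, and the surplus \<open>X\<close> is subtracted again by means
        of \<open>bas\<close>.\<close>
      have wei: "(LINT y|P. (X y * (1 + cos (\<theta> y + c))) * indicat_real (A j) (y j)) =
                 (LINT y|Q. (X y * (1 + cos (\<theta> y + c))) * indicat_real (A j) (y j))"
      proof (rule weighted_char_unique[of P Q "\<lambda>y. y j" _ 2])
        fix y
        have c: "0 \<le> 1 + cos (\<theta> y + c)" "1 + cos (\<theta> y + c) \<le> 2"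
          using cos_ge_minus_one[of "\<theta> y + c"] by linarith (simp)
        then show "0 \<le> X y * (1 + cos (\<theta> y + c))" using X01 by simp
        have "X y * (1 + cos (\<theta> y + c)) \<le> 1 * 2" using c X01[of y] by (intro mult_mono) auto
        then show "X y * (1 + cos (\<theta> y + c)) \<le> 2" by simp
      next
        fix s d
        \<comment> \<open>Product-to-sum leaves single cosines with frequencies s and - s at
          coordinate \<open>j\<close>; both are instances of \<open>IH\<close>.\<close>
        have e: "X y * (1 + cos (\<theta> y + c)) * cos (s * y j + d) =
            X y * cos (s * y j + d) + (X y * cos (s * y j + \<theta> y + (c + d)) + X y * cos ((- s) * y j + \<theta> y + (c - d))) / 2"
          for y :: "'a \<Rightarrow> real"
        proof -
          have "cos (\<theta> y + c) * cos (s * y j + d) =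
              (cos (s * y j + \<theta> y + (c + d)) + cos ((- s) * y j + \<theta> y + (c - d))) / 2"
            by (subst cos_times_cos) (simp add: algebra_simps)
          then show ?thesis by (simp add: algebra_simps)
        qed
        have "(LINT y|M. X y * (1 + cos (\<theta> y + c)) * cos (s * y j + d)) =
            (LINT y|M. X y * cos (s * y j + d)) + ((LINT y|M. X y * cos (s * y j + \<theta> y + (c + d)))
              + (LINT y|M. X y * cos ((- s) * y j + \<theta> y + (c - d)))) / 2"
          if "prob_space M" "sets M = sets (Pi\<^sub>M I (\<lambda>_. borel :: real measure))" for M
          unfolding e using int[OF that _ c2]
          by (subst Bochner_Integration.integral_add Bochner_Integration.integral_divide_zero; simp)+
        from this[OF assms(2) P] this[OF assms(3) Q]
        show "(LINT y|P. X y * (1 + cos (\<theta> y + c)) * cos (s * y j + d)) =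
            (LINT y|Q. X y * (1 + cos (\<theta> y + c)) * cos (s * y j + d))"
          using IH0[of s d] IH[of s "c + d"] IH[of "- s" "c - d"] by simp
      qed (use A P Q in \<open>auto intro: P.finite_measure_axioms Q.finite_measure_axioms\<close>)
      have "(LINT y|M. (\<Prod>i\<in>insert j J. indicat_real (A i) (y i)) * cos ((\<Sum>i\<in>I - insert j J. t i * y i) + c)) =
          (LINT y|M. (X y * (1 + cos (\<theta> y + c))) * indicat_real (A j) (y j)) - (LINT y|M. X y * indicat_real (A j) (y j))"
        if M: "prob_space M" "sets M = sets (Pi\<^sub>M I (\<lambda>_. borel :: real measure))" for M
      proof -
        have [measurable]: "A j \<in> sets borel" by (rule A)
        have "\<bar>(1 + cos (\<theta> y + c)) * indicat_real (A j) (y j)\<bar> \<le> 2" for y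
          using abs_cos_le_one[of "\<theta> y + c"] abs_triangle_ineq[of 1 "cos (\<theta> y + c)"]
          by (auto simp: indicator_def intro: order_trans)
        then have i: "integrable M (\<lambda>y. X y * ((1 + cos (\<theta> y + c)) * indicat_real (A j) (y j)))"
          by (intro int[OF M]) auto
        have i2: "integrable M (\<lambda>y. X y * indicat_real (A j) (y j))"
          by (intro int[OF M]) (auto simp: indicator_def)
        have "(LINT y|M. (\<Prod>i\<in>insert j J. indicat_real (A i) (y i)) * cos ((\<Sum>i\<in>I - insert j J. t i * y i) + c)) =
          (LINT y|M. X y * ((1 + cos (\<theta> y + c)) * indicat_real (A j) (y j)) - X y * indicat_real (A j) (y j))"
          using insert.hyps
          by (intro Bochner_Integration.integral_cong refl) (simp add: X_def \<theta>_def algebra_simps)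
        also have "\<dots> = (LINT y|M. X y * ((1 + cos (\<theta> y + c)) * indicat_real (A j) (y j))) - (LINT y|M. X y * indicat_real (A j) (y j))"
          by (rule Bochner_Integration.integral_diff[OF i i2])
        finally show ?thesis by (simp add: mult.assoc)
      qed
      from this[OF assms(2) P] this[OF assms(3) Q] show ?case using bas wei by simp
    qed
  qed
  have box: "emeasure P (Pi\<^sub>E I A) = emeasure Q (Pi\<^sub>E I A)" if A: "\<And>i. i \<in> I \<Longrightarrow> A i \<in> sets borel" for A
  proof -
    \<comment> \<open>The invariant asks for measurable sides at every index, so the sides outside
      \<open>I\<close> are made empty.\<close>
    define A' where "A' i = (if i \<in> I then A i else {})" for i
    have A': "A' i \<in> sets borel" for i using A by (auto simp: A'_def)
    have m: "measure M (Pi\<^sub>E I A) = (LINT y|M. (\<Prod>i\<in>I. indicat_real (A' i) (y i)) * cos ((\<Sum>i\<in>I-I. 0 * y i) + 0))"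
      if "prob_space M" "sets M = sets (Pi\<^sub>M I (\<lambda>_. borel :: real measure))" for M
    proof -
      have "Pi\<^sub>E I A \<in> sets M" using A I by (auto simp: that(2) intro!: sets_PiM_I_finite)
      then have "measure M (Pi\<^sub>E I A) = (LINT y|M. indicat_real (Pi\<^sub>E I A) y)"
        using sets.sets_into_space by (simp add: Int_absorb2)
      also have "\<dots> = (LINT y|M. (\<Prod>i\<in>I. indicat_real (A' i) (y i)))"
      proof (intro Bochner_Integration.integral_cong refl)
        fix y assume "y \<in> space M"
        then have "y \<in> extensional I"
          using sets_eq_imp_space_eq[OF that(2)] by (auto simp: space_PiM PiE_def)
        then show "indicat_real (Pi\<^sub>E I A) y = (\<Prod>i\<in>I. indicat_real (A' i) (y i))"
          using I by (auto simp: indicator_def PiE_iff A'_def prod_zero_iff)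
      qed
      finally show ?thesis by simp
    qed
    have "measure P (Pi\<^sub>E I A) = measure Q (Pi\<^sub>E I A)"
      unfolding m[OF assms(2) P] m[OF assms(3) Q] by (rule *[OF order_refl A'])
    then show ?thesis by (simp add: P.emeasure_eq_measure Q.emeasure_eq_measure)
  qed
  show ?thesis
  proof (rule measure_eqI_PiM_finite[OF I P Q, of "\<lambda>_. Pi\<^sub>E I (\<lambda>_. UNIV)"])
    show "range (\<lambda>_::nat. Pi\<^sub>E I (\<lambda>_. UNIV :: real set)) \<subseteq> prod_algebra I (\<lambda>_. borel)"
      using prod_algebraI_finite[OF I, of "\<lambda>_. UNIV" "\<lambda>_. borel"] by auto
  qed (use box in \<open>auto simp: space_PiM\<close>)
qed

section \<open>Standard Gaussian vectors\<close>

abbreviation gauss :: "'i set \<Rightarrow> ('i \<Rightarrow> real) measure" where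
  "gauss I \<equiv> Pi\<^sub>M I (\<lambda>_. std_normal_distribution)"

lemma sets_gauss [measurable_cong]: "sets (gauss I) = sets (Pi\<^sub>M I (\<lambda>_. borel))"
  by (rule sets_PiM_cong) auto

lemma prob_space_std_normal: "prob_space std_normal_distribution"
  using real_dist_normal_dist by (simp add: real_distribution_def)

lemma prob_space_gauss: "prob_space (gauss I)"
  by (intro prob_space_PiM prob_space_std_normal)

lemma gauss_component: "i \<in> I \<Longrightarrow> (\<lambda>z. z i) \<in> borel_measurable (gauss I)"
  by measurable

lemma gauss_char:
  assumes "finite J"
  shows "(LINT z|gauss J. iexp (\<Sum>j\<in>J. c j * z j)) = complex_of_real (exp (- (\<Sum>j\<in>J. (c j)\<^sup>2) / 2))"
proof -
  interpret N: prob_space std_normal_distribution by (rule prob_space_std_normal)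
  interpret product_prob_space "\<lambda>_. std_normal_distribution" J
    by (intro product_prob_spaceI prob_space_std_normal)
  have i: "integrable std_normal_distribution (\<lambda>x. iexp (c j * x))" for j
    by (rule N.integrable_const_bound[of _ 1]) auto
  have "(LINT z|gauss J. iexp (\<Sum>j\<in>J. c j * z j)) = (LINT z|gauss J. (\<Prod>j\<in>J. iexp (c j * z j)))"
    by (simp add: exp_sum[OF assms] sum_distrib_left)
  also have "\<dots> = (\<Prod>j\<in>J. LINT x|std_normal_distribution. iexp (c j * x))"
    by (rule product_integral_prod[OF assms i])
  also have "\<dots> = (\<Prod>j\<in>J. complex_of_real (exp (- ((c j)\<^sup>2) / 2)))"
    using fun_cong[OF char_std_normal_distribution] by (simp add: char_def)
  also have "\<dots> = complex_of_real (exp (- (\<Sum>j\<in>J. (c j)\<^sup>2) / 2))"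
    by (simp add: exp_sum[OF assms] sum_divide_distrib flip: of_real_prod sum_negf)
  finally show ?thesis .
qed

text \<open>The characteristic function at t only involves the norm of U^T t, and orthonormal rows
  make U^T an isometry. As \<open>J\<close> may be larger than \<open>I\<close>, this covers
  rotations, coordinate selections and unit combinations alike.\<close>

lemma gauss_forms:
  fixes U :: "'i \<Rightarrow> 'j \<Rightarrow> real"
  assumes I: "finite I" and J: "finite J"
    and U: "\<And>i i'. i \<in> I \<Longrightarrow> i' \<in> I \<Longrightarrow> (\<Sum>j\<in>J. U i j * U i' j) = (if i = i' then 1 else 0)"
  shows "distr (gauss J) (Pi\<^sub>M I (\<lambda>_. borel)) (\<lambda>z. \<lambda>i\<in>I. \<Sum>j\<in>J. U i j * z j) = gauss I"
    (is "distr _ _ ?L = _")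
proof (rule PiM_char_unique[OF I])
  interpret J: prob_space "gauss J" by (rule prob_space_gauss)
  have L[measurable]: "?L \<in> gauss J \<rightarrow>\<^sub>M Pi\<^sub>M I (\<lambda>_. borel)" by measurable
  show "prob_space (distr (gauss J) (Pi\<^sub>M I (\<lambda>_. borel)) ?L)" by (rule J.prob_space_distr[OF L])
  fix t :: "'i \<Rightarrow> real"
  have "(LINT y|distr (gauss J) (Pi\<^sub>M I (\<lambda>_. borel)) ?L. iexp (\<Sum>i\<in>I. t i * y i)) =
      (LINT z|gauss J. iexp (\<Sum>i\<in>I. t i * ?L z i))"
    by (subst integral_distr[OF L]) auto
  also have "\<dots> = (LINT z|gauss J. iexp (\<Sum>j\<in>J. (\<Sum>i\<in>I. t i * U i j) * z j))"
  proof -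
    have "(\<Sum>i\<in>I. t i * ?L z i) = (\<Sum>j\<in>J. (\<Sum>i\<in>I. t i * U i j) * z j)" for z :: "'j \<Rightarrow> real"
      by (simp add: sum_distrib_left sum_distrib_right mult.assoc sum.swap[of _ J I])
    then show ?thesis by presburger
  qed
  also have "\<dots> = complex_of_real (exp (- (\<Sum>j\<in>J. (\<Sum>i\<in>I. t i * U i j)\<^sup>2) / 2))"
    by (rule gauss_char[OF J])
  also have "(\<Sum>j\<in>J. (\<Sum>i\<in>I. t i * U i j)\<^sup>2) = (\<Sum>i\<in>I. (t i)\<^sup>2)"
  proof -
    have "(\<Sum>j\<in>J. (\<Sum>i\<in>I. t i * U i j)\<^sup>2) = (\<Sum>j\<in>J. \<Sum>i\<in>I. \<Sum>i'\<in>I. t i * t i' * (U i j * U i' j))"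
      by (simp add: power2_eq_square sum_product mult_ac)
    also have "\<dots> = (\<Sum>i\<in>I. \<Sum>i'\<in>I. t i * t i' * (\<Sum>j\<in>J. U i j * U i' j))"
      by (subst sum.swap, rule sum.cong[OF refl], subst sum.swap) (simp add: sum_distrib_left)
    also have "\<dots> = (\<Sum>i\<in>I. \<Sum>i'\<in>I. if i = i' then (t i)\<^sup>2 else 0)"
      by (intro sum.cong refl) (simp add: U power2_eq_square)
    also have "\<dots> = (\<Sum>i\<in>I. (t i)\<^sup>2)" using I by simp
    finally show ?thesis .
  qed
  also have "complex_of_real (exp (- (\<Sum>i\<in>I. (t i)\<^sup>2) / 2)) = (LINT y|gauss I. iexp (\<Sum>i\<in>I. t i * y i))"
    by (rule gauss_char[OF I, symmetric])
  finally show "(LINT y|distr (gauss J) (Pi\<^sub>M I (\<lambda>_. borel)) ?L. iexp (\<Sum>i\<in>I. t i * y i)) =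
      (LINT y|gauss I. iexp (\<Sum>i\<in>I. t i * y i))" .
qed (auto simp: sets_gauss prob_space_gauss)

text \<open>Splits one Gaussian family over a disjoint sum into an independent pair. The gluing map
  \<open>h\<close> in the opposite direction is compared with the product law on boxes and then
  inverted.\<close>

lemma distr_gauss_Plus:
  fixes I :: "'i set" and J :: "'j set"
  assumes I: "finite I" and J: "finite J"
  shows "distr (gauss (I <+> J)) (Pi\<^sub>M I (\<lambda>_. borel) \<Otimes>\<^sub>M Pi\<^sub>M J (\<lambda>_. borel))
      (\<lambda>w. (\<lambda>i\<in>I. w (Inl i), \<lambda>j\<in>J. w (Inr j))) = gauss I \<Otimes>\<^sub>M gauss J"
proof -
  interpret GJ: prob_space "gauss J" by (rule prob_space_gauss)
  interpret P: product_prob_space "\<lambda>_::'i + 'j. std_normal_distribution" "I <+> J"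
    by (intro product_prob_spaceI prob_space_std_normal)
  interpret PI: product_prob_space "\<lambda>_::'i. std_normal_distribution" I
    by (intro product_prob_spaceI prob_space_std_normal)
  interpret PJ: product_prob_space "\<lambda>_::'j. std_normal_distribution" J
    by (intro product_prob_spaceI prob_space_std_normal)
  define h where "h = (\<lambda>(a, b). \<lambda>s\<in>I <+> J. case_sum a b s :: real)"
  have h[measurable]: "h \<in> gauss I \<Otimes>\<^sub>M gauss J \<rightarrow>\<^sub>M gauss (I <+> J)"
    unfolding h_def case_prod_beta
    by (rule measurable_restrict) (auto split: sum.split intro!: measurable_compose[OF measurable_fst] measurable_compose[OF measurable_snd])
  have u[measurable]: "(\<lambda>w. (\<lambda>i\<in>I. w (Inl i), \<lambda>j\<in>J. w (Inr j)))
      \<in> gauss (I <+> J) \<rightarrow>\<^sub>M Pi\<^sub>M I (\<lambda>_. borel) \<Otimes>\<^sub>M Pi\<^sub>M J (\<lambda>_. borel)"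
    by (intro measurable_Pair measurable_restrict)
       (auto intro: gauss_component)
  have "distr (gauss I \<Otimes>\<^sub>M gauss J) (gauss (I <+> J)) h = gauss (I <+> J)"
  proof (rule P.PiM_eqI)
    fix A :: "'i + 'j \<Rightarrow> real set"
    assume A: "\<And>i. i \<in> I <+> J \<Longrightarrow> A i \<in> sets std_normal_distribution"
    have "h -` Pi\<^sub>E (I <+> J) A \<inter> space (gauss I \<Otimes>\<^sub>M gauss J) =
        Pi\<^sub>E I (A \<circ> Inl) \<times> Pi\<^sub>E J (A \<circ> Inr)"
      by (auto simp: h_def space_pair_measure space_PiM PiE_iff Ball_def split: sum.splits) fastforce+
    moreover have sets: "Pi\<^sub>E I (A \<circ> Inl) \<in> sets (gauss I)" "Pi\<^sub>E J (A \<circ> Inr) \<in> sets (gauss J)"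
        "Pi\<^sub>E (I <+> J) A \<in> sets (gauss (I <+> J))"
      using A I J by (auto intro!: sets_PiM_I_finite simp: InlI InrI)
    moreover have "emeasure (gauss I) (Pi\<^sub>E I (A \<circ> Inl)) = (\<Prod>i\<in>I. emeasure std_normal_distribution (A (Inl i)))"
        "emeasure (gauss J) (Pi\<^sub>E J (A \<circ> Inr)) = (\<Prod>j\<in>J. emeasure std_normal_distribution (A (Inr j)))"
      using A I J by (simp_all add: PI.emeasure_PiM PJ.emeasure_PiM InlI InrI)
    ultimately show "emeasure (distr (gauss I \<Otimes>\<^sub>M gauss J) (gauss (I <+> J)) h) (Pi\<^sub>E (I <+> J) A) =
        (\<Prod>i\<in>I <+> J. emeasure std_normal_distribution (A i))"
      using I J by (simp add: emeasure_distr GJ.emeasure_pair_measure_Times prod.Plus comp_def)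
  qed (use I J in auto)
  then have "distr (gauss (I <+> J)) (Pi\<^sub>M I (\<lambda>_. borel) \<Otimes>\<^sub>M Pi\<^sub>M J (\<lambda>_. borel))
      (\<lambda>w. (\<lambda>i\<in>I. w (Inl i), \<lambda>j\<in>J. w (Inr j))) =
      distr (distr (gauss I \<Otimes>\<^sub>M gauss J) (gauss (I <+> J)) h) (Pi\<^sub>M I (\<lambda>_. borel) \<Otimes>\<^sub>M Pi\<^sub>M J (\<lambda>_. borel))
      (\<lambda>w. (\<lambda>i\<in>I. w (Inl i), \<lambda>j\<in>J. w (Inr j)))" by simp
  also have "\<dots> = distr (gauss I \<Otimes>\<^sub>M gauss J) (Pi\<^sub>M I (\<lambda>_. borel) \<Otimes>\<^sub>M Pi\<^sub>M J (\<lambda>_. borel))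
      ((\<lambda>w. (\<lambda>i\<in>I. w (Inl i), \<lambda>j\<in>J. w (Inr j))) \<circ> h)"
    by (rule distr_distr) auto
  also have "\<dots> = distr (gauss I \<Otimes>\<^sub>M gauss J) (gauss I \<Otimes>\<^sub>M gauss J) (\<lambda>p. p)"
  proof (rule distr_cong[OF refl])
    show "sets (Pi\<^sub>M I (\<lambda>_. borel) \<Otimes>\<^sub>M Pi\<^sub>M J (\<lambda>_. borel)) = sets (gauss I \<Otimes>\<^sub>M gauss J)"
      by (intro sets_pair_measure_cong sets_gauss[symmetric])
    fix p assume "p \<in> space (gauss I \<Otimes>\<^sub>M gauss J)"
    then show "((\<lambda>w. (\<lambda>i\<in>I. w (Inl i), \<lambda>j\<in>J. w (Inr j))) \<circ> h) p = p"
      by (cases p) (auto simp: h_def space_pair_measure space_PiM PiE_iff fun_eq_iff extensional_def)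
  qed
  finally show ?thesis by (simp add: distr_id)
qed

text \<open>Two orthonormal families orthogonal to each other are one orthonormal family over
  \<open>I <+> L\<close>; for Gaussian forms this orthogonality is independence.\<close>

lemma gauss_forms_pair:
  fixes U :: "'i \<Rightarrow> 'j \<Rightarrow> real" and V :: "'l \<Rightarrow> 'j \<Rightarrow> real"
  assumes I: "finite I" and L: "finite L" and J: "finite J"
    and U: "\<And>i i'. i \<in> I \<Longrightarrow> i' \<in> I \<Longrightarrow> (\<Sum>j\<in>J. U i j * U i' j) = (if i = i' then 1 else 0)"
    and V: "\<And>l l'. l \<in> L \<Longrightarrow> l' \<in> L \<Longrightarrow> (\<Sum>j\<in>J. V l j * V l' j) = (if l = l' then 1 else 0)"
    and UV: "\<And>i l. i \<in> I \<Longrightarrow> l \<in> L \<Longrightarrow> (\<Sum>j\<in>J. U i j * V l j) = 0"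
  shows "distr (gauss J) (Pi\<^sub>M I (\<lambda>_. borel) \<Otimes>\<^sub>M Pi\<^sub>M L (\<lambda>_. borel))
      (\<lambda>z. (\<lambda>i\<in>I. \<Sum>j\<in>J. U i j * z j, \<lambda>l\<in>L. \<Sum>j\<in>J. V l j * z j)) = gauss I \<Otimes>\<^sub>M gauss L"
proof -
  have "gauss (I <+> L) = distr (gauss J) (Pi\<^sub>M (I <+> L) (\<lambda>_. borel))
      (\<lambda>z. \<lambda>s\<in>I <+> L. \<Sum>j\<in>J. case_sum U V s j * z j)"
    using I L J U V UV
    by (intro gauss_forms[symmetric]) (auto simp: mult.commute[of "V _ _" "U _ _"] split: if_splits)
  note * = arg_cong[OF this, of "\<lambda>M. distr M (Pi\<^sub>M I (\<lambda>_. borel) \<Otimes>\<^sub>M Pi\<^sub>M L (\<lambda>_. borel))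
      (\<lambda>w. (\<lambda>i\<in>I. w (Inl i), \<lambda>j\<in>L. w (Inr j)))"]
  show ?thesis
    unfolding distr_gauss_Plus[OF I L, symmetric] *
    by (subst distr_distr)
       (auto simp: comp_def InlI InrI intro!: distr_cong measurable_Pair measurable_restrict)
qed

text \<open>Fubini: averaging a conditional law that is almost surely the constant D leaves D. Every
  conditioning on a random matrix or signal goes through this.\<close>

lemma distr_pair_kernel:
  assumes "prob_space P" "prob_space Q"
    and f[measurable]: "f \<in> P \<Otimes>\<^sub>M Q \<rightarrow>\<^sub>M N" and D: "sets D = sets N"
    and eq: "AE s in P. distr Q N (\<lambda>z. f (s, z)) = D"
  shows "distr (P \<Otimes>\<^sub>M Q) N f = D"
proof (rule measure_eqI)
  interpret P: prob_space P by fact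
  interpret Q: prob_space Q by fact
  fix A assume "A \<in> sets (distr (P \<Otimes>\<^sub>M Q) N f)"
  then have A[measurable]: "A \<in> sets N" by simp
  have "emeasure (distr (P \<Otimes>\<^sub>M Q) N f) A = emeasure (P \<Otimes>\<^sub>M Q) (f -` A \<inter> space (P \<Otimes>\<^sub>M Q))"
    by (simp add: emeasure_distr)
  also have "\<dots> = (\<integral>\<^sup>+s. emeasure Q (Pair s -` (f -` A \<inter> space (P \<Otimes>\<^sub>M Q))) \<partial>P)"
    by (rule Q.emeasure_pair_measure_alt) measurable
  also have "\<dots> = (\<integral>\<^sup>+s. emeasure D A \<partial>P)"
  proof (rule nn_integral_cong_AE)
    show "AE s in P. emeasure Q (Pair s -` (f -` A \<inter> space (P \<Otimes>\<^sub>M Q))) = emeasure D A"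
      using eq AE_space
    proof eventually_elim
      case (elim s)
      have "Pair s -` (f -` A \<inter> space (P \<Otimes>\<^sub>M Q)) = (\<lambda>z. f (s, z)) -` A \<inter> space Q"
        using elim(2) by (auto simp: space_pair_measure)
      then show ?case using elim(2) by (simp add: elim(1)[symmetric] emeasure_distr)
    qed
  qed
  also have "\<dots> = emeasure D A" by (simp add: P.emeasure_space_1)
  finally show "emeasure (distr (P \<Otimes>\<^sub>M Q) N f) A = emeasure D A" .
qed (simp add: D)

section \<open>Least squares by Gram matrices\<close>

text \<open>Spectral decomposition of a projection without eigenvalues: a normalized column with
  positive diagonal entry is a unit vector in the range, and subtracting its rank-one projection
  lowers the trace by one.\<close>

lemma idempotent_decomposition:
  fixes D :: "nat \<Rightarrow> nat \<Rightarrow> real"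
  assumes "\<And>i j. i < n \<Longrightarrow> j < n \<Longrightarrow> D i j = D j i"
    and "\<And>i l. i < n \<Longrightarrow> l < n \<Longrightarrow> (\<Sum>j<n. D i j * D j l) = D i l"
    and "(\<Sum>i<n. D i i) = real r"
  shows "\<exists>u. (\<forall>a<r. \<forall>b<r. (\<Sum>i<n. u a i * u b i) = (if a = b then 1 else 0)) \<and>
      (\<forall>i<n. \<forall>j<n. D i j = (\<Sum>a<r. u a i * u a j))"
  using assms
proof (induction r arbitrary: D)
  case 0
  \<comment> \<open>Idempotence writes each diagonal entry as the sum of squares of its row, so
    trace 0 forces D = 0.\<close>
  have sq: "D i i = (\<Sum>j<n. (D i j)\<^sup>2)" if "i < n" for i
    using 0(2)[OF that that] 0(1) that by (simp add: power2_eq_square)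
  have "\<forall>i\<in>{..<n}. D i i = 0"
    using 0(3) sq by (subst sum_nonneg_eq_0_iff[symmetric]) (auto simp: sum_nonneg)
  then have "D i j = 0" if "i < n" "j < n" for i j
    using sq[OF that(1)] that by (simp add: sum_nonneg_eq_0_iff)
  then show ?case by auto
next
  case (Suc r)
  note sym = Suc.prems(1) and idem = Suc.prems(2)
  have "\<exists>l<n. 0 < D l l"
  proof (rule ccontr)
    assume "\<not> ?thesis"
    then have "(\<Sum>i<n. D i i) \<le> 0" by (intro sum_nonpos) (meson lessThan_iff not_less)
    then show False using Suc.prems(3) by simp
  qed
  then obtain l where l: "l < n" "0 < D l l" by blast
  \<comment> \<open>By idempotence, column l has squared norm D_ll, which explains the
    normalization.\<close>
  define v where "v i = D i l / sqrt (D l l)" for i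
  have vv: "v i * v j = D i l * D j l / D l l" for i j
    using l by (simp add: v_def)
  have v1: "(\<Sum>i<n. v i * v i) = 1"
    using idem[OF l(1) l(1)] l sym by (simp add: vv flip: sum_divide_distrib)
  have Dv: "(\<Sum>j<n. D i j * v j) = v i" if "i < n" for i
    using idem[OF that l(1)] by (simp add: v_def flip: sum_divide_distrib)
  define D' where "D' i j = D i j - v i * v j" for i j
  have vD: "(\<Sum>j<n. v j * D j i) = v i" if "i < n" for i
  proof -
    have "(\<Sum>j<n. v j * D j i) = (\<Sum>j<n. D i j * v j)"
      using that by (intro sum.cong refl) (simp add: sym mult.commute)
    then show ?thesis using Dv that by simp
  qed
  have "\<exists>u. (\<forall>a<r. \<forall>b<r. (\<Sum>i<n. u a i * u b i) = (if a = b then 1 else 0)) \<and>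
      (\<forall>i<n. \<forall>j<n. D' i j = (\<Sum>a<r. u a i * u a j))"
  proof (rule Suc.IH)
    fix i j assume ij: "i < n" "j < n"
    then show "D' i j = D' j i" by (simp add: D'_def sym mult.commute)
    have "(\<Sum>m<n. D' i m * D' m j) = (\<Sum>m<n. D i m * D m j - (D i m * v m) * v j
        - v i * (v m * D m j) + v i * (v m * v m) * v j)"
      by (intro sum.cong refl) (simp add: D'_def algebra_simps)
    also have "\<dots> = D i j - v i * v j - v i * v j + v i * v j"
      using ij by (simp add: sum.distrib sum_subtractf idem Dv vD v1 flip: sum_distrib_left sum_distrib_right)
    finally show "(\<Sum>m<n. D' i m * D' m j) = D' i j" by (simp add: D'_def)
  next
    show "(\<Sum>i<n. D' i i) = real r" using Suc.prems(3) v1 by (simp add: D'_def sum_subtractf)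
  qed
  then obtain u where u1: "\<And>a b. a < r \<Longrightarrow> b < r \<Longrightarrow> (\<Sum>i<n. u a i * u b i) = (if a = b then 1 else 0)"
    and u2: "\<And>i j. i < n \<Longrightarrow> j < n \<Longrightarrow> D' i j = (\<Sum>a<r. u a i * u a j)" by blast
  \<comment> \<open>The squared components of v along the vectors u add up to v . D' v, and D'
    annihilates v.\<close>
  have "(\<Sum>a<r. (\<Sum>i<n. u a i * v i)\<^sup>2) = (\<Sum>i<n. \<Sum>j<n. v i * (\<Sum>a<r. u a i * u a j) * v j)"
    by (simp add: power2_eq_square sum_product sum_distrib_left sum_distrib_right mult_ac
        sum.swap[of _ "{..<n}" "{..<r}"])
  also have "\<dots> = (\<Sum>i<n. v i * (\<Sum>j<n. D' i j * v j))"
    by (simp add: u2[symmetric] sum_distrib_left mult.assoc)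
  also have "\<dots> = 0"
  proof -
    have "(\<Sum>j<n. D' i j * v j) = 0" if "i < n" for i
      using Dv[OF that] v1 by (simp add: D'_def left_diff_distrib sum_subtractf mult.assoc flip: sum_distrib_left)
    then show ?thesis by simp
  qed
  finally have uv: "(\<Sum>i<n. u a i * v i) = 0" if "a < r" for a
    using that by (simp add: sum_nonneg_eq_0_iff)
  define u' where "u' a = (if a < r then u a else v)" for a
  have "(\<Sum>i<n. u' a i * u' b i) = (if a = b then 1 else 0)" if "a < Suc r" "b < Suc r" for a b
    using that u1 uv v1 by (auto simp: u'_def mult.commute[of "v _" "u _ _"])
  moreover have "D i j = (\<Sum>a<Suc r. u' a i * u' a j)" if "i < n" "j < n" for i j
    using u2[OF that] by (simp add: u'_def D'_def)
  ultimately show ?case by blast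
qed

section \<open>Least squares by Cramer's rule\<close>

definition gram :: "nat \<Rightarrow> nat \<Rightarrow> (nat \<times> nat \<Rightarrow> real) \<Rightarrow> real Matrix.mat" where
  "gram n k w = mat k k (\<lambda>(a, b). \<Sum>i<n. w (i, a) * w (i, b))"

text \<open>Entry (a, i) of (W^T W)^-1 W^T, with the inverse as adjugate over determinant. It is a
  quotient of polynomials in the entries, hence measurable, and 0 where the determinant
  vanishes.\<close>

definition lsinv :: "nat \<Rightarrow> nat \<Rightarrow> (nat \<times> nat \<Rightarrow> real) \<Rightarrow> nat \<Rightarrow> nat \<Rightarrow> real" where
  "lsinv n k w a i = (\<Sum>b<k. adj_mat (gram n k w) $$ (a, b) * w (i, b)) / Determinant.det (gram n k w)"

definition lscoef :: "nat \<Rightarrow> nat \<Rightarrow> (nat \<times> nat \<Rightarrow> real) \<Rightarrow> (nat \<Rightarrow> real) \<Rightarrow> nat \<Rightarrow> real" where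
  "lscoef n k w z a = (\<Sum>i<n. lsinv n k w a i * z i)"

text \<open>For a nonzero Gram determinant this is the component of z orthogonal to the
  columns.\<close>

definition lsres :: "nat \<Rightarrow> nat \<Rightarrow> (nat \<times> nat \<Rightarrow> real) \<Rightarrow> (nat \<Rightarrow> real) \<Rightarrow> nat \<Rightarrow> real" where
  "lsres n k w z i = z i - (\<Sum>a<k. w (i, a) * lscoef n k w z a)"

lemma gram_carrier [simp]: "gram n k w \<in> carrier_mat k k" "dim_row (gram n k w) = k" "dim_col (gram n k w) = k"
  by (simp_all add: gram_def)

lemma gram_eq: "gram n k w = transpose_mat (mat n k w) * mat n k w"
  by (rule eq_matI) (auto simp: gram_def scalar_prod_def atLeast0LessThan)

lemma gram_cong: "(\<And>i a. i < n \<Longrightarrow> a < k \<Longrightarrow> w (i, a) = w' (i, a)) \<Longrightarrow> gram n k w = gram n k w'"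
  by (rule eq_matI) (auto simp: gram_def)

context
  fixes n k :: nat and w :: "nat \<times> nat \<Rightarrow> real"
  assumes det: "Determinant.det (gram n k w) \<noteq> 0"
begin

text \<open>With X the adjugate of the symmetric G and d the determinant, X^T G X equals both d X
  and d X^T; then d cancels.\<close>

lemma adj_gram_sym: "a < k \<Longrightarrow> b < k \<Longrightarrow> adj_mat (gram n k w) $$ (a, b) = adj_mat (gram n k w) $$ (b, a)"
proof -
  let ?G = "gram n k w" and ?d = "Determinant.det (gram n k w)"
  let ?X = "adj_mat ?G"
  note adj = adj_mat[OF gram_carrier(1)[of n k w]]
  have Gs: "transpose_mat ?G = ?G" by (rule eq_matI) (auto simp: gram_def mult.commute)
  have "transpose_mat ?X * ?G = transpose_mat (?G * ?X)"
    using transpose_mult[OF gram_carrier(1) adj(1)] Gs by simp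
  also have "\<dots> = ?d \<cdot>\<^sub>m 1\<^sub>m k" 
    by (rule eq_matI) (auto simp: adj(2))
  finally have "?d \<cdot>\<^sub>m ?X = (transpose_mat ?X * ?G) * ?X"
    using adj(1) by (simp add: mult_smult_assoc_mat[of _ k k _ k])
  also have "\<dots> = transpose_mat ?X * (?G * ?X)"
    using adj(1) by (intro assoc_mult_mat[where ?n\<^sub>1 = k and ?n\<^sub>2 = k and ?n\<^sub>3 = k and ?n\<^sub>4 = k]) auto
  also have "\<dots> = ?d \<cdot>\<^sub>m transpose_mat ?X"
    using adj(1) by (simp add: adj(2) mult_smult_distrib[of _ k k _ k])
  finally have "?d \<cdot>\<^sub>m ?X = ?d \<cdot>\<^sub>m transpose_mat ?X" .
  then have "(?d \<cdot>\<^sub>m ?X) $$ (a, b) = (?d \<cdot>\<^sub>m transpose_mat ?X) $$ (a, b)" by simp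
  then show "a < k \<Longrightarrow> b < k \<Longrightarrow> ?X $$ (a, b) = ?X $$ (b, a)" using adj(1) det by simp
qed

lemma lsinv_left_inverse:
  assumes "a < k" "c < k"
  shows "(\<Sum>i<n. lsinv n k w a i * w (i, c)) = (if a = c then 1 else 0)"
proof -
  let ?G = "gram n k w" and ?d = "Determinant.det (gram n k w)"
  let ?X = "adj_mat ?G"
  note adj = adj_mat[OF gram_carrier(1)[of n k w]]
  have "(\<Sum>i<n. lsinv n k w a i * w (i, c)) = (\<Sum>b<k. ?X $$ (a, b) * (\<Sum>i<n. w (i, b) * w (i, c))) / ?d"
    by (simp add: lsinv_def sum_distrib_left sum_distrib_right mult.assoc sum.swap[of _ "{..<n}"]
        flip: sum_divide_distrib)
  also have "(\<Sum>b<k. ?X $$ (a, b) * (\<Sum>i<n. w (i, b) * w (i, c))) = (?X * ?G) $$ (a, c)"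
    using assms adj(1) by (simp add: scalar_prod_def atLeast0LessThan) (simp add: gram_def)
  also have "\<dots> = (if a = c then ?d else 0)" using assms by (simp add: adj(3))
  finally show ?thesis using det by simp
qed

text \<open>Symmetry of the projection W (W^T W)^-1 W^T, inherited from the adjugate.\<close>

lemma lsinv_proj_sym: "(\<Sum>a<k. w (i, a) * lsinv n k w a j) = (\<Sum>a<k. w (j, a) * lsinv n k w a i)"
proof -
  have "(\<Sum>a<k. \<Sum>b<k. w (i, a) * adj_mat (gram n k w) $$ (a, b) * w (j, b)) =
      (\<Sum>b<k. \<Sum>a<k. w (j, b) * adj_mat (gram n k w) $$ (b, a) * w (i, a))"
    by (subst sum.swap) (intro sum.cong refl, simp add: adj_gram_sym)
  then show ?thesis
    by (simp add: lsinv_def sum_distrib_left mult.assoc flip: sum_divide_distrib)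
qed

text \<open>A nonzero determinant makes G a unit, so \<open>mat_inverse\<close> returns some Y;
  evaluating X G Y both ways gives d Y = X for the adjugate X.\<close>

lemma pinv_eq_lsinv: "pinv (mat n k w) = mat k n (\<lambda>(a, i). lsinv n k w a i)"
proof -
  let ?G = "gram n k w" and ?d = "Determinant.det (gram n k w)"
  let ?X = "adj_mat ?G"
  note adj = adj_mat[OF gram_carrier(1)[of n k w]]
  have "?G \<in> Units (ring_mat TYPE(real) k ())"
    by (rule det_non_zero_imp_unit[OF gram_carrier(1) det])
  then obtain Y where Y: "mat_inverse ?G = Some Y"
    using mat_inverse(1)[OF gram_carrier(1)[of n k w], where b = "()"] by (cases "mat_inverse ?G") auto
  note Y' = mat_inverse(2)[OF gram_carrier(1)[of n k w] Y]
  have "?d \<cdot>\<^sub>m Y = (?X * ?G) * Y"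
    using Y' by (auto simp: adj(3) mult_smult_assoc_mat[of _ k k _ k])
  also have "\<dots> = ?X * (?G * Y)"
    using adj(1) Y' by (intro assoc_mult_mat[where ?n\<^sub>1 = k and ?n\<^sub>2 = k and ?n\<^sub>3 = k and ?n\<^sub>4 = k]) auto
  also have "\<dots> = ?X" using Y' adj(1) by simp
  finally have dY: "?d \<cdot>\<^sub>m Y = ?X" .
  have Yc: "Y \<in> carrier_mat k k" using Y' by simp
  have Yab: "Y $$ (a, b) = ?X $$ (a, b) / ?d" if "a < k" "b < k" for a b
  proof -
    have "?d * Y $$ (a, b) = ?X $$ (a, b)"
      using arg_cong[OF dY, of "\<lambda>M. M $$ (a, b)"] carrier_matD[OF Yc] that by simp
    then show ?thesis using det by (simp add: field_simps)
  qed
  show ?thesis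
    unfolding pinv_def gram_eq[symmetric] Y option.sel
    by (rule eq_matI)
       (use Y' in \<open>auto simp: lsinv_def scalar_prod_def atLeast0LessThan Yab sum_divide_distrib\<close>)
qed

text \<open>The normal equations: with P the projection, symmetry of P and the left inverse property
  give W^T P = W^T.\<close>

lemma lsres_orthogonal:
  assumes "c < k"
  shows "(\<Sum>i<n. w (i, c) * lsres n k w z i) = 0"
proof -
  have "(\<Sum>i<n. w (i, c) * (\<Sum>a<k. w (i, a) * lscoef n k w z a)) =
      (\<Sum>j<n. (\<Sum>i<n. (\<Sum>a<k. w (i, a) * lsinv n k w a j) * w (i, c)) * z j)"
    by (simp add: lscoef_def sum_distrib_left sum_distrib_right mult_ac)
       (subst sum.swap[of _ "{..<n}" "{..<n}"], simp add: sum.swap[of _ "{..<k}" "{..<n}"] mult_ac)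
  also have "\<dots> = (\<Sum>j<n. (\<Sum>a<k. w (j, a) * (\<Sum>i<n. lsinv n k w a i * w (i, c))) * z j)"
    by (subst lsinv_proj_sym)
       (simp add: sum_distrib_left sum_distrib_right mult.assoc sum.swap[of _ "{..<k}" "{..<n}"])
  also have "\<dots> = (\<Sum>j<n. w (j, c) * z j)"
    using assms by (simp add: lsinv_left_inverse if_distrib[of "\<lambda>x. _ * x"] cong: if_cong)
  finally show ?thesis by (simp add: lsres_def right_diff_distrib sum_subtractf)
qed

text \<open>I - P is symmetric and idempotent, and cyclicity of the trace gives trace P = k, hence n
  - k vectors. They depend on \<open>w\<close> alone, so that z can be made Gaussian
  afterwards.\<close>

lemma lsres_decomposition:
  assumes "k \<le> n"
  obtains u :: "nat \<Rightarrow> nat \<Rightarrow> real"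
  where "\<And>a b. a < n - k \<Longrightarrow> b < n - k \<Longrightarrow> (\<Sum>i<n. u a i * u b i) = (if a = b then 1 else 0)"
    and "\<And>z. (\<Sum>i<n. (lsres n k w z i)\<^sup>2) = (\<Sum>a<n - k. (\<Sum>i<n. u a i * z i)\<^sup>2)"
proof -
  define P where "P i j = (\<Sum>a<k. w (i, a) * lsinv n k w a j)" for i j
  define D where "D i j = (if i = j then 1 else 0) - P i j" for i j
  have Psym: "P i j = P j i" for i j unfolding P_def by (rule lsinv_proj_sym)
  have PP: "(\<Sum>j<n. P i j * P j l) = P i l" for i l
  proof -
    have "(\<Sum>j<n. P i j * P j l) =
        (\<Sum>a<k. \<Sum>c<k. w (i, a) * ((\<Sum>j<n. lsinv n k w a j * w (j, c)) * lsinv n k w c l))"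
      unfolding P_def sum_product
      by (subst sum.swap, rule sum.cong[OF refl], subst sum.swap)
         (simp add: sum_distrib_left sum_distrib_right mult.assoc)
    also have "\<dots> = P i l"
      by (simp add: lsinv_left_inverse P_def if_distrib[of "\<lambda>x. x * _"] if_distrib[of "\<lambda>x. _ * x"] cong: if_cong)
    finally show ?thesis .
  qed
  have Dz: "lsres n k w z i = (\<Sum>j<n. D i j * z j)" if "i < n" for z i
  proof -
    have "(\<Sum>a<k. w (i, a) * lscoef n k w z a) = (\<Sum>j<n. P i j * z j)"
      by (simp add: lscoef_def P_def sum_distrib_left sum_distrib_right mult.assoc sum.swap[of _ "{..<k}"])
    moreover have "(\<Sum>j<n. (if i = j then 1 else 0) * z j) = z i"
      using that by (simp add: if_distrib[of "\<lambda>x. x * _"] cong: if_cong)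
    ultimately show ?thesis by (simp add: lsres_def D_def left_diff_distrib sum_subtractf)
  qed
  have Dsym: "D i j = D j i" for i j by (simp add: D_def Psym)
  have DD: "(\<Sum>j<n. D i j * D j l) = D i l" if "i < n" "l < n" for i l
  proof -
    have "(\<Sum>j<n. D i j * D j l) = (\<Sum>j<n. (if i = j then (if j = l then 1 else 0) else 0)
        - (if j = l then P i j else 0) - (if i = j then P j l else 0) + P i j * P j l)"
      by (intro sum.cong refl) (simp add: D_def algebra_simps)
    also have "\<dots> = D i l"
      using that by (simp add: sum.distrib sum_subtractf PP D_def)
    finally show ?thesis .
  qed
  have tr: "(\<Sum>i<n. D i i) = real (n - k)"
  proof -
    have "(\<Sum>i<n. P i i) = (\<Sum>a<k. \<Sum>i<n. lsinv n k w a i * w (i, a))"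
      by (subst sum.swap) (simp add: P_def mult.commute)
    also have "\<dots> = real k" by (simp add: lsinv_left_inverse)
    finally show ?thesis using assms by (simp add: D_def sum_subtractf of_nat_diff)
  qed
  from idempotent_decomposition[of n D "n - k", OF Dsym DD tr]
  obtain u where u1: "\<And>a b. a < n - k \<Longrightarrow> b < n - k \<Longrightarrow> (\<Sum>i<n. u a i * u b i) = (if a = b then 1 else 0)"
    and u2: "\<And>i j. i < n \<Longrightarrow> j < n \<Longrightarrow> D i j = (\<Sum>a<n-k. u a i * u a j)" by blast
  have "(\<Sum>i<n. (lsres n k w z i)\<^sup>2) = (\<Sum>a<n - k. (\<Sum>i<n. u a i * z i)\<^sup>2)" for z
  proof -
    have "(\<Sum>i<n. (lsres n k w z i)\<^sup>2) = (\<Sum>i<n. (\<Sum>j<n. D i j * z j) * (\<Sum>l<n. D i l * z l))"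
      by (simp add: Dz power2_eq_square)
    \<comment> \<open>By symmetry the inner sum is entry (j, l) of D^2, which idempotence reduces to
      D.\<close>
    also have "\<dots> = (\<Sum>j<n. \<Sum>l<n. z j * (\<Sum>i<n. D j i * D i l) * z l)"
      unfolding sum_product
      by (subst sum.swap, rule sum.cong[OF refl], subst sum.swap)
         (simp add: sum_distrib_left sum_distrib_right mult_ac Dsym[of _ "_::nat"])
    also have "\<dots> = (\<Sum>j<n. \<Sum>l<n. z j * (\<Sum>a<n-k. u a j * u a l) * z l)"
      by (intro sum.cong refl, subst DD) (simp_all add: u2)
    also have "\<dots> = (\<Sum>a<n - k. (\<Sum>i<n. u a i * z i)\<^sup>2)"
      by (simp add: power2_eq_square sum_product sum_distrib_left sum_distrib_right mult_ac
          sum.swap[of _ "{..<n}" "{..<n - k}"])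
    finally show ?thesis .
  qed
  with u1 that show thesis by blast
qed

end

section \<open>Full rank and orthogonal changes of the columns\<close>

lemma det_gram_neq_0:
  assumes "\<And>v a. (\<And>i. i < n \<Longrightarrow> (\<Sum>a<k. w (i, a) * v a) = 0) \<Longrightarrow> a < k \<Longrightarrow> v a = 0"
  shows "Determinant.det (gram n k w) \<noteq> 0"
proof
  assume "Determinant.det (gram n k w) = 0"
  then obtain v where v: "v \<in> carrier_vec k" "v \<noteq> 0\<^sub>v k" "gram n k w *\<^sub>v v = 0\<^sub>v k"
    using det_0_iff_vec_prod_zero_field[OF gram_carrier(1)] by blast
  have G: "(\<Sum>b<k. (\<Sum>i<n. w (i, a) * w (i, b)) * v $ b) = 0" if "a < k" for a
    using arg_cong[OF v(3), of "\<lambda>u. u $ a"] that v(1)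
    by (simp add: scalar_prod_def atLeast0LessThan) (simp add: gram_def)
  \<comment> \<open>The squared norm of W v is v . G v, so a kernel vector of G is one of W.\<close>
  have "(\<Sum>i<n. (\<Sum>a<k. w (i, a) * v $ a)\<^sup>2) =
      (\<Sum>a<k. v $ a * (\<Sum>b<k. (\<Sum>i<n. w (i, a) * w (i, b)) * v $ b))"
    by (simp add: power2_eq_square sum_product sum_distrib_left sum_distrib_right mult_ac
        sum.swap[of _ "{..<n}" "{..<k}"])
  also have "\<dots> = 0" by (simp add: G)
  finally have "(\<Sum>a<k. w (i, a) * v $ a) = 0" if "i < n" for i
    using that by (simp add: sum_nonneg_eq_0_iff)
  from assms[OF this] have "v $ a = 0" if "a < k" for a using that by blast
  with v(1) have "v = 0\<^sub>v k" by (intro eq_vecI) auto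
  with v(2) show False by simp
qed

text \<open>In a linear relation between k + 1 columns, \<open>lsinv\<close> expresses the first k
  coefficients by the last one. The relation then says that the last coefficient times the residual
  of the new column is 0.\<close>

lemma det_gram_Suc:
  assumes det: "Determinant.det (gram n k w) \<noteq> 0"
    and res: "(\<Sum>i<n. (lsres n k w (\<lambda>i. w (i, k)) i)\<^sup>2) \<noteq> 0"
  shows "Determinant.det (gram n (Suc k) w) \<noteq> 0"
proof (rule det_gram_neq_0)
  fix v :: "nat \<Rightarrow> real" and a
  assume 0: "\<And>i. i < n \<Longrightarrow> (\<Sum>a<Suc k. w (i, a) * v a) = 0" and a: "a < Suc k"
  let ?z = "\<lambda>i. w (i, k)"
  have va: "v a = - (v k * lscoef n k w ?z a)" if "a < k" for a
  proof -
    have "0 = (\<Sum>i<n. lsinv n k w a i * 0)" by simp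
    also have "\<dots> = (\<Sum>i<n. lsinv n k w a i * (\<Sum>c<Suc k. w (i, c) * v c))"
      by (intro sum.cong refl arg_cong2[where f = "(*)"] 0[symmetric]) simp
    also have "\<dots> = (\<Sum>c<k. (\<Sum>i<n. lsinv n k w a i * w (i, c)) * v c) + (\<Sum>i<n. lsinv n k w a i * ?z i) * v k"
      by (simp add: sum_distrib_left sum_distrib_right mult.assoc distrib_left sum.distrib
          sum.swap[of _ "{..<n}"])
    also have "\<dots> = v a + lscoef n k w ?z a * v k"
      using that by (simp add: lsinv_left_inverse[OF det] lscoef_def if_distrib[of "\<lambda>x. x * _"] cong: if_cong)
    finally show ?thesis by (simp add: mult.commute)
  qed
  have "v k * lsres n k w ?z i = 0" if "i < n" for i
  proof -
    have "v k * lsres n k w ?z i = (\<Sum>a<Suc k. w (i, a) * v a)"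
      by (simp add: lsres_def right_diff_distrib sum_distrib_left va sum_negf mult_ac)
    then show ?thesis using 0[OF that] by simp
  qed
  then have "v k = 0" using res by (auto intro: ccontr)
  with va a show "v a = 0" by (cases "a = k") auto
qed

text \<open>I - q q^T is a projection of trace m. Its m orthonormal range vectors, followed by q,
  are the columns of Q; orthonormality of the rows is the identity (I - q q^T) + q q^T = I.\<close>

lemma orthogonal_completion:
  fixes q :: "nat \<Rightarrow> real"
  assumes "(\<Sum>l<Suc m. (q l)\<^sup>2) = 1"
  obtains Q :: "nat \<Rightarrow> nat \<Rightarrow> real"
  where "\<And>l. Q l m = q l"
    and "\<And>j j'. j < Suc m \<Longrightarrow> j' < Suc m \<Longrightarrow> (\<Sum>l<Suc m. Q l j * Q l j') = (if j = j' then 1 else 0)"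
    and "\<And>l l'. l < Suc m \<Longrightarrow> l' < Suc m \<Longrightarrow> (\<Sum>j<Suc m. Q l j * Q l' j) = (if l = l' then 1 else 0)"
proof -
  define D where "D i j = (if i = j then 1 else 0) - q i * q j" for i j
  have qq: "(\<Sum>l<Suc m. q l * q l) = 1" using assms by (simp only: power2_eq_square)
  have qD: "(\<Sum>j<Suc m. D i j * q j) = 0" if "i < Suc m" for i
  proof -
    have "(\<Sum>j<Suc m. D i j * q j) = (\<Sum>j<Suc m. (if i = j then q j else 0) - q i * (q j * q j))"
      by (intro sum.cong refl) (simp add: D_def algebra_simps)
    also have "\<dots> = (\<Sum>j<Suc m. (if i = j then q j else 0)) - q i * (\<Sum>j<Suc m. q j * q j)"
      by (simp only: sum_subtractf sum_distrib_left)
    also have "\<dots> = 0" unfolding qq using that by simp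
    finally show ?thesis .
  qed
  have "\<exists>u. (\<forall>a<m. \<forall>b<m. (\<Sum>i<Suc m. u a i * u b i) = (if a = b then 1 else 0)) \<and>
      (\<forall>i<Suc m. \<forall>j<Suc m. D i j = (\<Sum>a<m. u a i * u a j))"
  proof (rule idempotent_decomposition)
    fix i l assume il: "i < Suc m" "l < Suc m"
    show "D i l = D l i" by (simp add: D_def)
    have "(\<Sum>j<Suc m. D i j * D j l) = (\<Sum>j<Suc m. (if j = l then D i j else 0) - D i j * q j * q l)"
      by (intro sum.cong refl) (simp add: D_def algebra_simps)
    also have "\<dots> = (\<Sum>j<Suc m. (if j = l then D i j else 0)) - (\<Sum>j<Suc m. D i j * q j) * q l"
      by (simp only: sum_subtractf sum_distrib_right)
    also have "\<dots> = D i l" unfolding qD[OF il(1)] using il by simp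
    finally show "(\<Sum>j<Suc m. D i j * D j l) = D i l" .
  next
    show "(\<Sum>i<Suc m. D i i) = real m"
      unfolding D_def sum_subtractf qq by simp
  qed
  then obtain u where u1: "\<And>a b. a < m \<Longrightarrow> b < m \<Longrightarrow> (\<Sum>i<Suc m. u a i * u b i) = (if a = b then 1 else 0)"
    and u2: "\<And>i j. i < Suc m \<Longrightarrow> j < Suc m \<Longrightarrow> D i j = (\<Sum>a<m. u a i * u a j)" by blast
  \<comment> \<open>The components of q along the vectors u vanish because D q = 0.\<close>
  have "(\<Sum>a<m. (\<Sum>i<Suc m. u a i * q i)\<^sup>2) = (\<Sum>i<Suc m. q i * (\<Sum>j<Suc m. (\<Sum>a<m. u a i * u a j) * q j))"
    unfolding power2_eq_square sum_product sum_distrib_left sum_distrib_right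
    by (subst sum.swap, rule sum.cong[OF refl], subst sum.swap) (simp only: mult_ac)
  also have "\<dots> = (\<Sum>i<Suc m. q i * (\<Sum>j<Suc m. D i j * q j))"
    by (intro sum.cong refl arg_cong2[where f = "(*)"]) (simp add: u2)
  also have "\<dots> = (\<Sum>i<Suc m. q i * 0)"
    by (intro sum.cong refl arg_cong2[where f = "(*)"] qD) simp
  finally have "(\<Sum>a<m. (\<Sum>i<Suc m. u a i * q i)\<^sup>2) = 0" by simp
  then have uq: "(\<Sum>i<Suc m. u a i * q i) = 0" if "a < m" for a
    using that by (subst (asm) sum_nonneg_eq_0_iff) (auto simp del: sum.lessThan_Suc)
  define Q where "Q l j = (if j < m then u j l else q l)" for l j
  show thesis
  proof (rule that[of Q])
    show "Q l m = q l" for l by (simp add: Q_def)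
    show "(\<Sum>l<Suc m. Q l j * Q l j') = (if j = j' then 1 else 0)" if "j < Suc m" "j' < Suc m" for j j'
      using that[unfolded less_Suc_eq] u1 uq qq unfolding Q_def
      by (auto simp: mult.commute[of "q _" "u _ _"] simp del: sum.lessThan_Suc)
    show "(\<Sum>j<Suc m. Q l j * Q l' j) = (if l = l' then 1 else 0)" if "l < Suc m" "l' < Suc m" for l l'
      using u2[OF that] by (simp add: Q_def D_def)
  qed
qed

lemma lsinv_comb_in_span:
  "(\<Sum>a<k. \<zeta> a * lsinv n k w a i) =
    (\<Sum>b<k. w (i, b) * (\<Sum>a<k. \<zeta> a * adj_mat (gram n k w) $$ (a, b) / Determinant.det (gram n k w)))"
  unfolding lsinv_def sum_divide_distrib sum_distrib_left
  by (subst sum.swap) (simp add: mult_ac)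

text \<open>A vector in the span that is orthogonal to the first m columns is a multiple of the
  residual r of the last one. The product follows from |v|^2 = a_m s and s = v . r = a_m
  |r|^2.\<close>

lemma dual_vector_norm:
  fixes C :: "nat \<times> nat \<Rightarrow> real"
  assumes det: "Determinant.det (gram n m C) \<noteq> 0"
    and v: "\<And>i. i < n \<Longrightarrow> v i = (\<Sum>j<Suc m. C (i, j) * a j)"
    and Cv: "\<And>j. j < Suc m \<Longrightarrow> (\<Sum>i<n. C (i, j) * v i) = (if j = m then s else 0)"
  shows "(\<Sum>i<n. (v i)\<^sup>2) * (\<Sum>i<n. (lsres n m C (\<lambda>i. C (i, m)) i)\<^sup>2) = s\<^sup>2"
proof -
  define r where "r = lsres n m C (\<lambda>i. C (i, m))"
  define c where "c = lscoef n m C (\<lambda>i. C (i, m))"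
  have r: "r i = C (i, m) - (\<Sum>j<m. C (i, j) * c j)" for i by (simp add: r_def lsres_def c_def)
  have Cr: "(\<Sum>i<n. C (i, j) * r i) = 0" if "j < m" for j
    unfolding r_def by (rule lsres_orthogonal[OF det that])
  \<comment> \<open>r differs from the last column by a combination of the first m, to which v is
    orthogonal.\<close>
  have vr: "(\<Sum>i<n. v i * r i) = s"
  proof -
    have "(\<Sum>i<n. v i * r i) = (\<Sum>i<n. C (i, m) * v i) - (\<Sum>j<m. c j * (\<Sum>i<n. C (i, j) * v i))"
      by (simp add: r right_diff_distrib sum_subtractf sum_distrib_left mult_ac sum.swap[of _ "{..<m}"])
    then show ?thesis by (simp add: Cv)
  qed
  \<comment> \<open>Expanding v instead, only its coefficient at the last column survives, as r is
    orthogonal to the other columns.\<close>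
  have vr': "(\<Sum>i<n. v i * r i) = a m * (\<Sum>i<n. (r i)\<^sup>2)"
  proof -
    have "(\<Sum>i<n. v i * r i) = (\<Sum>i<n. (\<Sum>j<Suc m. C (i, j) * a j) * r i)" by (simp add: v del: sum.lessThan_Suc)
    also have "\<dots> = (\<Sum>j<m. a j * (\<Sum>i<n. C (i, j) * r i)) + a m * (\<Sum>i<n. C (i, m) * r i)"
      by (simp add: distrib_left distrib_right sum.distrib sum_distrib_left sum_distrib_right mult_ac sum.swap[of _ "{..<m}"])
    also have "\<dots> = a m * (\<Sum>i<n. C (i, m) * r i)" by (simp add: Cr)
    also have "(\<Sum>i<n. C (i, m) * r i) = (\<Sum>i<n. (r i)\<^sup>2) + (\<Sum>j<m. c j * (\<Sum>i<n. C (i, j) * r i))"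
    proof -
      have "C (i, m) = r i + (\<Sum>j<m. C (i, j) * c j)" for i by (simp add: r)
      then have "(\<Sum>i<n. C (i, m) * r i) = (\<Sum>i<n. (r i + (\<Sum>j<m. C (i, j) * c j)) * r i)" by presburger
      also have "\<dots> = (\<Sum>i<n. (r i)\<^sup>2) + (\<Sum>j<m. c j * (\<Sum>i<n. C (i, j) * r i))"
        by (simp add: power2_eq_square distrib_left sum.distrib sum_distrib_left sum_distrib_right mult_ac sum.swap[of _ "{..<m}"])
      finally show ?thesis .
    qed
    finally show ?thesis by (simp add: Cr)
  qed
  have "(\<Sum>i<n. (v i)\<^sup>2) = (\<Sum>i<n. (\<Sum>j<Suc m. C (i, j) * a j) * v i)"
    by (intro sum.cong refl) (simp add: v power2_eq_square del: sum.lessThan_Suc)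
  also have "\<dots> = (\<Sum>j<Suc m. a j * (\<Sum>i<n. C (i, j) * v i))"
    by (simp add: sum_distrib_left sum_distrib_right mult_ac sum.swap[of _ "{..<Suc m}"] del: sum.lessThan_Suc)
  also have "\<dots> = a m * s" by (simp add: Cv)
  finally have "(\<Sum>i<n. (v i)\<^sup>2) = a m * s" .
  then show ?thesis using vr vr' unfolding r_def by (simp add: power2_eq_square mult_ac)
qed

text \<open>The vector v = W G^-1 zeta has squared norm zeta . G^-1 zeta and satisfies W^T v = zeta.
  For the rotated columns C = W Q this reads C^T v = Q^T zeta, which is s times the last basis
  vector, so \<open>dual_vector_norm\<close> applies to C.\<close>

lemma lsinv_rotate:
  fixes Q :: "nat \<Rightarrow> nat \<Rightarrow> real" and m :: nat
  defines "C \<equiv> \<lambda>w (i, j). \<Sum>l<Suc m. w (i, l) * Q l j"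
  assumes det: "Determinant.det (gram n (Suc m) w) \<noteq> 0" and det': "Determinant.det (gram n m (C w)) \<noteq> 0"
    and Q: "\<And>l. l < Suc m \<Longrightarrow> s * Q l m = \<zeta> l"
    and Q1: "\<And>j j'. j < Suc m \<Longrightarrow> j' < Suc m \<Longrightarrow> (\<Sum>l<Suc m. Q l j * Q l j') = (if j = j' then 1 else 0)"
    and Q2: "\<And>l l'. l < Suc m \<Longrightarrow> l' < Suc m \<Longrightarrow> (\<Sum>j<Suc m. Q l j * Q l' j) = (if l = l' then 1 else 0)"
  shows "(\<Sum>i<n. (\<Sum>a<Suc m. \<zeta> a * lsinv n (Suc m) w a i)\<^sup>2) *
      (\<Sum>i<n. (lsres n m (C w) (\<lambda>i. C w (i, m)) i)\<^sup>2) = s\<^sup>2"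
proof (rule dual_vector_norm[OF det'])
  define x where "x b = (\<Sum>a<Suc m. \<zeta> a * adj_mat (gram n (Suc m) w) $$ (a, b) / Determinant.det (gram n (Suc m) w))" for b
  \<comment> \<open>The rows of Q are orthonormal, so W = C Q^T and the span of the columns is
    unchanged.\<close>
  have w: "w (i, b) = (\<Sum>j<Suc m. C w (i, j) * Q b j)" if "b < Suc m" for i b
  proof -
    have "(\<Sum>j<Suc m. C w (i, j) * Q b j) = (\<Sum>l<Suc m. w (i, l) * (\<Sum>j<Suc m. Q l j * Q b j))"
      unfolding C_def prod.case sum_distrib_left sum_distrib_right
      by (subst sum.swap) (simp only: mult.assoc)
    also have "\<dots> = (\<Sum>l<Suc m. if l = b then w (i, l) else 0)"
      using that by (intro sum.cong refl) (simp add: Q2 del: sum.lessThan_Suc)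
    finally show ?thesis using that by simp
  qed
  fix i assume "i < n"
  have "(\<Sum>a<Suc m. \<zeta> a * lsinv n (Suc m) w a i) = (\<Sum>b<Suc m. w (i, b) * x b)"
    unfolding x_def by (rule lsinv_comb_in_span)
  also have "\<dots> = (\<Sum>b<Suc m. (\<Sum>j<Suc m. C w (i, j) * Q b j) * x b)"
    by (intro sum.cong refl) (simp add: w del: sum.lessThan_Suc)
  also have "\<dots> = (\<Sum>j<Suc m. C w (i, j) * (\<Sum>b<Suc m. Q b j * x b))"
    unfolding sum_distrib_left sum_distrib_right by (subst sum.swap) (simp only: mult.assoc)
  finally show "(\<Sum>a<Suc m. \<zeta> a * lsinv n (Suc m) w a i) = (\<Sum>j<Suc m. C w (i, j) * (\<Sum>b<Suc m. Q b j * x b))" .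
next
  fix j assume j: "j < Suc m"
  have "(\<Sum>i<n. C w (i, j) * (\<Sum>a<Suc m. \<zeta> a * lsinv n (Suc m) w a i)) =
      (\<Sum>l<Suc m. Q l j * (\<Sum>a<Suc m. \<zeta> a * (\<Sum>i<n. lsinv n (Suc m) w a i * w (i, l))))"
    unfolding C_def prod.case sum_product
    by (unfold sum_distrib_left, subst sum.swap, rule sum.cong[OF refl], subst sum.swap) (simp only: mult_ac)
  also have "\<dots> = (\<Sum>l<Suc m. Q l j * \<zeta> l)"
  proof (rule sum.cong[OF refl])
    fix l assume l: "l \<in> {..<Suc m}"
    have "(\<Sum>a<Suc m. \<zeta> a * (\<Sum>i<n. lsinv n (Suc m) w a i * w (i, l))) = (\<Sum>a<Suc m. if a = l then \<zeta> a else 0)"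
      using l by (intro sum.cong refl) (simp add: lsinv_left_inverse[OF det])
    also have "\<dots> = \<zeta> l" using l by simp
    finally show "Q l j * (\<Sum>a<Suc m. \<zeta> a * (\<Sum>i<n. lsinv n (Suc m) w a i * w (i, l))) = Q l j * \<zeta> l"
      by simp
  qed
  also have "\<dots> = s * (\<Sum>l<Suc m. Q l j * Q l m)"
    unfolding sum_distrib_left by (intro sum.cong refl) (simp flip: Q)
  also have "\<dots> = (if j = m then s else 0)" using j by (simp add: Q1 del: sum.lessThan_Suc)
  finally show "(\<Sum>i<n. C w (i, j) * (\<Sum>a<Suc m. \<zeta> a * lsinv n (Suc m) w a i)) = (if j = m then s else 0)" .
qed

section \<open>Distribution of least-squares residuals\<close>

lemma borel_measurable_det:
  fixes X :: "'a \<Rightarrow> real Matrix.mat"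
  assumes c: "\<And>x. X x \<in> carrier_mat k k"
    and [measurable]: "\<And>i j. i < k \<Longrightarrow> j < k \<Longrightarrow> (\<lambda>x. X x $$ (i, j)) \<in> borel_measurable M"
  shows "(\<lambda>x. Determinant.det (X x)) \<in> borel_measurable M"
  unfolding det_def'[OF c]
  by (intro borel_measurable_sum borel_measurable_times borel_measurable_prod borel_measurable_const assms(2))
     (auto simp: permutes_in_image)

context
  fixes W :: "'a \<Rightarrow> nat \<times> nat \<Rightarrow> real" and M :: "'a measure" and n k :: nat
  assumes W: "\<And>i a. i < n \<Longrightarrow> a < k \<Longrightarrow> (\<lambda>x. W x (i, a)) \<in> borel_measurable M"
begin

lemma borel_measurable_gram_entry:
  "a < k \<Longrightarrow> b < k \<Longrightarrow> (\<lambda>x. gram n k (W x) $$ (a, b)) \<in> borel_measurable M"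
  using W by (auto simp: gram_def intro!: borel_measurable_sum borel_measurable_times)

lemma borel_measurable_det_gram: "(\<lambda>x. Determinant.det (gram n k (W x))) \<in> borel_measurable M"
  by (rule borel_measurable_det[OF gram_carrier(1) borel_measurable_gram_entry])

lemma borel_measurable_lsinv:
  assumes "a < k" "i < n"
  shows "(\<lambda>x. lsinv n k (W x) a i) \<in> borel_measurable M"
proof -
  have "(\<lambda>x. adj_mat (gram n k (W x)) $$ (a, b)) \<in> borel_measurable M" if b: "b < k" for b
  proof -
    have "(\<lambda>x. Determinant.det (mat_delete (gram n k (W x)) b a)) \<in> borel_measurable M"
      using assms b
      by (intro borel_measurable_det[where k = "k - 1"] mat_delete_carrier gram_carrier)
         (auto simp: mat_delete_def intro!: borel_measurable_gram_entry)
    then show ?thesis using assms b by (simp add: adj_mat_def cofactor_def)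
  qed
  then show ?thesis
    unfolding lsinv_def using assms
    by (intro borel_measurable_divide borel_measurable_det_gram borel_measurable_sum borel_measurable_times W) auto
qed

context
  fixes Z :: "'a \<Rightarrow> nat \<Rightarrow> real"
  assumes Z: "\<And>i. i < n \<Longrightarrow> (\<lambda>x. Z x i) \<in> borel_measurable M"
begin

lemma borel_measurable_lscoef: "a < k \<Longrightarrow> (\<lambda>x. lscoef n k (W x) (Z x) a) \<in> borel_measurable M"
  unfolding lscoef_def by (intro borel_measurable_sum borel_measurable_times borel_measurable_lsinv Z) auto

lemma borel_measurable_lsres: "i < n \<Longrightarrow> (\<lambda>x. lsres n k (W x) (Z x) i) \<in> borel_measurable M"
  unfolding lsres_def
  by (intro borel_measurable_diff borel_measurable_sum borel_measurable_times borel_measurable_lscoef Z W) auto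

lemma borel_measurable_lscoef_sq: "(\<lambda>x. \<Sum>a<k. (lscoef n k (W x) (Z x) a)\<^sup>2) \<in> borel_measurable M"
  by (intro borel_measurable_sum borel_measurable_power borel_measurable_lscoef) auto

lemma borel_measurable_lsres_sq: "(\<lambda>x. \<Sum>i<n. (lsres n k (W x) (Z x) i)\<^sup>2) \<in> borel_measurable M"
  by (intro borel_measurable_sum borel_measurable_power borel_measurable_lsres) auto

end

end

context
  fixes n k :: nat and w w' :: "nat \<times> nat \<Rightarrow> real" and z z' :: "nat \<Rightarrow> real"
  assumes ww': "\<And>i a. i < n \<Longrightarrow> a < k \<Longrightarrow> w (i, a) = w' (i, a)"
begin

lemma lsinv_cong: "i < n \<Longrightarrow> lsinv n k w a i = lsinv n k w' a i"
proof -
  have "gram n k w = gram n k w'" by (rule gram_cong) (rule ww')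
  then show "i < n \<Longrightarrow> lsinv n k w a i = lsinv n k w' a i" by (simp add: lsinv_def ww')
qed

lemma lscoef_cong: "(\<And>i. i < n \<Longrightarrow> z i = z' i) \<Longrightarrow> lscoef n k w z a = lscoef n k w' z' a"
  unfolding lscoef_def by (intro sum.cong refl) (simp add: lsinv_cong)

lemma lsres_cong: "(\<And>i. i < n \<Longrightarrow> z i = z' i) \<Longrightarrow> i < n \<Longrightarrow> lsres n k w z i = lsres n k w' z' i"
  unfolding lsres_def using lscoef_cong by (simp add: ww')

end

section \<open>Chi-squared laws of residuals and almost sure full rank\<close>

lemma sets_chi_squared [measurable_cong, simp]: "sets (chi_squared s) = sets borel"
  by (simp add: chi_squared_def)

lemma prob_space_chi_squared: "prob_space (chi_squared s)"
  unfolding chi_squared_def by (intro prob_space.prob_space_distr prob_space_gauss) measurable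

lemma AE_std_normal_neq_0: "AE x in std_normal_distribution. x \<noteq> 0"
proof -
  have "AE x in lborel. x \<noteq> (0::real)" by (rule AE_lborel_singleton)
  then show ?thesis by (subst AE_density) auto
qed

lemma AE_gauss_sq_neq_0:
  fixes s :: nat
  assumes "s > 0"
  shows "AE z in gauss {..<s}. (\<Sum>i<s. (z i)\<^sup>2) \<noteq> 0"
proof -
  have "AE z in gauss {..<s}. z 0 \<noteq> 0"
    by (rule AE_PiM_component[OF prob_space_std_normal]) (use assms AE_std_normal_neq_0 in auto)
  then show ?thesis
  proof eventually_elim
    case (elim z)
    then show ?case
      using assms sum_nonneg_eq_0_iff[of "{..<s}" "\<lambda>i. (z i)\<^sup>2"] by auto
  qed
qed

lemma AE_chi_squared_neq_0: "s > 0 \<Longrightarrow> AE x in chi_squared s. x \<noteq> 0"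
  unfolding chi_squared_def by (subst AE_distr_iff) (auto intro: AE_gauss_sq_neq_0)

lemma chi_squared_forms:
  fixes U :: "nat \<Rightarrow> 'j \<Rightarrow> real"
  assumes J: "finite J"
    and U: "\<And>a b. a < s \<Longrightarrow> b < s \<Longrightarrow> (\<Sum>j\<in>J. U a j * U b j) = (if a = b then 1 else 0)"
  shows "distr (gauss J) borel (\<lambda>z. \<Sum>a<s. (\<Sum>j\<in>J. U a j * z j)\<^sup>2) = chi_squared s"
proof -
  have *: "distr (gauss J) (Pi\<^sub>M {..<s} (\<lambda>_. borel)) (\<lambda>z. \<lambda>a\<in>{..<s}. \<Sum>j\<in>J. U a j * z j) = gauss {..<s}"
    by (rule gauss_forms) (use J U in auto)
  show ?thesis
    unfolding chi_squared_def *[symmetric]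
    by (subst distr_distr) (auto simp: comp_def intro!: distr_cong)
qed

lemma chi_squared_lsres:
  assumes "Determinant.det (gram n k w) \<noteq> 0" "k \<le> n"
  shows "distr (gauss {..<n}) borel (\<lambda>z. \<Sum>i<n. (lsres n k w z i)\<^sup>2) = chi_squared (n - k)"
proof -
  obtain u :: "nat \<Rightarrow> nat \<Rightarrow> real"
    where u1: "\<And>a b. a < n - k \<Longrightarrow> b < n - k \<Longrightarrow> (\<Sum>i<n. u a i * u b i) = (if a = b then 1 else 0)"
    and u2: "\<And>z. (\<Sum>i<n. (lsres n k w z i)\<^sup>2) = (\<Sum>a<n - k. (\<Sum>i<n. u a i * z i)\<^sup>2)"
    using lsres_decomposition[OF assms] by blast
  show ?thesis unfolding u2 by (rule chi_squared_forms) (use u1 in auto)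
qed

text \<open>Coordinate selections are forms with coefficients 0 and 1; injectivity and disjoint
  images express their orthonormality.\<close>

lemma distr_gauss_reindex_pair:
  fixes f :: "'i \<Rightarrow> 'j" and g :: "'l \<Rightarrow> 'j"
  assumes "finite J" and f: "inj_on f I" "f ` I \<subseteq> J" and g: "inj_on g L" "g ` L \<subseteq> J" and fg: "f ` I \<inter> g ` L = {}"
  shows "distr (gauss J) (Pi\<^sub>M I (\<lambda>_. borel) \<Otimes>\<^sub>M Pi\<^sub>M L (\<lambda>_. borel))
      (\<lambda>z. (\<lambda>i\<in>I. z (f i), \<lambda>l\<in>L. z (g l))) = gauss I \<Otimes>\<^sub>M gauss L"
proof -
  have fin: "finite I" "finite L"
    using assms finite_subset[of "f ` I" J] finite_subset[of "g ` L" J] by (auto dest: finite_imageD)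
  have "distr (gauss J) (Pi\<^sub>M I (\<lambda>_. borel) \<Otimes>\<^sub>M Pi\<^sub>M L (\<lambda>_. borel))
      (\<lambda>z. (\<lambda>i\<in>I. \<Sum>j\<in>J. (if j = f i then 1 else 0) * z j, \<lambda>l\<in>L. \<Sum>j\<in>J. (if j = g l then 1 else 0) * z j)) =
      gauss I \<Otimes>\<^sub>M gauss L"
    using assms fin
    by (intro gauss_forms_pair)
       (auto simp: if_distrib[of "\<lambda>x. x * _"] inj_on_eq_iff image_subset_iff cong: if_cong)
  moreover have "(\<lambda>z::'j \<Rightarrow> real. (\<lambda>i\<in>I. \<Sum>j\<in>J. (if j = f i then 1 else 0) * z j, \<lambda>l\<in>L. \<Sum>j\<in>J. (if j = g l then 1 else 0) * z j)) =
      (\<lambda>z. (\<lambda>i\<in>I. z (f i), \<lambda>l\<in>L. z (g l)))"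
    using assms
    by (auto simp: fun_eq_iff if_distrib[of "\<lambda>x. x * _"] image_subset_iff restrict_def cong: if_cong)
  ultimately show ?thesis by simp
qed

lemma distr_gauss_last_column:
  fixes n k :: nat
  shows "distr (gauss ({..<n} \<times> {..<Suc k})) (Pi\<^sub>M ({..<n} \<times> {..<k}) (\<lambda>_. borel) \<Otimes>\<^sub>M Pi\<^sub>M {..<n} (\<lambda>_. borel))
    (\<lambda>w. (\<lambda>p\<in>{..<n} \<times> {..<k}. w p, \<lambda>i\<in>{..<n}. w (i, k))) = gauss ({..<n} \<times> {..<k}) \<Otimes>\<^sub>M gauss {..<n}"
  by (rule distr_gauss_reindex_pair) (auto simp: inj_on_def)

text \<open>Columns are added one at a time. The next one is independent of the previous k, and its
  squared residual norm is chi-squared with n - k > 0 degrees of freedom, hence almost surely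
  nonzero.\<close>

lemma AE_det_gram_neq_0:
  "k \<le> n \<Longrightarrow> AE w in gauss ({..<n} \<times> {..<k}). Determinant.det (gram n k w) \<noteq> 0"
proof (induction k)
  case 0
  have "Determinant.det (gram n 0 w) = 1" for w
    using det_dim_zero[OF gram_carrier(1)] by blast
  then show ?case by simp
next
  case (Suc k)
  let ?A = "gauss ({..<n} \<times> {..<k})" and ?Z = "gauss {..<n}"
  interpret Z: prob_space ?Z by (rule prob_space_gauss)
  interpret A: prob_space ?A by (rule prob_space_gauss)
  interpret AZ: pair_prob_space ?A ?Z ..
  have m1: "(\<lambda>p. Determinant.det (gram n k (fst p))) \<in> borel_measurable (?A \<Otimes>\<^sub>M ?Z)"
    by (intro borel_measurable_det_gram measurable_compose[OF measurable_fst] gauss_component) auto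
  have m2: "(\<lambda>p. \<Sum>i<n. (lsres n k (fst p) (snd p) i)\<^sup>2) \<in> borel_measurable (?A \<Otimes>\<^sub>M ?Z)"
    by (intro borel_measurable_lsres_sq measurable_compose[OF measurable_fst] measurable_compose[OF measurable_snd] gauss_component) auto
  have "AE p in ?A \<Otimes>\<^sub>M ?Z. Determinant.det (gram n k (fst p)) \<noteq> 0 \<and> (\<Sum>i<n. (lsres n k (fst p) (snd p) i)\<^sup>2) \<noteq> 0"
  proof (rule AZ.AE_pair_measure)
    show "{p \<in> space (?A \<Otimes>\<^sub>M ?Z). Determinant.det (gram n k (fst p)) \<noteq> 0 \<and>
        (\<Sum>i<n. (lsres n k (fst p) (snd p) i)\<^sup>2) \<noteq> 0} \<in> sets (?A \<Otimes>\<^sub>M ?Z)"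
      using m1 m2 by measurable
    have "AE w in ?A. Determinant.det (gram n k w) \<noteq> 0" using Suc by simp
    then show "AE w in ?A. AE z in ?Z. Determinant.det (gram n k (fst (w, z))) \<noteq> 0 \<and>
        (\<Sum>i<n. (lsres n k (fst (w, z)) (snd (w, z)) i)\<^sup>2) \<noteq> 0"
    proof eventually_elim
      case (elim w)
      have m: "(\<lambda>z. \<Sum>i<n. (lsres n k w z i)\<^sup>2) \<in> borel_measurable ?Z"
        by (intro borel_measurable_lsres_sq gauss_component) auto
      have "AE x in distr ?Z borel (\<lambda>z. \<Sum>i<n. (lsres n k w z i)\<^sup>2). x \<noteq> 0"
        unfolding chi_squared_lsres[OF elim Suc_leD[OF Suc.prems]]
        by (rule AE_chi_squared_neq_0) (use Suc.prems in simp)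
      from AE_distrD[OF m this] show ?case using elim by simp
    qed
  qed
  \<comment> \<open>The product measure is read as the law of the pair (first k columns, last
    column).\<close>
  note * = this[folded distr_gauss_last_column]
  have m: "(\<lambda>w. (\<lambda>p\<in>{..<n} \<times> {..<k}. w p, \<lambda>i\<in>{..<n}. w (i, k))) \<in> gauss ({..<n} \<times> {..<Suc k})
      \<rightarrow>\<^sub>M Pi\<^sub>M ({..<n} \<times> {..<k}) (\<lambda>_. borel) \<Otimes>\<^sub>M Pi\<^sub>M {..<n} (\<lambda>_. borel)"
    by (intro measurable_Pair measurable_restrict gauss_component) auto
  from AE_distrD[OF m *] show ?case
  proof eventually_elim
    case (elim w)
    let ?r = "\<lambda>p\<in>{..<n} \<times> {..<k}. w p"
    have r: "\<And>i a. i < n \<Longrightarrow> a < k \<Longrightarrow> ?r (i, a) = w (i, a)" by simp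
    show ?case
    proof (rule det_gram_Suc)
      show "Determinant.det (gram n k w) \<noteq> 0"
        using elim gram_cong[of n k ?r w] r by simp
      have "(\<Sum>i<n. (lsres n k w (\<lambda>i. w (i, k)) i)\<^sup>2) = (\<Sum>i<n. (lsres n k ?r (\<lambda>i\<in>{..<n}. w (i, k)) i)\<^sup>2)"
        by (intro sum.cong refl arg_cong2[where f = power] lsres_cong) auto
      then show "(\<Sum>i<n. (lsres n k w (\<lambda>i. w (i, k)) i)\<^sup>2) \<noteq> 0" using elim by simp
    qed
  qed
qed

section \<open>Distribution of least-squares coefficients\<close>

lemma measurable_lsres_sq_pair [measurable]:
  "(\<lambda>(w, z). \<Sum>i<n. (lsres n k w z i)\<^sup>2) \<in> borel_measurable (gauss ({..<n} \<times> {..<k}) \<Otimes>\<^sub>M gauss {..<n})"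
  unfolding case_prod_beta
  by (intro borel_measurable_lsres_sq measurable_compose[OF measurable_fst]
      measurable_compose[OF measurable_snd] gauss_component) auto

lemma chi_squared_lsres_pair:
  assumes "k \<le> n"
  shows "distr (gauss ({..<n} \<times> {..<k}) \<Otimes>\<^sub>M gauss {..<n}) borel (\<lambda>(w, z). \<Sum>i<n. (lsres n k w z i)\<^sup>2) =
    chi_squared (n - k)"
proof (rule distr_pair_kernel)
  show "AE w in gauss ({..<n} \<times> {..<k}). distr (gauss {..<n}) borel
      (\<lambda>z. case (w, z) of (w, z) \<Rightarrow> \<Sum>i<n. (lsres n k w z i)\<^sup>2) = chi_squared (n - k)"
    using AE_det_gram_neq_0[OF assms] by eventually_elim (simp add: chi_squared_lsres assms)
qed (auto intro: prob_space_gauss)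

text \<open>Here the fitted column belongs to the same matrix; with m = k - 1 this is the law of
  rho.\<close>

lemma chi_squared_lsres_last_column:
  assumes "m \<le> n"
  shows "distr (gauss ({..<n} \<times> {..<Suc m})) borel (\<lambda>w. \<Sum>i<n. (lsres n m w (\<lambda>i. w (i, m)) i)\<^sup>2) =
    chi_squared (n - m)"
proof -
  have "(\<Sum>i<n. (lsres n m w (\<lambda>i. w (i, m)) i)\<^sup>2) =
      (\<Sum>i<n. (lsres n m (\<lambda>p\<in>{..<n} \<times> {..<m}. w p) (\<lambda>i\<in>{..<n}. w (i, m)) i)\<^sup>2)" for w
    by (intro sum.cong refl arg_cong2[where f = power] lsres_cong) auto
  moreover have "distr (gauss ({..<n} \<times> {..<Suc m})) borel
      (\<lambda>w. \<Sum>i<n. (lsres n m (\<lambda>p\<in>{..<n} \<times> {..<m}. w p) (\<lambda>i\<in>{..<n}. w (i, m)) i)\<^sup>2) = chi_squared (n - m)"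
    unfolding chi_squared_lsres_pair[OF assms, symmetric] distr_gauss_last_column[symmetric]
    by (subst distr_distr)
       (auto simp: comp_def case_prod_beta intro!: measurable_Pair measurable_restrict gauss_component
         borel_measurable_lsres_sq measurable_compose[OF measurable_fst] measurable_compose[OF measurable_snd]
         measurable_component_singleton)
  ultimately show ?thesis by simp
qed

text \<open>Each row is multiplied by a matrix with orthonormal columns, and different rows use
  disjoint sets of variables, so the new entries are orthonormal forms.\<close>

lemma distr_gauss_rotate_columns:
  fixes Q :: "nat \<Rightarrow> nat \<Rightarrow> real" and n k :: nat
  assumes Q: "\<And>j j'. j < k \<Longrightarrow> j' < k \<Longrightarrow> (\<Sum>l<k. Q l j * Q l j') = (if j = j' then 1 else 0)"
  shows "distr (gauss ({..<n} \<times> {..<k})) (Pi\<^sub>M ({..<n} \<times> {..<k}) (\<lambda>_. borel))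
      (\<lambda>w. \<lambda>(i, j)\<in>{..<n} \<times> {..<k}. \<Sum>l<k. w (i, l) * Q l j) = gauss ({..<n} \<times> {..<k})"
proof -
  define U where "U p q = (if fst p = fst q then Q (snd q) (snd p) else 0)" for p q :: "nat \<times> nat"
  have Usum: "(\<Sum>q\<in>{..<n} \<times> {..<k}. U p q * f q) = (\<Sum>l<k. f (fst p, l) * Q l (snd p))"
    if "fst p < n" for p f
  proof -
    have "(\<Sum>q\<in>{..<n} \<times> {..<k}. U p q * f q) =
        (\<Sum>i<n. \<Sum>l<k. if i = fst p then f (i, l) * Q l (snd p) else 0)"
      unfolding sum.cartesian_product by (intro sum.cong refl) (auto simp: U_def)
    also have "\<dots> = (\<Sum>i<n. if i = fst p then \<Sum>l<k. f (i, l) * Q l (snd p) else 0)"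
      by (intro sum.cong refl) auto
    finally show ?thesis using that by simp
  qed
  have "distr (gauss ({..<n} \<times> {..<k})) (Pi\<^sub>M ({..<n} \<times> {..<k}) (\<lambda>_. borel))
      (\<lambda>w. \<lambda>p\<in>{..<n} \<times> {..<k}. \<Sum>q\<in>{..<n} \<times> {..<k}. U p q * w q) = gauss ({..<n} \<times> {..<k})"
  proof (rule gauss_forms)
    fix p p' assume p: "p \<in> {..<n} \<times> {..<k}" "p' \<in> {..<n} \<times> {..<k}"
    have "(\<Sum>q\<in>{..<n} \<times> {..<k}. U p q * U p' q) = (\<Sum>l<k. U p' (fst p, l) * Q l (snd p))"
      by (rule Usum) (use p in auto)
    also have "\<dots> = (if fst p' = fst p then \<Sum>l<k. Q l (snd p') * Q l (snd p) else 0)"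
      by (simp add: U_def)
    also have "\<dots> = (if p = p' then 1 else 0)" using p Q by (auto simp: prod_eq_iff)
    finally show "(\<Sum>q\<in>{..<n} \<times> {..<k}. U p q * U p' q) = (if p = p' then 1 else 0)" .
  qed auto
  moreover have "(\<lambda>p\<in>{..<n} \<times> {..<k}. \<Sum>q\<in>{..<n} \<times> {..<k}. U p q * w q) =
      (\<lambda>(i, j)\<in>{..<n} \<times> {..<k}. \<Sum>l<k. w (i, l) * Q l j)" for w
    by (intro restrict_ext) (auto simp: Usum)
  ultimately show ?thesis by simp
qed

text \<open>The exponent on the left is zeta . G^-1 zeta. A rotation that depends on zeta only turns
  it into |zeta|^2 / rho, and the law of the matrix is invariant under that rotation.\<close>

lemma gauss_dual_vector_char:
  fixes \<zeta> :: "nat \<Rightarrow> real"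
  assumes "m < n"
  shows "(LINT w|gauss ({..<n} \<times> {..<Suc m}).
        complex_of_real (exp (- (\<Sum>i<n. (\<Sum>a<Suc m. \<zeta> a * lsinv n (Suc m) w a i)\<^sup>2) / 2))) =
      (LINT x|chi_squared (n - m). complex_of_real (exp (- ((\<Sum>a<Suc m. (\<zeta> a)\<^sup>2) / x) / 2)))"
    (is "(LINT w|?G. complex_of_real (exp (- ?v w / 2))) = _")
proof -
  interpret G: prob_space ?G by (rule prob_space_gauss)
  define s where "s = sqrt (\<Sum>a<Suc m. (\<zeta> a)\<^sup>2)"
  have s2: "(\<Sum>a<Suc m. (\<zeta> a)\<^sup>2) = s\<^sup>2" by (simp add: s_def sum_nonneg del: sum.lessThan_Suc)
  show ?thesis
  proof (cases "s = 0")
    \<comment> \<open>For zeta = 0 both integrands are the constant 1.\<close>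
    case True
    then have "(\<Sum>a<Suc m. (\<zeta> a)\<^sup>2) = 0" using s2 by simp
    then have z: "\<forall>a\<in>{..<Suc m}. \<zeta> a = 0"
      by (subst (asm) sum_nonneg_eq_0_iff) (auto simp del: sum.lessThan_Suc)
    have v0: "?v w = 0" for w using z by (simp del: sum.lessThan_Suc)
    interpret X: prob_space "chi_squared (n - m)" by (rule prob_space_chi_squared)
    show ?thesis unfolding v0 s2 True using G.prob_space X.prob_space by simp
  next
    case False
    \<comment> \<open>The unit vector zeta / s becomes the last column of Q, so that zeta is s times
      that column.\<close>
    have "(\<Sum>l<Suc m. (\<zeta> l / s)\<^sup>2) = 1"
      using False by (simp add: power_divide s2 del: sum.lessThan_Suc flip: sum_divide_distrib)
    from orthogonal_completion[OF this] obtain Q :: "nat \<Rightarrow> nat \<Rightarrow> real" where Q0: "\<And>l. Q l m = \<zeta> l / s"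
      and Q1: "\<And>j j'. j < Suc m \<Longrightarrow> j' < Suc m \<Longrightarrow> (\<Sum>l<Suc m. Q l j * Q l j') = (if j = j' then 1 else 0)"
      and Q2: "\<And>l l'. l < Suc m \<Longrightarrow> l' < Suc m \<Longrightarrow> (\<Sum>j<Suc m. Q l j * Q l' j) = (if l = l' then 1 else 0)"
      by blast
    define C where "C w = (\<lambda>(i, j). \<Sum>l<Suc m. w (i, l) * Q l j)" for w :: "nat \<times> nat \<Rightarrow> real"
    \<comment> \<open>\<open>C\<close> serves the matrix algebra; \<open>CR\<close> is its
      restriction to the index set, since points of the product space are extensional.\<close>
    define CR where "CR w = (\<lambda>(i, j)\<in>{..<n} \<times> {..<Suc m}. \<Sum>l<Suc m. w (i, l) * Q l j)" for w :: "nat \<times> nat \<Rightarrow> real"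
    have CR: "CR w (i, j) = C w (i, j)" if "i < n" "j < Suc m" for w i j
      using that by (simp add: CR_def C_def)
    define X where "X w = (\<Sum>i<n. (lsres n m w (\<lambda>i. w (i, m)) i)\<^sup>2)" for w
    have XC: "X (CR w) = X (C w)" for w
      unfolding X_def by (intro sum.cong refl arg_cong2[where f = power] lsres_cong) (auto simp: CR)
    have CRm: "CR \<in> ?G \<rightarrow>\<^sub>M Pi\<^sub>M ({..<n} \<times> {..<Suc m}) (\<lambda>_. borel)"
      unfolding CR_def
      by (rule measurable_restrict) (auto intro!: borel_measurable_sum borel_measurable_times gauss_component)
    have Xm: "X \<in> borel_measurable ?G"
      unfolding X_def by (intro borel_measurable_lsres_sq gauss_component) auto
    have law: "distr ?G (Pi\<^sub>M ({..<n} \<times> {..<Suc m}) (\<lambda>_. borel)) CR = ?G"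
      unfolding CR_def by (rule distr_gauss_rotate_columns) (rule Q1)
    have chi: "chi_squared (n - m) = distr ?G borel (\<lambda>w. X (CR w))"
    proof -
      have "chi_squared (n - m) = distr (distr ?G (Pi\<^sub>M ({..<n} \<times> {..<Suc m}) (\<lambda>_. borel)) CR) borel X"
        unfolding law X_def using chi_squared_lsres_last_column[of m n] assms by simp
      also have "\<dots> = distr ?G borel (X \<circ> CR)"
        by (rule distr_distr) (use CRm Xm in \<open>auto simp: measurable_cong_sets[OF sets_gauss refl]\<close>)
      finally show ?thesis by (simp add: comp_def)
    qed
    have XCRm: "(\<lambda>w. X (CR w)) \<in> borel_measurable ?G"
      by (rule measurable_compose[OF CRm]) (use Xm in \<open>simp add: measurable_cong_sets[OF sets_gauss refl]\<close>)
    have ae1: "AE w in ?G. Determinant.det (gram n (Suc m) w) \<noteq> 0"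
      by (rule AE_det_gram_neq_0) (use assms in simp)
    \<comment> \<open>\<open>CR\<close> has the law of the original matrix, so it suffices that the
      first m columns of a Gaussian matrix are almost surely linearly independent.\<close>
    have ae2: "AE w in ?G. Determinant.det (gram n m (CR w)) \<noteq> 0"
    proof (rule AE_distrD[OF CRm], unfold law)
      have "AE p in gauss ({..<n} \<times> {..<m}) \<Otimes>\<^sub>M gauss {..<n}. Determinant.det (gram n m (fst p)) \<noteq> 0"
      proof -
        interpret Z: prob_space "gauss {..<n}" by (rule prob_space_gauss)
        have "AE w in distr (gauss ({..<n} \<times> {..<m}) \<Otimes>\<^sub>M gauss {..<n}) (gauss ({..<n} \<times> {..<m})) fst. Determinant.det (gram n m w) \<noteq> 0"
          unfolding Z.distr_pair_fst by (rule AE_det_gram_neq_0) (use assms in simp)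
        then show ?thesis by (rule AE_distrD[OF measurable_fst])
      qed
      note * = this[folded distr_gauss_last_column]
      have m: "(\<lambda>w. (\<lambda>p\<in>{..<n} \<times> {..<m}. w p, \<lambda>i\<in>{..<n}. w (i, m))) \<in> ?G
          \<rightarrow>\<^sub>M Pi\<^sub>M ({..<n} \<times> {..<m}) (\<lambda>_. borel) \<Otimes>\<^sub>M Pi\<^sub>M {..<n} (\<lambda>_. borel)"
        by (intro measurable_Pair measurable_restrict gauss_component) auto
      from AE_distrD[OF m *] show "AE w in ?G. Determinant.det (gram n m w) \<noteq> 0"
      proof eventually_elim
        case (elim w)
        then show ?case using gram_cong[of n m "\<lambda>p\<in>{..<n} \<times> {..<m}. w p" w] by simp
      qed
    qed
    have ae3: "AE w in ?G. X (CR w) \<noteq> 0"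
      using AE_chi_squared_neq_0[of "n - m"] assms unfolding chi
      by (intro AE_distrD[OF XCRm]) auto
    have "(LINT w|?G. complex_of_real (exp (- ?v w / 2))) =
        (LINT w|?G. complex_of_real (exp (- ((\<Sum>a<Suc m. (\<zeta> a)\<^sup>2) / X (CR w)) / 2)))"
    proof (rule integral_cong_AE)
      show "AE w in ?G. complex_of_real (exp (- ?v w / 2)) =
          complex_of_real (exp (- ((\<Sum>a<Suc m. (\<zeta> a)\<^sup>2) / X (CR w)) / 2))"
        using ae1 ae2 ae3
      proof eventually_elim
        case (elim w)
        have "Determinant.det (gram n m (C w)) \<noteq> 0"
          using elim(2) gram_cong[of n m "CR w" "C w"] CR by auto
        from lsinv_rotate[OF elim(1) this[unfolded C_def], of s \<zeta>]
        have "?v w * X (C w) = s\<^sup>2"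
          using Q0 Q1 Q2 False by (simp add: X_def C_def del: sum.lessThan_Suc)
        then have "?v w = s\<^sup>2 / X (CR w)" using elim(3) XC by (simp add: field_simps del: sum.lessThan_Suc)
        then show ?case unfolding s2 by simp
      qed
      show "(\<lambda>w. complex_of_real (exp (- ?v w / 2))) \<in> borel_measurable ?G"
      proof -
        have "(\<lambda>w. \<Sum>a<Suc m. \<zeta> a * lsinv n (Suc m) w a i) \<in> borel_measurable ?G" if "i < n" for i
          using that
          by (intro borel_measurable_sum borel_measurable_times borel_measurable_const
              borel_measurable_lsinv gauss_component) auto
        then have "?v \<in> borel_measurable ?G"
          by (intro borel_measurable_sum[where S = "{..<n}"], intro borel_measurable_power)
             (auto simp del: sum.lessThan_Suc)
        then show ?thesis by measurable
      qed
      show "(\<lambda>w. complex_of_real (exp (- ((\<Sum>a<Suc m. (\<zeta> a)\<^sup>2) / X (CR w)) / 2))) \<in> borel_measurable ?G"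
        using XCRm by measurable
    qed
    also have "\<dots> = (LINT x|chi_squared (n - m). complex_of_real (exp (- ((\<Sum>a<Suc m. (\<zeta> a)\<^sup>2) / x) / 2)))"
      unfolding chi by (rule integral_distr[symmetric, OF XCRm]) measurable
    finally show ?thesis .
  qed
qed

text \<open>For a fixed matrix the exponent is a linear form in z, whose coefficient vector is the
  one in \<open>gauss_dual_vector_char\<close>.\<close>

lemma lscoef_char:
  fixes \<zeta> :: "nat \<Rightarrow> real"
  shows "(LINT z|gauss {..<n}. iexp (\<Sum>a<k. \<zeta> a * lscoef n k w z a)) =
    complex_of_real (exp (- (\<Sum>i<n. (\<Sum>a<k. \<zeta> a * lsinv n k w a i)\<^sup>2) / 2))"
proof -
  have "(\<Sum>a<k. \<zeta> a * lscoef n k w z a) = (\<Sum>i<n. (\<Sum>a<k. \<zeta> a * lsinv n k w a i) * z i)" for z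
    unfolding lscoef_def sum_distrib_left sum_distrib_right
    by (subst sum.swap) (simp add: mult.assoc)
  then show ?thesis using gauss_char[of "{..<n}" "\<lambda>i. \<Sum>a<k. \<zeta> a * lsinv n k w a i"] by simp
qed

lemma distr_lscoef:
  assumes "0 < k" "k \<le> n"
  shows "distr (gauss ({..<n} \<times> {..<k}) \<Otimes>\<^sub>M gauss {..<n}) (Pi\<^sub>M {..<k} (\<lambda>_. borel))
      (\<lambda>p. \<lambda>a\<in>{..<k}. lscoef n k (fst p) (snd p) a) =
    distr (gauss {..<k} \<Otimes>\<^sub>M gauss {..<n - k + 1}) (Pi\<^sub>M {..<k} (\<lambda>_. borel))
      (\<lambda>p. \<lambda>a\<in>{..<k}. fst p a / sqrt (\<Sum>i<n - k + 1. (snd p i)\<^sup>2))"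
    (is "distr ?P ?N ?f = distr ?Q ?N ?g")
proof (rule PiM_char_unique)
  interpret W: prob_space "gauss ({..<n} \<times> {..<k})" by (rule prob_space_gauss)
  interpret Z: prob_space "gauss {..<n}" by (rule prob_space_gauss)
  interpret H: prob_space "gauss {..<k}" by (rule prob_space_gauss)
  interpret Y: prob_space "gauss {..<n - k + 1}" by (rule prob_space_gauss)
  interpret P: pair_prob_space "gauss ({..<n} \<times> {..<k})" "gauss {..<n}" ..
  interpret Q: pair_prob_space "gauss {..<k}" "gauss {..<n - k + 1}" ..
  have f: "?f \<in> ?P \<rightarrow>\<^sub>M ?N"
    by (intro measurable_restrict borel_measurable_lscoef measurable_compose[OF measurable_fst]
        measurable_compose[OF measurable_snd] gauss_component) auto
  have S: "(\<lambda>p. \<Sum>i<n - k + 1. (snd p i)\<^sup>2) \<in> borel_measurable ?Q"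
    by (intro borel_measurable_sum borel_measurable_power measurable_compose[OF measurable_snd] gauss_component) auto
  have g: "?g \<in> ?Q \<rightarrow>\<^sub>M ?N"
    by (intro measurable_restrict borel_measurable_divide measurable_compose[OF S] borel_measurable_sqrt
        measurable_compose[OF measurable_fst] gauss_component) auto
  show "prob_space (distr ?P ?N ?f)" by (rule P.prob_space_distr[OF f])
  show "prob_space (distr ?Q ?N ?g)" by (rule Q.prob_space_distr[OF g])
  fix \<zeta> :: "nat \<Rightarrow> real"
  obtain m where k: "k = Suc m" using assms by (cases k) auto
  \<comment> \<open>Degrees of freedom: of the k = m + 1 columns the last is fitted by the m others,
    which leaves n - m.\<close>
  have nm: "n - k + 1 = n - m" "m < n" using assms k by auto
  have e: "(\<lambda>v. iexp (\<Sum>a<k. \<zeta> a * v a)) \<in> borel_measurable ?N"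
    by measurable
  have "(LINT v|distr ?P ?N ?f. iexp (\<Sum>a<k. \<zeta> a * v a)) =
      (LINT p|?P. iexp (\<Sum>a<k. \<zeta> a * ?f p a))"
    by (rule integral_distr[OF f e])
  also have "\<dots> = (LINT w|gauss ({..<n} \<times> {..<k}). LINT z|gauss {..<n}. iexp (\<Sum>a<k. \<zeta> a * ?f (w, z) a))"
    by (rule P.integral_fst'[symmetric], rule P.integrable_const_bound[of _ 1])
       (use measurable_compose[OF f e] in auto)
  also have "\<dots> = (LINT w|gauss ({..<n} \<times> {..<k}).
      complex_of_real (exp (- (\<Sum>i<n. (\<Sum>a<k. \<zeta> a * lsinv n k w a i)\<^sup>2) / 2)))"
    using lscoef_char[where n = n and k = k and \<zeta> = \<zeta>] by simp
  also have "\<dots> = (LINT x|chi_squared (n - m). complex_of_real (exp (- ((\<Sum>a<k. (\<zeta> a)\<^sup>2) / x) / 2)))"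
    unfolding k by (rule gauss_dual_vector_char[OF nm(2)])
  also have "\<dots> = (LINT y|gauss {..<n - k + 1}.
      complex_of_real (exp (- ((\<Sum>a<k. (\<zeta> a)\<^sup>2) / (\<Sum>i<n - k + 1. (y i)\<^sup>2)) / 2)))"
    unfolding nm(1)[symmetric] chi_squared_def by (rule integral_distr) measurable
  \<comment> \<open>On the other side the denominator is held fixed: given y, the quotient is a
    Gaussian vector with variance 1 / r in each coordinate.\<close>
  also have "\<dots> = (LINT y|gauss {..<n - k + 1}. LINT h|gauss {..<k}. iexp (\<Sum>a<k. \<zeta> a * ?g (h, y) a))"
  proof (rule Bochner_Integration.integral_cong[OF refl])
    fix y :: "nat \<Rightarrow> real"
    define r where "r = (\<Sum>i<n - k + 1. (y i)\<^sup>2)"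
    have r: "r \<ge> 0" by (simp add: r_def sum_nonneg)
    have "(\<Sum>a<k. \<zeta> a * ?g (h, y) a) = (\<Sum>a<k. \<zeta> a / sqrt r * h a)" for h
      by (intro sum.cong refl) (simp add: r_def)
    then have "(LINT h|gauss {..<k}. iexp (\<Sum>a<k. \<zeta> a * ?g (h, y) a)) =
        complex_of_real (exp (- (\<Sum>a<k. (\<zeta> a / sqrt r)\<^sup>2) / 2))"
      using gauss_char[of "{..<k}" "\<lambda>a. \<zeta> a / sqrt r"] by simp
    \<comment> \<open>At r = 0 both sides are 0 by the convention for division.\<close>
    also have "(\<Sum>a<k. (\<zeta> a / sqrt r)\<^sup>2) = (\<Sum>a<k. (\<zeta> a)\<^sup>2) / r"
      using r by (simp add: power_divide sum_divide_distrib)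
    finally show "complex_of_real (exp (- ((\<Sum>a<k. (\<zeta> a)\<^sup>2) / (\<Sum>i<n - k + 1. (y i)\<^sup>2)) / 2)) =
        (LINT h|gauss {..<k}. iexp (\<Sum>a<k. \<zeta> a * ?g (h, y) a))" by (simp only: r_def)
  qed
  also have "\<dots> = (LINT p|?Q. iexp (\<Sum>a<k. \<zeta> a * ?g p a))"
  proof -
    have "integrable ?Q (\<lambda>(h, y). iexp (\<Sum>a<k. \<zeta> a * ?g (h, y) a))"
      by (rule Q.integrable_const_bound[of _ 1]) (use measurable_compose[OF g e] in auto)
    from Q.integral_snd[OF this] show ?thesis by (simp only: case_prod_unfold fst_conv snd_conv)
  qed
  also have "\<dots> = (LINT v|distr ?Q ?N ?g. iexp (\<Sum>a<k. \<zeta> a * v a))"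
    by (rule integral_distr[OF g e, symmetric])
  finally show "(LINT v|distr ?P ?N ?f. iexp (\<Sum>a<k. \<zeta> a * v a)) =
      (LINT v|distr ?Q ?N ?g. iexp (\<Sum>a<k. \<zeta> a * v a))" .
qed auto

text \<open>The normalizations cancel: (s / t) * ((P / s) / (Q / t)) = P / Q.\<close>

lemma scale_law_F_law:
  assumes "0 < s" "0 < t"
  shows "scale_law (real s / real t) (F_law s t) =
    distr (gauss {..<s} \<Otimes>\<^sub>M gauss {..<t}) borel (\<lambda>p. (\<Sum>a<s. (fst p a)\<^sup>2) / (\<Sum>i<t. (snd p i)\<^sup>2))"
proof -
  have sc: "scale_law c (chi_squared u) = distr (gauss {..<u}) borel (\<lambda>z. c * (\<Sum>i<u. (z i)\<^sup>2))" for c u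
    unfolding scale_law_def chi_squared_def by (subst distr_distr) (auto simp: comp_def)
  have T: "sigma_finite_measure (distr (gauss {..<t}) borel (\<lambda>z. 1 / real t * (\<Sum>i<t. (z i)\<^sup>2)))"
    by (intro prob_space_imp_sigma_finite prob_space.prob_space_distr prob_space_gauss) measurable
  let ?f = "\<lambda>(x, y). (1 / real s * (\<Sum>i<s. (x i)\<^sup>2), 1 / real t * (\<Sum>i<t. (y i)\<^sup>2))"
  have f: "?f \<in> gauss {..<s} \<Otimes>\<^sub>M gauss {..<t} \<rightarrow>\<^sub>M borel \<Otimes>\<^sub>M borel"
    unfolding case_prod_beta
    by (intro measurable_Pair borel_measurable_times borel_measurable_const borel_measurable_sum
        borel_measurable_power measurable_compose[OF measurable_fst] measurable_compose[OF measurable_snd]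
        gauss_component) auto
  have d: "(\<lambda>(p, q). p / q :: real) \<in> borel \<Otimes>\<^sub>M borel \<rightarrow>\<^sub>M borel" by measurable
  have prod: "distr (gauss {..<s}) borel (\<lambda>z. 1 / real s * (\<Sum>i<s. (z i)\<^sup>2)) \<Otimes>\<^sub>M
      distr (gauss {..<t}) borel (\<lambda>z. 1 / real t * (\<Sum>i<t. (z i)\<^sup>2)) =
      distr (gauss {..<s} \<Otimes>\<^sub>M gauss {..<t}) (borel \<Otimes>\<^sub>M borel) ?f"
    by (rule pair_measure_distr[OF _ _ T]) measurable
  have "scale_law (real s / real t) (F_law s t) =
      distr (gauss {..<s} \<Otimes>\<^sub>M gauss {..<t}) borel ((*) (real s / real t) \<circ> ((\<lambda>(p, q). p / q) \<circ> ?f))"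
    unfolding F_law_def sc prod distr_distr[OF d f]
    unfolding scale_law_def by (rule distr_distr) (use measurable_comp[OF f d] in auto)
  then show ?thesis
    using assms by (simp add: comp_def case_prod_beta)
qed

lemma F_law_lscoef:
  assumes "0 < k" "k \<le> n"
  shows "distr (gauss ({..<n} \<times> {..<k}) \<Otimes>\<^sub>M gauss {..<n}) borel
      (\<lambda>p. \<Sum>a<k. (lscoef n k (fst p) (snd p) a)\<^sup>2) =
    scale_law (real k / real (n - k + 1)) (F_law k (n - k + 1))"
proof -
  let ?P = "gauss ({..<n} \<times> {..<k}) \<Otimes>\<^sub>M gauss {..<n}" and ?Q = "gauss {..<k} \<Otimes>\<^sub>M gauss {..<n - k + 1}"
  let ?N = "Pi\<^sub>M {..<k} (\<lambda>_. borel :: real measure)" and ?sq = "\<lambda>v. \<Sum>a<k. (v a)\<^sup>2 :: real"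
  have sq: "?sq \<in> borel_measurable ?N" by measurable
  have f: "(\<lambda>p. \<lambda>a\<in>{..<k}. lscoef n k (fst p) (snd p) a) \<in> ?P \<rightarrow>\<^sub>M ?N"
    by (intro measurable_restrict borel_measurable_lscoef measurable_compose[OF measurable_fst]
        measurable_compose[OF measurable_snd] gauss_component) auto
  have S: "(\<lambda>p. \<Sum>i<n - k + 1. (snd p i)\<^sup>2) \<in> borel_measurable ?Q"
    by (intro borel_measurable_sum borel_measurable_power measurable_compose[OF measurable_snd] gauss_component) auto
  have g: "(\<lambda>p. \<lambda>a\<in>{..<k}. fst p a / sqrt (\<Sum>i<n - k + 1. (snd p i)\<^sup>2)) \<in> ?Q \<rightarrow>\<^sub>M ?N"
    by (intro measurable_restrict borel_measurable_divide measurable_compose[OF S] borel_measurable_sqrt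
        measurable_compose[OF measurable_fst] gauss_component) auto
  have "distr ?P borel (\<lambda>p. \<Sum>a<k. (lscoef n k (fst p) (snd p) a)\<^sup>2) =
      distr (distr ?P ?N (\<lambda>p. \<lambda>a\<in>{..<k}. lscoef n k (fst p) (snd p) a)) borel ?sq"
    by (subst distr_distr[OF sq f]) (simp add: comp_def)
  also have "\<dots> = distr ?Q borel (\<lambda>p. (\<Sum>a<k. (fst p a)\<^sup>2) / (\<Sum>i<n - k + 1. (snd p i)\<^sup>2))"
    unfolding distr_lscoef[OF assms]
    by (subst distr_distr[OF sq g])
       (simp add: comp_def power_divide sum_nonneg sum_divide_distrib del: sum.lessThan_Suc)
  also have "\<dots> = scale_law (real k / real (n - k + 1)) (F_law k (n - k + 1))"
    by (rule scale_law_F_law[symmetric]) (use assms in auto)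
  finally show ?thesis .
qed

section \<open>Random linear combinations of Gaussian columns\<close>

definition select_cols :: "nat \<Rightarrow> nat \<Rightarrow> (nat \<Rightarrow> nat) \<Rightarrow> (nat \<times> nat \<Rightarrow> real) \<Rightarrow> nat \<times> nat \<Rightarrow> real" where
  "select_cols n k p \<alpha> = (\<lambda>(i, a)\<in>{..<n} \<times> {..<k}. \<alpha> (i, p a))"

definition unit_comb :: "nat \<Rightarrow> nat \<Rightarrow> (nat \<Rightarrow> real) \<Rightarrow> (nat \<times> nat \<Rightarrow> real) \<Rightarrow> nat \<Rightarrow> real" where
  "unit_comb n L y \<alpha> = (\<lambda>i\<in>{..<n}. (\<Sum>j<L. \<alpha> (i, j) * y j) / sqrt (\<Sum>j<L. (y j)\<^sup>2))"

text \<open>As y vanishes on the selected columns, the combination only uses entries of other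
  columns and is uncorrelated with the selected ones; division by |y| gives it unit
  variance.\<close>

lemma distr_cols_unit_comb:
  fixes n k L :: nat
  assumes p: "inj_on p {..<k}" "p ` {..<k} \<subseteq> {..<L}" and yp: "\<And>a. a < k \<Longrightarrow> y (p a) = 0"
    and y: "(\<Sum>j<L. (y j)\<^sup>2) \<noteq> 0"
  shows "distr (gauss ({..<n} \<times> {..<L})) (Pi\<^sub>M ({..<n} \<times> {..<k}) (\<lambda>_. borel) \<Otimes>\<^sub>M Pi\<^sub>M {..<n} (\<lambda>_. borel))
      (\<lambda>\<alpha>. (select_cols n k p \<alpha>, unit_comb n L y \<alpha>)) = gauss ({..<n} \<times> {..<k}) \<Otimes>\<^sub>M gauss {..<n}"
proof -
  let ?J = "{..<n} \<times> {..<L}"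
  define s where "s = sqrt (\<Sum>j<L. (y j)\<^sup>2)"
  have "(\<Sum>j<L. (y j)\<^sup>2) > 0" using y sum_nonneg[of "{..<L}" "\<lambda>j. (y j)\<^sup>2"] by (simp add: less_le)
  then have s: "s > 0" "s * s = (\<Sum>j<L. (y j)\<^sup>2)" by (simp_all add: s_def)
  define U where "U q r = (if fst r = fst q \<and> snd r = p (snd q) then 1 else 0 :: real)" for q r :: "nat \<times> nat"
  define V where "V i r = (if fst r = i then y (snd r) / s else 0)" for i :: nat and r :: "nat \<times> nat"
  have Vsum: "(\<Sum>r\<in>?J. V i r * f r) = (\<Sum>j<L. y j / s * f (i, j))" if "i < n" for i f
  proof -
    have "(\<Sum>r\<in>?J. V i r * f r) = (\<Sum>i'<n. \<Sum>j<L. if i' = i then y j / s * f (i', j) else 0)"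
      unfolding sum.cartesian_product by (intro sum.cong refl) (auto simp: V_def)
    also have "\<dots> = (\<Sum>i'<n. if i' = i then (\<Sum>j<L. y j / s * f (i', j)) else 0)"
      by (intro sum.cong refl) auto
    finally show ?thesis using that by simp
  qed
  have Usum: "(\<Sum>r\<in>?J. U q r * f r) = f (fst q, p (snd q))" if "q \<in> {..<n} \<times> {..<k}" for q f
  proof -
    have "(\<Sum>r\<in>?J. U q r * f r) = (\<Sum>r\<in>?J. if r = (fst q, p (snd q)) then f r else 0)"
      by (intro sum.cong refl) (auto simp: U_def prod_eq_iff)
    also have "\<dots> = f (fst q, p (snd q))"
      using that p(2) by (subst sum.delta) auto
    finally show ?thesis .
  qed
  have "distr (gauss ?J) (Pi\<^sub>M ({..<n} \<times> {..<k}) (\<lambda>_. borel) \<Otimes>\<^sub>M Pi\<^sub>M {..<n} (\<lambda>_. borel))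
      (\<lambda>\<alpha>. (\<lambda>q\<in>{..<n} \<times> {..<k}. \<Sum>r\<in>?J. U q r * \<alpha> r, \<lambda>i\<in>{..<n}. \<Sum>r\<in>?J. V i r * \<alpha> r)) =
      gauss ({..<n} \<times> {..<k}) \<Otimes>\<^sub>M gauss {..<n}"
  proof (rule gauss_forms_pair)
    fix q q' assume q: "q \<in> {..<n} \<times> {..<k}" "q' \<in> {..<n} \<times> {..<k}"
    show "(\<Sum>r\<in>?J. U q r * U q' r) = (if q = q' then 1 else 0)"
      unfolding Usum[OF q(1)] using q p(1) by (auto simp: U_def prod_eq_iff inj_on_eq_iff)
  next
    fix i i' assume i: "i \<in> {..<n}" "i' \<in> {..<n}"
    have "(\<Sum>r\<in>?J. V i r * V i' r) = (if i = i' then (\<Sum>j<L. (y j)\<^sup>2) / (s * s) else 0)"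
      using i by (simp add: Vsum) (auto simp: V_def power2_eq_square sum_divide_distrib)
    then show "(\<Sum>r\<in>?J. V i r * V i' r) = (if i = i' then 1 else 0)" using s(2) y by simp
  next
    fix q i assume q: "q \<in> {..<n} \<times> {..<k}" "i \<in> {..<n}"
    show "(\<Sum>r\<in>?J. U q r * V i r) = 0"
      unfolding Usum[OF q(1)] using q yp by (auto simp: V_def)
  qed auto
  moreover have "(\<lambda>q\<in>{..<n} \<times> {..<k}. \<Sum>r\<in>?J. U q r * \<alpha> r) = select_cols n k p \<alpha>" for \<alpha>
    unfolding select_cols_def by (intro restrict_ext) (auto simp: Usum)
  moreover have "(\<lambda>i\<in>{..<n}. \<Sum>r\<in>?J. V i r * \<alpha> r) = unit_comb n L y \<alpha>" for \<alpha>
    unfolding unit_comb_def s_def[symmetric]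
    by (intro restrict_ext) (simp add: Vsum sum_divide_distrib, simp add: mult.commute)
  ultimately show ?thesis by simp
qed

context
  fixes n k L :: nat and p :: "nat \<Rightarrow> nat" and \<mu> :: "'s measure" and y :: "'s \<Rightarrow> nat \<Rightarrow> real"
  assumes p: "inj_on p {..<k}" "p ` {..<k} \<subseteq> {..<L}"
    and \<mu>: "prob_space \<mu>" and y: "\<And>j. (\<lambda>s. y s j) \<in> borel_measurable \<mu>"
    and yp: "\<And>s. \<forall>a<k. y s (p a) = 0"
    and y0: "AE s in \<mu>. (\<Sum>j<L. (y s j)\<^sup>2) \<noteq> 0"
begin

lemma measurable_cols_unit_comb:
  "(\<lambda>(s, \<alpha>). (select_cols n k p \<alpha>, unit_comb n L (y s) \<alpha>)) \<in> \<mu> \<Otimes>\<^sub>M gauss ({..<n} \<times> {..<L})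
    \<rightarrow>\<^sub>M Pi\<^sub>M ({..<n} \<times> {..<k}) (\<lambda>_. borel) \<Otimes>\<^sub>M Pi\<^sub>M {..<n} (\<lambda>_. borel)"
proof -
  have a: "(\<lambda>q. snd q (i, j)) \<in> borel_measurable (\<mu> \<Otimes>\<^sub>M gauss ({..<n} \<times> {..<L}))" if "i < n" "j < L" for i j
    using that by (intro measurable_compose[OF measurable_snd] gauss_component) auto
  have b: "(\<lambda>q. y (fst q) j) \<in> borel_measurable (\<mu> \<Otimes>\<^sub>M gauss ({..<n} \<times> {..<L}))" if "j < L" for j
    using that by (intro measurable_compose[OF measurable_fst] y)
  show ?thesis
    unfolding case_prod_unfold select_cols_def unit_comb_def
    using p(2)
    by (intro measurable_Pair measurable_restrict borel_measurable_divide measurable_compose[OF _ borel_measurable_sqrt]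
        borel_measurable_sum borel_measurable_times borel_measurable_power a b) auto
qed

text \<open>The conditional law given s is the same for almost all s, so random coefficients
  independent of the matrix change nothing. Both the signal off \<Gamma> and the coordinate vector
  that picks the noise column will be used as y.\<close>

lemma distr_random_cols_unit_comb:
  "distr (\<mu> \<Otimes>\<^sub>M gauss ({..<n} \<times> {..<L}))
      (Pi\<^sub>M ({..<n} \<times> {..<k}) (\<lambda>_. borel) \<Otimes>\<^sub>M Pi\<^sub>M {..<n} (\<lambda>_. borel))
      (\<lambda>(s, \<alpha>). (select_cols n k p \<alpha>, unit_comb n L (y s) \<alpha>)) = gauss ({..<n} \<times> {..<k}) \<Otimes>\<^sub>M gauss {..<n}"
proof (rule distr_pair_kernel[OF \<mu> prob_space_gauss measurable_cols_unit_comb])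
  show "AE s in \<mu>. distr (gauss ({..<n} \<times> {..<L})) (Pi\<^sub>M ({..<n} \<times> {..<k}) (\<lambda>_. borel) \<Otimes>\<^sub>M Pi\<^sub>M {..<n} (\<lambda>_. borel))
      (\<lambda>z. case (s, z) of (s, \<alpha>) \<Rightarrow> (select_cols n k p \<alpha>, unit_comb n L (y s) \<alpha>)) =
      gauss ({..<n} \<times> {..<k}) \<Otimes>\<^sub>M gauss {..<n}"
    using y0 by eventually_elim (simp add: distr_cols_unit_comb[OF p] yp)
  show "sets (gauss ({..<n} \<times> {..<k}) \<Otimes>\<^sub>M gauss {..<n}) =
      sets (Pi\<^sub>M ({..<n} \<times> {..<k}) (\<lambda>_. borel) \<Otimes>\<^sub>M Pi\<^sub>M {..<n} (\<lambda>_. borel))"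
    by (intro sets_pair_measure_cong sets_gauss)
qed

lemma F_law_random_lscoef:
  assumes "0 < k" "k \<le> n"
  shows "distr (\<mu> \<Otimes>\<^sub>M gauss ({..<n} \<times> {..<L})) borel
      (\<lambda>(s, \<alpha>). \<Sum>a<k. (lscoef n k (select_cols n k p \<alpha>) (unit_comb n L (y s) \<alpha>) a)\<^sup>2) =
    scale_law (real k / real (n - k + 1)) (F_law k (n - k + 1))"
  unfolding F_law_lscoef[OF assms, symmetric] distr_random_cols_unit_comb[symmetric]
  by (subst distr_distr[OF _ measurable_cols_unit_comb])
     (auto simp: comp_def case_prod_unfold intro!: borel_measurable_lscoef_sq
       measurable_compose[OF measurable_fst] measurable_compose[OF measurable_snd] measurable_component_singleton)

lemma measurable_random_lscoef:
  "(\<lambda>(s, \<alpha>). \<Sum>a<k. (lscoef n k (select_cols n k p \<alpha>) (unit_comb n L (y s) \<alpha>) a)\<^sup>2)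
    \<in> borel_measurable (\<mu> \<Otimes>\<^sub>M gauss ({..<n} \<times> {..<L}))"
proof -
  have "(\<lambda>q. \<Sum>a<k. (lscoef n k (fst q) (snd q) a)\<^sup>2) \<in>
      borel_measurable (Pi\<^sub>M ({..<n} \<times> {..<k}) (\<lambda>_. borel) \<Otimes>\<^sub>M Pi\<^sub>M {..<n} (\<lambda>_. borel))"
    by (intro borel_measurable_lscoef_sq measurable_compose[OF measurable_fst]
        measurable_compose[OF measurable_snd] measurable_component_singleton) auto
  from measurable_compose[OF measurable_cols_unit_comb this] show ?thesis by (simp add: case_prod_unfold)
qed

lemma measurable_random_lsres:
  "(\<lambda>(s, \<alpha>). \<Sum>i<n. (lsres n k (select_cols n k p \<alpha>) (unit_comb n L (y s) \<alpha>) i)\<^sup>2)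
    \<in> borel_measurable (\<mu> \<Otimes>\<^sub>M gauss ({..<n} \<times> {..<L}))"
proof -
  have "(\<lambda>q. \<Sum>i<n. (lsres n k (fst q) (snd q) i)\<^sup>2) \<in>
      borel_measurable (Pi\<^sub>M ({..<n} \<times> {..<k}) (\<lambda>_. borel) \<Otimes>\<^sub>M Pi\<^sub>M {..<n} (\<lambda>_. borel))"
    by (intro borel_measurable_lsres_sq measurable_compose[OF measurable_fst]
        measurable_compose[OF measurable_snd] measurable_component_singleton) auto
  from measurable_compose[OF measurable_cols_unit_comb this] show ?thesis by (simp add: case_prod_unfold)
qed

lemma chi_squared_random_lsres:
  assumes "k \<le> n"
  shows "distr (\<mu> \<Otimes>\<^sub>M gauss ({..<n} \<times> {..<L})) borel
      (\<lambda>(s, \<alpha>). \<Sum>i<n. (lsres n k (select_cols n k p \<alpha>) (unit_comb n L (y s) \<alpha>) i)\<^sup>2) = chi_squared (n - k)"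
  unfolding chi_squared_lsres_pair[OF assms, symmetric] distr_random_cols_unit_comb[symmetric]
  by (subst distr_distr[OF _ measurable_cols_unit_comb])
     (auto simp: comp_def case_prod_unfold intro!: borel_measurable_lsres_sq
       measurable_compose[OF measurable_fst] measurable_compose[OF measurable_snd] measurable_component_singleton)

lemma AE_random_cols_det_gram:
  assumes "k \<le> n"
  shows "AE q in \<mu> \<Otimes>\<^sub>M gauss ({..<n} \<times> {..<L}). Determinant.det (gram n k (select_cols n k p (snd q))) \<noteq> 0"
proof -
  interpret Z: prob_space "gauss {..<n}" by (rule prob_space_gauss)
  have "AE w in distr (gauss ({..<n} \<times> {..<k}) \<Otimes>\<^sub>M gauss {..<n}) (gauss ({..<n} \<times> {..<k})) fst.
      Determinant.det (gram n k w) \<noteq> 0"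
    unfolding Z.distr_pair_fst by (rule AE_det_gram_neq_0[OF assms])
  then have "AE q in gauss ({..<n} \<times> {..<k}) \<Otimes>\<^sub>M gauss {..<n}. Determinant.det (gram n k (fst q)) \<noteq> 0"
    by (rule AE_distrD[OF measurable_fst])
  from AE_distrD[OF measurable_cols_unit_comb this[folded distr_random_cols_unit_comb]]
  show ?thesis by (simp add: case_prod_unfold)
qed

end

text \<open>For fixed columns in \<open>p\<close> and fixed \<open>c\<close>-th column, the residual \<open>v\<close> of the latter is a fixed vector, so the
  inner products of \<open>v / \<parallel>v\<parallel>\<close> with the other columns are independent standard normal variables.\<close>

lemma chi_squared_cols_lsres:
  fixes n k L :: nat
  assumes p: "inj_on p {..<k}" "p ` {..<k} \<subseteq> {..<L}" and c: "c < L" "c \<notin> p ` {..<k}"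
    and D: "D \<subseteq> {..<L}" "D \<inter> p ` {..<k} = {}" "c \<notin> D" and kn: "k < n"
  shows "distr (gauss ({..<n} \<times> {..<L})) borel
      (\<lambda>\<alpha>. (\<Sum>j\<in>D. (\<Sum>i<n. \<alpha> (i, j) * lsres n k (select_cols n k p \<alpha>) (\<lambda>i. \<alpha> (i, c)) i)\<^sup>2) /
        (\<Sum>i<n. (lsres n k (select_cols n k p \<alpha>) (\<lambda>i. \<alpha> (i, c)) i)\<^sup>2)) = chi_squared (card D)"
proof -
  have fD: "finite D" using D(1) finite_subset by blast
  let ?J = "{..<n} \<times> {..<L}" and ?A = "{..<n} \<times> {..<Suc k}" and ?B = "{..<n} \<times> D"
  have pk: "p a < L" "p a \<noteq> c" "p a \<notin> D" if "a < k" for a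
    using p(2) c(2) D(2) that by auto
  \<comment> \<open>Gathers the fitted columns p and, as column number k, the column c in one matrix
    over \<open>?A\<close>; the columns in D stay separate.\<close>
  define f where "f q = (fst q, if snd q < k then p (snd q) else c)" for q :: "nat \<times> nat"
  define v where "v w i = lsres n k w (\<lambda>i. w (i, k)) i" for w i
  define h where "h = (\<lambda>(w, b). (\<Sum>j\<in>D. (\<Sum>i<n. b (i, j) * v w i)\<^sup>2) / (\<Sum>i<n. (v w i)\<^sup>2))"
  define \<Phi> where "\<Phi> \<alpha> = (\<lambda>q\<in>?A. \<alpha> (f q), \<lambda>r\<in>?B. \<alpha> r :: real)" for \<alpha> :: "nat \<times> nat \<Rightarrow> real"
  have law: "distr (gauss ?J) (Pi\<^sub>M ?A (\<lambda>_. borel) \<Otimes>\<^sub>M Pi\<^sub>M ?B (\<lambda>_. borel)) \<Phi> = gauss ?A \<Otimes>\<^sub>M gauss ?B"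
    unfolding \<Phi>_def
  proof (rule distr_gauss_reindex_pair[of ?J f ?A "\<lambda>r. r" ?B])
    show "inj_on f ?A"
      using p c by (auto simp: inj_on_def f_def less_Suc_eq split: if_splits)
    show "f ` ?A \<subseteq> ?J" "f ` ?A \<inter> (\<lambda>r. r) ` ?B = {}"
      using pk c D by (auto simp: f_def split: if_splits)
  qed (use D in auto)
  have \<Phi>m: "\<Phi> \<in> gauss ?J \<rightarrow>\<^sub>M Pi\<^sub>M ?A (\<lambda>_. borel) \<Otimes>\<^sub>M Pi\<^sub>M ?B (\<lambda>_. borel)"
    unfolding \<Phi>_def using pk c D
    by (intro measurable_Pair measurable_restrict gauss_component) (auto simp: f_def image_subset_iff)
  have vm: "(\<lambda>q. v (fst q) i) \<in> borel_measurable (Pi\<^sub>M ?A (\<lambda>_. borel) \<Otimes>\<^sub>M Pi\<^sub>M ?B (\<lambda>_. borel))" if "i < n" for i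
    unfolding v_def using that
    by (intro borel_measurable_lsres measurable_compose[OF measurable_fst] measurable_component_singleton) auto
  have bm: "(\<lambda>q. snd q (i, j)) \<in> borel_measurable (Pi\<^sub>M ?A (\<lambda>_. borel) \<Otimes>\<^sub>M Pi\<^sub>M ?B (\<lambda>_. borel))" if "i < n" "j \<in> D" for i j
    using that by (intro measurable_compose[OF measurable_snd] measurable_component_singleton) auto
  have hm: "h \<in> borel_measurable (Pi\<^sub>M ?A (\<lambda>_. borel) \<Otimes>\<^sub>M Pi\<^sub>M ?B (\<lambda>_. borel))"
    unfolding h_def case_prod_unfold
    by (intro borel_measurable_divide borel_measurable_sum borel_measurable_power borel_measurable_times vm bm) auto
  have "chi_squared (card D) = distr (gauss ?A \<Otimes>\<^sub>M gauss ?B) borel h"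
  proof (rule distr_pair_kernel[symmetric, OF prob_space_gauss prob_space_gauss])
    show "h \<in> borel_measurable (gauss ?A \<Otimes>\<^sub>M gauss ?B)"
      using hm by (simp cong: measurable_cong_sets sets_pair_measure_cong add: sets_gauss)
    have "AE x in distr (gauss ?A) borel (\<lambda>w. \<Sum>i<n. (lsres n k w (\<lambda>i. w (i, k)) i)\<^sup>2). x \<noteq> 0"
      unfolding chi_squared_lsres_last_column[OF less_imp_le[OF kn]]
      by (rule AE_chi_squared_neq_0) (use kn in simp)
    then have "AE w in gauss ?A. (\<Sum>i<n. (v w i)\<^sup>2) \<noteq> 0"
      unfolding v_def
      by (rule AE_distrD[rotated]) (intro borel_measurable_lsres_sq gauss_component, auto)
    then show "AE w in gauss ?A. distr (gauss ?B) borel (\<lambda>b. h (w, b)) = chi_squared (card D)"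
    proof eventually_elim
      case (elim w)
      define s where "s = sqrt (\<Sum>i<n. (v w i)\<^sup>2)"
      have "(\<Sum>i<n. (v w i)\<^sup>2) > 0" using elim sum_nonneg[of "{..<n}" "\<lambda>i. (v w i)\<^sup>2"] by (simp add: less_le)
      then have s: "s > 0" "s\<^sup>2 = (\<Sum>i<n. (v w i)\<^sup>2)" by (simp_all add: s_def)
      obtain d where d: "bij_betw d {..<card D} D"
        using ex_bij_betw_nat_finite[OF fD] by (auto simp: atLeast0LessThan)
      have dD: "d a \<in> D" if "a < card D" for a using d that by (auto simp: bij_betw_def)
      \<comment> \<open>The form number a is the inner product of column d a with the unit vector v
        / |v|; different forms use different columns, whence orthonormality.\<close>
      define U where "U a r = (if snd r = d a then v w (fst r) / s else 0)" for a and r :: "nat \<times> nat"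
      have Usum: "(\<Sum>r\<in>?B. U a r * g r) = (\<Sum>i<n. v w i / s * g (i, d a))" if "a < card D" for a g
      proof -
        have "(\<Sum>r\<in>?B. U a r * g r) = (\<Sum>i<n. \<Sum>j\<in>D. if j = d a then v w i / s * g (i, j) else 0)"
          unfolding sum.cartesian_product by (intro sum.cong refl) (auto simp: U_def)
        then show ?thesis using dD[OF that] fD by simp
      qed
      have "distr (gauss ?B) borel (\<lambda>b. \<Sum>a<card D. (\<Sum>r\<in>?B. U a r * b r)\<^sup>2) = chi_squared (card D)"
      proof (rule chi_squared_forms)
        fix a b assume ab: "a < card D" "b < card D"
        have "(\<Sum>r\<in>?B. U a r * U b r) = (if d a = d b then (\<Sum>i<n. (v w i)\<^sup>2) / s\<^sup>2 else 0)"
          using ab by (simp add: Usum) (auto simp: U_def power2_eq_square sum_divide_distrib)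
        moreover have "d a = d b \<longleftrightarrow> a = b" using d ab by (auto simp: bij_betw_def inj_on_eq_iff)
        ultimately show "(\<Sum>r\<in>?B. U a r * U b r) = (if a = b then 1 else 0)" using s(2) elim by simp
      qed (use fD in auto)
      moreover have "(\<Sum>a<card D. (\<Sum>r\<in>?B. U a r * b r)\<^sup>2) = h (w, b)" for b
      proof -
        have "(\<Sum>a<card D. (\<Sum>r\<in>?B. U a r * b r)\<^sup>2) = (\<Sum>a<card D. (\<Sum>i<n. v w i / s * b (i, d a))\<^sup>2)"
          by (intro sum.cong refl) (simp add: Usum)
        also have "\<dots> = (\<Sum>j\<in>D. (\<Sum>i<n. v w i / s * b (i, j))\<^sup>2)"
          by (rule sum.reindex_bij_betw[OF d])
        also have "\<dots> = (\<Sum>j\<in>D. (\<Sum>i<n. b (i, j) * v w i)\<^sup>2 / s\<^sup>2)"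
          by (intro sum.cong refl) (simp add: power_divide mult.commute flip: sum_divide_distrib)
        finally show ?thesis by (simp add: h_def s sum_divide_distrib)
      qed
      ultimately show ?case by simp
    qed
  qed auto
  also have "\<dots> = distr (gauss ?J) borel (\<lambda>\<alpha>. h (\<Phi> \<alpha>))"
    unfolding law[symmetric] by (subst distr_distr[OF hm \<Phi>m]) (simp add: comp_def)
  also have "(\<lambda>\<alpha>. h (\<Phi> \<alpha>)) = (\<lambda>\<alpha>. (\<Sum>j\<in>D. (\<Sum>i<n. \<alpha> (i, j) * lsres n k (select_cols n k p \<alpha>) (\<lambda>i. \<alpha> (i, c)) i)\<^sup>2) /
        (\<Sum>i<n. (lsres n k (select_cols n k p \<alpha>) (\<lambda>i. \<alpha> (i, c)) i)\<^sup>2))"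
  proof
    fix \<alpha>
    have v: "v (\<lambda>q\<in>?A. \<alpha> (f q)) i = lsres n k (select_cols n k p \<alpha>) (\<lambda>i. \<alpha> (i, c)) i" if "i < n" for i
      unfolding v_def by (rule lsres_cong) (use that in \<open>auto simp: select_cols_def f_def\<close>)
    show "h (\<Phi> \<alpha>) = (\<Sum>j\<in>D. (\<Sum>i<n. \<alpha> (i, j) * lsres n k (select_cols n k p \<alpha>) (\<lambda>i. \<alpha> (i, c)) i)\<^sup>2) /
        (\<Sum>i<n. (lsres n k (select_cols n k p \<alpha>) (\<lambda>i. \<alpha> (i, c)) i)\<^sup>2)"
      by (simp add: h_def \<Phi>_def v)
  qed
  finally show ?thesis ..
qed

section \<open>The joint law of matrix, signal and noise\<close>

lemma indep_rv_prob:
  assumes "prob_space M" "indep_rv M S X T Y" "B \<in> sets S" "C \<in> sets T"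
  shows "measure M {\<omega> \<in> space M. X \<omega> \<in> B \<and> Y \<omega> \<in> C} =
    measure M {\<omega> \<in> space M. X \<omega> \<in> B} * measure M {\<omega> \<in> space M. Y \<omega> \<in> C}"
proof -
  interpret prob_space M by fact
  have "prob ((X -` B \<inter> space M) \<inter> (Y -` C \<inter> space M)) = prob (X -` B \<inter> space M) * prob (Y -` C \<inter> space M)"
    using assms(2-4) unfolding indep_rv_def by (intro indep_setD) auto
  moreover have "X -` B \<inter> space M = {\<omega> \<in> space M. X \<omega> \<in> B}" "Y -` C \<inter> space M = {\<omega> \<in> space M. Y \<omega> \<in> C}"
    "(X -` B \<inter> space M) \<inter> (Y -` C \<inter> space M) = {\<omega> \<in> space M. X \<omega> \<in> B \<and> Y \<omega> \<in> C}" by auto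
  ultimately show ?thesis by simp
qed

lemma has_law_normal_scale:
  assumes "has_law M X (normal_law v)" "c * sqrt v = 1"
  shows "distr M borel (\<lambda>\<omega>. c * X \<omega>) = std_normal_distribution"
proof -
  have X: "X \<in> borel_measurable M" "distr M borel X = distr std_normal_distribution borel (\<lambda>z. sqrt v * z)"
    using assms(1) by (auto simp: has_law_def normal_law_def)
  have "distr M borel (\<lambda>\<omega>. c * X \<omega>) = distr (distr M borel X) borel ((*) c)"
    by (subst distr_distr[OF _ X(1)]) (auto simp: comp_def)
  also have "\<dots> = distr std_normal_distribution borel (\<lambda>z. z)"
    unfolding X(2) using assms(2) by (subst distr_distr) (auto simp: comp_def mult.assoc[symmetric])
  also have "\<dots> = std_normal_distribution"
    by (rule distr_id2) simp
  finally show ?thesis .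
qed

lemma indep_normal_box:
  assumes "prob_space M" "finite I" and ind: "prob_space.indep_vars M (\<lambda>_. borel) X I"
    and law: "\<And>i. i \<in> I \<Longrightarrow> has_law M (X i) (normal_law v)" and c: "c * sqrt v = 1"
    and E: "\<And>i. i \<in> I \<Longrightarrow> E i \<in> sets borel"
  shows "measure M {\<omega> \<in> space M. \<forall>i\<in>I. c * X i \<omega> \<in> E i} = (\<Prod>i\<in>I. measure std_normal_distribution (E i))"
proof -
  interpret prob_space M by fact
  show ?thesis
  proof (cases "I = {}")
    case True
    then show ?thesis by (simp add: prob_space)
  next
    case False
    have Xm: "X i \<in> borel_measurable M" if "i \<in> I" for i using law[OF that] by (simp add: has_law_def)
    define E' where "E' i = (\<lambda>x. c * x) -` E i" for i
    have E': "E' i \<in> sets borel" if "i \<in> I" for i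
      using measurable_sets[of "\<lambda>x::real. c * x" borel borel "E i"] E[OF that] by (simp add: E'_def)
    have "{\<omega> \<in> space M. \<forall>i\<in>I. c * X i \<omega> \<in> E i} = (\<Inter>i\<in>I. X i -` E' i \<inter> space M)"
      using False by (auto simp: E'_def)
    then have "prob {\<omega> \<in> space M. \<forall>i\<in>I. c * X i \<omega> \<in> E i} = (\<Prod>i\<in>I. prob (X i -` E' i \<inter> space M))"
      using indep_varsD_finite[OF ind False assms(2)] E' by simp
    also have "\<dots> = (\<Prod>i\<in>I. measure std_normal_distribution (E i))"
    proof (rule prod.cong[OF refl])
      fix i assume i: "i \<in> I"
      have "measure std_normal_distribution (E i) = measure (distr M borel (\<lambda>\<omega>. c * X i \<omega>)) (E i)"
        by (simp only: has_law_normal_scale[OF law[OF i] c])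
      also have "\<dots> = prob ((\<lambda>\<omega>. c * X i \<omega>) -` E i \<inter> space M)"
        using Xm[OF i] E[OF i] by (intro measure_distr) auto
      finally show "prob (X i -` E' i \<inter> space M) = measure std_normal_distribution (E i)"
        by (simp add: E'_def vimage_def)
    qed
    finally show ?thesis .
  qed
qed

text \<open>Box probabilities suffice for independence. Conditioning on the event that X lies in C
  is the uniform measure on that event; under it Y has Gaussian box probabilities, hence the
  Gaussian law, and boxes may be replaced by arbitrary measurable sets.\<close>

lemma distr_pair_gauss_boxI:
  fixes Y :: "'w \<Rightarrow> 'p \<Rightarrow> real"
  assumes M: "prob_space M" and J: "finite J" and X: "X \<in> M \<rightarrow>\<^sub>M S"
    and Y: "\<And>p. p \<in> J \<Longrightarrow> (\<lambda>\<omega>. Y \<omega> p) \<in> borel_measurable M"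
    and box: "\<And>C E. C \<in> sets S \<Longrightarrow> (\<And>p. p \<in> J \<Longrightarrow> E p \<in> sets borel) \<Longrightarrow>
      measure M {\<omega> \<in> space M. X \<omega> \<in> C \<and> (\<forall>p\<in>J. Y \<omega> p \<in> E p)} =
      measure M {\<omega> \<in> space M. X \<omega> \<in> C} * (\<Prod>p\<in>J. measure std_normal_distribution (E p))"
  shows "distr M (S \<Otimes>\<^sub>M gauss J) (\<lambda>\<omega>. (X \<omega>, \<lambda>p\<in>J. Y \<omega> p)) = distr M S X \<Otimes>\<^sub>M gauss J"
proof -
  interpret prob_space M by fact
  interpret N: prob_space std_normal_distribution by (rule prob_space_std_normal)
  interpret G: prob_space "gauss J" by (rule prob_space_gauss)
  interpret PP: product_prob_space "\<lambda>_::'p. std_normal_distribution" J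
    by (intro product_prob_spaceI prob_space_std_normal)
  have Ym: "(\<lambda>\<omega>. \<lambda>p\<in>J. Y \<omega> p) \<in> M \<rightarrow>\<^sub>M gauss J"
    by (rule measurable_restrict) (simp add: Y)
  have XY: "(\<lambda>\<omega>. (X \<omega>, \<lambda>p\<in>J. Y \<omega> p)) \<in> M \<rightarrow>\<^sub>M S \<Otimes>\<^sub>M gauss J"
    by (rule measurable_Pair[OF X Ym])
  show ?thesis
  proof (rule pair_measure_eqI[symmetric])
    show "sigma_finite_measure (distr M S X)"
      by (intro prob_space_imp_sigma_finite prob_space_distr X)
    show "sigma_finite_measure (gauss J)" by (rule G.sigma_finite_measure_axioms)
    show "sets (distr M S X \<Otimes>\<^sub>M gauss J) = sets (distr M (S \<Otimes>\<^sub>M gauss J) (\<lambda>\<omega>. (X \<omega>, \<lambda>p\<in>J. Y \<omega> p)))"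
      by (simp cong: sets_pair_measure_cong)
    fix C B assume "C \<in> sets (distr M S X)" and B: "B \<in> sets (gauss J)"
    then have C: "C \<in> sets S" by simp
    define A where "A = {\<omega> \<in> space M. X \<omega> \<in> C}"
    have A: "A \<in> sets M" "X -` C \<inter> space M = A"
      using measurable_sets[OF X C] by (auto simp: A_def vimage_def Int_def conj_commute)
    let ?Y = "\<lambda>\<omega>. \<lambda>p\<in>J. Y \<omega> p"
    have *: "emeasure M (A \<inter> (?Y -` B \<inter> space M)) = emeasure M A * emeasure (gauss J) B"
    proof (cases "prob A = 0")
      \<comment> \<open>A null event cannot be conditioned on, but both sides vanish.\<close>
      case True
      then have "emeasure M A = 0" by (simp add: emeasure_eq_measure)
      then show ?thesis
        using emeasure_mono[of "A \<inter> (?Y -` B \<inter> space M)" A M] A(1) by simp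
    next
      case False
      let ?U = "uniform_measure M A"
      have pA: "prob A > 0" using False measure_nonneg[of M A] by linarith
      have Yu: "?Y \<in> ?U \<rightarrow>\<^sub>M gauss J" using Ym by simp
      have "distr ?U (gauss J) ?Y = gauss J"
      proof (rule PP.PiM_eqI[OF J])
        fix E :: "'p \<Rightarrow> real set" assume E: "\<And>p. p \<in> J \<Longrightarrow> E p \<in> sets std_normal_distribution"
        have sE: "Pi\<^sub>E J E \<in> sets (gauss J)" using E J by (intro sets_PiM_I_finite) auto
        have "A \<inter> (?Y -` Pi\<^sub>E J E \<inter> space M) = {\<omega> \<in> space M. X \<omega> \<in> C \<and> (\<forall>p\<in>J. Y \<omega> p \<in> E p)}"
          by (auto simp: A_def PiE_iff)
        then have "prob (A \<inter> (?Y -` Pi\<^sub>E J E \<inter> space M)) = prob A * (\<Prod>p\<in>J. measure std_normal_distribution (E p))"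
          using box[OF C, of E] E by (simp add: A_def)
        moreover have "emeasure (distr ?U (gauss J) ?Y) (Pi\<^sub>E J E) =
            emeasure M (A \<inter> (?Y -` Pi\<^sub>E J E \<inter> space M)) / emeasure M A"
          using measurable_sets[OF Ym sE] A(1) by (simp add: emeasure_distr[OF Yu sE])
        ultimately have "emeasure (distr ?U (gauss J) ?Y) (Pi\<^sub>E J E) =
            ennreal (\<Prod>p\<in>J. measure std_normal_distribution (E p))"
          using pA by (simp add: emeasure_eq_measure divide_ennreal prod_nonneg)
        also have "\<dots> = (\<Prod>p\<in>J. emeasure std_normal_distribution (E p))"
          by (simp add: N.emeasure_eq_measure prod_ennreal)
        finally show "emeasure (distr ?U (gauss J) ?Y) (Pi\<^sub>E J E) =
            (\<Prod>p\<in>J. emeasure std_normal_distribution (E p))" .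
      qed simp
      from arg_cong[OF this, of "\<lambda>M. emeasure M B"]
      have "emeasure M (A \<inter> (?Y -` B \<inter> space M)) / emeasure M A = emeasure (gauss J) B"
        using measurable_sets[OF Ym B] A(1) by (simp add: emeasure_distr[OF Yu B])
      then show ?thesis using pA
        by (simp add: emeasure_eq_measure G.emeasure_eq_measure divide_ennreal ennreal_mult[symmetric] field_simps)
    qed
    show "emeasure (distr M S X) C * emeasure (gauss J) B =
        emeasure (distr M (S \<Otimes>\<^sub>M gauss J) (\<lambda>\<omega>. (X \<omega>, \<lambda>p\<in>J. Y \<omega> p))) (C \<times> B)"
    proof -
      have "(\<lambda>\<omega>. (X \<omega>, ?Y \<omega>)) -` (C \<times> B) \<inter> space M = A \<inter> (?Y -` B \<inter> space M)"
        by (auto simp: A_def)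
      moreover have "C \<times> B \<in> sets (S \<Otimes>\<^sub>M gauss J)" using B C by (rule pair_measureI[rotated])
      ultimately show ?thesis
        using * by (simp only: emeasure_distr[OF XY] emeasure_distr[OF X C] A(2))
    qed
  qed
qed

lemma measurable_mat_entry: "p \<in> {..<n} \<times> {..<m} \<Longrightarrow> (\<lambda>B. B $$ p) \<in> borel_measurable (mat_borel n m)"
  using iffD1[OF measurable_mat_borel_iff measurable_ident_sets[OF refl], of n m] by blast

lemma measurable_vec_entry: "i < n \<Longrightarrow> (\<lambda>v. v $ i) \<in> borel_measurable (vec_borel n)"
  using measurable_vec_borel_iff[of "\<lambda>v. v" "vec_borel n" n] by simp

lemma measure_gauss_reindex_box:
  fixes idx :: "'p \<Rightarrow> 'q"
  assumes "finite J" "inj_on idx J" and E: "\<And>p. p \<in> J \<Longrightarrow> E p \<in> sets borel"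
  shows "measure (gauss UNIV) {\<tau> \<in> space (gauss UNIV). \<forall>p\<in>J. \<tau> (idx p) \<in> E p} =
    (\<Prod>p\<in>J. measure std_normal_distribution (E p))"
proof -
  interpret N: prob_space std_normal_distribution by (rule prob_space_std_normal)
  interpret PP: product_prob_space "\<lambda>_::'p. std_normal_distribution" J
    by (intro product_prob_spaceI prob_space_std_normal)
  let ?r = "\<lambda>\<tau>. \<lambda>p\<in>J. \<tau> (idx p)"
  have law: "distr (gauss UNIV) (gauss J) ?r = gauss J"
    by (rule distr_PiM_reindex[of UNIV "\<lambda>_. std_normal_distribution" idx J]) (use assms prob_space_std_normal in auto)
  have r: "?r \<in> gauss UNIV \<rightarrow>\<^sub>M gauss J"
    by measurable
  have sE: "Pi\<^sub>E J E \<in> sets (gauss J)" using E assms(1) by (intro sets_PiM_I_finite) auto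
  have "measure (gauss J) (Pi\<^sub>E J E) = measure (gauss UNIV) (?r -` Pi\<^sub>E J E \<inter> space (gauss UNIV))"
    using measure_distr[OF r sE] law by simp
  also have "?r -` Pi\<^sub>E J E \<inter> space (gauss UNIV) = {\<tau> \<in> space (gauss UNIV). \<forall>p\<in>J. \<tau> (idx p) \<in> E p}"
    by (auto simp: PiE_iff)
  finally have preimage: "measure (gauss J) (Pi\<^sub>E J E) =
      measure (gauss UNIV) {\<tau> \<in> space (gauss UNIV). \<forall>p\<in>J. \<tau> (idx p) \<in> E p}" .
  have "emeasure (gauss J) (Pi\<^sub>E J E) = ennreal (\<Prod>p\<in>J. measure std_normal_distribution (E p))"
    using E assms(1) by (simp add: PP.emeasure_PiM N.emeasure_eq_measure prod_ennreal)
  then have "measure (gauss J) (Pi\<^sub>E J E) = (\<Prod>p\<in>J. measure std_normal_distribution (E p))"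
    by (intro measure_eq_emeasure_eq_ennreal prod_nonneg) auto
  with preimage show ?thesis by simp
qed

text \<open>One infinite sequence serves all sizes: entry (i, j) of an auxiliary column will read
  coordinate j * n + i.\<close>

definition enlarged :: "'w measure \<Rightarrow> ('w \<times> (nat \<Rightarrow> real)) measure" where
  "enlarged M = M \<Otimes>\<^sub>M gauss UNIV"

definition coords :: "('w \<Rightarrow> real Matrix.vec) \<Rightarrow> nat \<Rightarrow> 'w \<Rightarrow> nat \<Rightarrow> real" where
  "coords x N \<omega> = (\<lambda>j\<in>{..<N}. x \<omega> $ j)"

text \<open>The rescaled columns of \<open>A\<close>, followed by \<open>k\<close> auxiliary columns and the rescaled noise, which is replaced by
  a further auxiliary column if \<open>\<sigma> = 0\<close>.\<close>

definition noise_cols :: "('w \<Rightarrow> real Matrix.mat) \<Rightarrow> ('w \<Rightarrow> real Matrix.vec) \<Rightarrow> nat \<Rightarrow> nat \<Rightarrow> nat \<Rightarrow> real \<Rightarrow>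
    'w \<times> (nat \<Rightarrow> real) \<Rightarrow> nat \<times> nat \<Rightarrow> real" where
  "noise_cols A e k n N \<sigma> \<omega> = (\<lambda>(i, j)\<in>{..<n} \<times> {..<N + k + 1}.
     if j < N then sqrt n * A (fst \<omega>) $$ (i, j)
     else if j = N + k \<and> \<sigma> \<noteq> 0 then sqrt n / \<sigma> * e (fst \<omega>) $ i
     else snd \<omega> (j * n + i))"

context
  fixes M :: "'w measure"
    and A :: "'w \<Rightarrow> real Matrix.mat"
    and x e :: "'w \<Rightarrow> real Matrix.vec"
    and k n N :: nat
    and \<sigma> :: real
  assumes M: "prob_space M" and n: "0 < n"
    and sigma: "\<sigma> \<ge> 0"
    and A: "A \<in> M \<rightarrow>\<^sub>M mat_borel n N"
    and A_indep: "prob_space.indep_vars M (\<lambda>_. borel) (\<lambda>p \<omega>. A \<omega> $$ p) ({..<n} \<times> {..<N})"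
    and A_law: "\<And>p. p \<in> {..<n} \<times> {..<N} \<Longrightarrow> has_law M (\<lambda>\<omega>. A \<omega> $$ p) (normal_law (1 / real n))"
    and x: "x \<in> M \<rightarrow>\<^sub>M vec_borel N"
    and Ax: "indep_rv M (mat_borel n N) A (vec_borel N) x"
    and e: "e \<in> M \<rightarrow>\<^sub>M vec_borel n"
    and e_indep: "prob_space.indep_vars M (\<lambda>_. borel) (\<lambda>i \<omega>. vec_index (e \<omega>) i) {..<n}"
    and e_law: "\<And>i. i < n \<Longrightarrow> has_law M (\<lambda>\<omega>. vec_index (e \<omega>) i) (normal_law (\<sigma>\<^sup>2 / real n))"
    and eAx: "indep_rv M (vec_borel n) e (mat_borel n N \<Otimes>\<^sub>M vec_borel N) (\<lambda>\<omega>. (A \<omega>, x \<omega>))"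
begin

lemma enlargement_enlarged: "enlargement M (enlarged M) fst"
proof -
  interpret M: prob_space M by (rule M)
  interpret G: prob_space "gauss (UNIV :: nat set)" by (rule prob_space_gauss)
  interpret P: pair_prob_space M "gauss (UNIV :: nat set)" ..
  show ?thesis
    unfolding enlargement_def enlarged_def using G.distr_pair_fst P.prob_space_axioms by simp
qed

lemma measurable_coords: "coords x N \<in> M \<rightarrow>\<^sub>M Pi\<^sub>M {..<N} (\<lambda>_. borel)"
  unfolding coords_def using x
  by (intro measurable_restrict) (auto simp: measurable_vec_borel_iff)

text \<open>A is independent of x, e of the pair (A, x), and the auxiliary sequence of all of them.
  Hence the completed matrix is standard Gaussian and independent of the signal, and all further
  laws can be computed on this product.\<close>

lemma
  shows measurable_coords_noise_cols: "(\<lambda>\<omega>. (coords x N (fst \<omega>), noise_cols A e k n N \<sigma> \<omega>)) \<in>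
    enlarged M \<rightarrow>\<^sub>M Pi\<^sub>M {..<N} (\<lambda>_. borel) \<Otimes>\<^sub>M gauss ({..<n} \<times> {..<N + k + 1})"
  and distr_coords_noise_cols: "distr (enlarged M) (Pi\<^sub>M {..<N} (\<lambda>_. borel) \<Otimes>\<^sub>M gauss ({..<n} \<times> {..<N + k + 1})) (\<lambda>\<omega>. (coords x N (fst \<omega>), noise_cols A e k n N \<sigma> \<omega>)) =
    distr M (Pi\<^sub>M {..<N} (\<lambda>_. borel)) (coords x N) \<Otimes>\<^sub>M gauss ({..<n} \<times> {..<N + k + 1})"
proof -
  interpret M: prob_space M by (rule M)
  interpret G: prob_space "gauss (UNIV :: nat set)" by (rule prob_space_gauss)
  interpret P: pair_prob_space M "gauss (UNIV :: nat set)" ..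
  let ?J = "{..<n} \<times> {..<N + k + 1}" and ?S = "Pi\<^sub>M {..<N} (\<lambda>_. borel :: real measure)"
  \<comment> \<open>The entries are partitioned by origin: \<open>JA\<close> from the matrix,
    \<open>Je\<close> from the noise, \<open>Jt\<close> from the auxiliary sequence. For \<sigma> =
    0 the noise column belongs to \<open>Jt\<close>.\<close>
  define JA where "JA = {..<n} \<times> {..<N}"
  define Je where "Je = (if \<sigma> = 0 then {} else {..<n} \<times> {N + k})"
  define Jt where "Jt = ?J - JA - Je"
  define idx where "idx p = snd p * n + fst p" for p :: "nat \<times> nat"
  have fin: "finite JA" "finite Je" "finite Jt" by (auto simp: JA_def Je_def Jt_def)
  have J: "?J = JA \<union> Je \<union> Jt" "JA \<inter> Je = {}" "(JA \<union> Je) \<inter> Jt = {}"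
    by (auto simp: JA_def Je_def Jt_def)
  \<comment> \<open>The row number is below n, so remainder and quotient by n recover both
    indices.\<close>
  have idx: "inj_on idx Jt"
  proof (rule inj_onI)
    fix p q assume pq: "p \<in> Jt" "q \<in> Jt" "idx p = idx q"
    then have "fst p < n" "fst q < n" by (auto simp: Jt_def)
    moreover have "idx p mod n = idx q mod n" "idx p div n = idx q div n" using pq by simp_all
    ultimately show "p = q" by (simp add: idx_def prod_eq_iff)
  qed
  define \<alpha> where "\<alpha> \<omega> p = (if snd p < N then sqrt n * A (fst \<omega>) $$ p
     else if snd p = N + k \<and> \<sigma> \<noteq> 0 then sqrt n / \<sigma> * e (fst \<omega>) $ (fst p)
     else snd \<omega> (idx p))" for \<omega> :: "'w \<times> (nat \<Rightarrow> real)" and p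
  have noise: "noise_cols A e k n N \<sigma> \<omega> = (\<lambda>p\<in>?J. \<alpha> \<omega> p)" for \<omega>
    unfolding noise_cols_def by (intro restrict_ext) (auto simp: \<alpha>_def idx_def)
  have Am: "(\<lambda>\<omega>. A \<omega> $$ p) \<in> borel_measurable M" if "p \<in> JA" for p
    using A that by (auto simp: measurable_mat_borel_iff JA_def)
  have em: "(\<lambda>\<omega>. e \<omega> $ i) \<in> borel_measurable M" if "i < n" for i
    using e that by (auto simp: measurable_vec_borel_iff)
  have \<alpha>m: "(\<lambda>\<omega>. \<alpha> \<omega> p) \<in> borel_measurable (enlarged M)" if p: "p \<in> ?J" for p
  proof -
    consider "p \<in> JA" | "p \<in> Je" | "p \<in> Jt" using p J(1) by blast
    then show ?thesis
    proof cases
      case 1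
      then have "(\<lambda>\<omega>. \<alpha> \<omega> p) = (\<lambda>\<omega>. sqrt n * A (fst \<omega>) $$ p)" by (auto simp: JA_def \<alpha>_def)
      then show ?thesis unfolding enlarged_def
        by (simp only:) (intro borel_measurable_times borel_measurable_const measurable_compose[OF measurable_fst Am[OF 1]])
    next
      case 2
      then have "(\<lambda>\<omega>. \<alpha> \<omega> p) = (\<lambda>\<omega>. sqrt n / \<sigma> * e (fst \<omega>) $ fst p)" "fst p < n"
        by (auto simp: Je_def \<alpha>_def split: if_splits)
      then show ?thesis unfolding enlarged_def
        by (simp only:) (intro borel_measurable_times borel_measurable_const measurable_compose[OF measurable_fst em])
    next
      case 3
      then have "(\<lambda>\<omega>. \<alpha> \<omega> p) = (\<lambda>\<omega>. snd \<omega> (idx p))" by (auto simp: Jt_def JA_def Je_def \<alpha>_def split: if_splits)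
      then show ?thesis unfolding enlarged_def
        by (simp only:) (intro measurable_compose[OF measurable_snd gauss_component] UNIV_I)
    qed
  qed
  have cm: "(\<lambda>\<omega>. coords x N (fst \<omega>)) \<in> enlarged M \<rightarrow>\<^sub>M ?S"
    unfolding enlarged_def by (rule measurable_compose[OF measurable_fst measurable_coords])
  have law1: "distr (enlarged M) ?S (\<lambda>\<omega>. coords x N (fst \<omega>)) = distr M ?S (coords x N)"
  proof -
    have "distr (enlarged M) ?S (\<lambda>\<omega>. coords x N (fst \<omega>)) = distr (distr (enlarged M) M fst) ?S (coords x N)"
      by (subst distr_distr[OF measurable_coords]) (auto simp: enlarged_def comp_def)
    then show ?thesis using enlargement_enlarged by (simp add: enlargement_def)
  qed
  have "distr (enlarged M) (?S \<Otimes>\<^sub>M gauss ?J) (\<lambda>\<omega>. (coords x N (fst \<omega>), \<lambda>p\<in>?J. \<alpha> \<omega> p)) =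
      distr (enlarged M) ?S (\<lambda>\<omega>. coords x N (fst \<omega>)) \<Otimes>\<^sub>M gauss ?J"
  proof (rule distr_pair_gauss_boxI[OF _ _ cm \<alpha>m])
    show "prob_space (enlarged M)" using enlargement_enlarged by (simp add: enlargement_def)
    show "finite ?J" by simp
    fix C E assume C: "C \<in> sets ?S" and E: "\<And>p. p \<in> ?J \<Longrightarrow> E p \<in> sets (borel :: real measure)"
    let ?N = "measure std_normal_distribution"
    define SA where "SA = {B \<in> space (mat_borel n N). \<forall>p\<in>JA. sqrt n * B $$ p \<in> E p}"
    define SC where "SC = {v \<in> space (vec_borel N). (\<lambda>j\<in>{..<N}. v $ j) \<in> C}"
    define Se where "Se = {v \<in> space (vec_borel n). \<forall>p\<in>Je. sqrt n / \<sigma> * v $ fst p \<in> E p}"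
    define B2 where "B2 = {\<tau> \<in> space (gauss UNIV). \<forall>p\<in>Jt. \<tau> (idx p) \<in> E p}"
    define B1 where "B1 = {\<omega> \<in> space M. e \<omega> \<in> Se \<and> (A \<omega>, x \<omega>) \<in> SA \<times> SC}"
    have SA: "SA \<in> sets (mat_borel n N)"
      unfolding SA_def
    proof (rule sets.sets_Collect_finite_All[OF _ fin(1)])
      fix p assume p: "p \<in> JA"
      then have [measurable]: "(\<lambda>B. B $$ p) \<in> borel_measurable (mat_borel n N)"
        unfolding JA_def by (rule measurable_mat_entry)
      have [measurable]: "E p \<in> sets borel" using p J(1) by (intro E) blast
      show "{B \<in> space (mat_borel n N). sqrt n * B $$ p \<in> E p} \<in> sets (mat_borel n N)" by measurable
    qed
    have Se: "Se \<in> sets (vec_borel n)"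
      unfolding Se_def
    proof (rule sets.sets_Collect_finite_All[OF _ fin(2)])
      fix p assume p: "p \<in> Je"
      then have "fst p < n" by (auto simp: Je_def split: if_splits)
      then have [measurable]: "(\<lambda>v. v $ fst p) \<in> borel_measurable (vec_borel n)"
        by (rule measurable_vec_entry)
      have [measurable]: "E p \<in> sets borel" using p J(1) by (intro E) blast
      show "{v \<in> space (vec_borel n). sqrt n / \<sigma> * v $ fst p \<in> E p} \<in> sets (vec_borel n)" by measurable
    qed
    have SC: "SC \<in> sets (vec_borel N)"
    proof -
      have "(\<lambda>v. \<lambda>j\<in>{..<N}. v $ j) \<in> vec_borel N \<rightarrow>\<^sub>M ?S"
        by (intro measurable_restrict measurable_vec_entry) auto
      from measurable_sets[OF this C] show ?thesis by (simp add: SC_def vimage_def Int_def conj_commute)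
    qed
    have sp: "A \<omega> \<in> space (mat_borel n N)" "x \<omega> \<in> space (vec_borel N)" "e \<omega> \<in> space (vec_borel n)" if "\<omega> \<in> space M" for \<omega>
      using measurable_space[OF A that] measurable_space[OF x that] measurable_space[OF e that] by auto
    have C_eq: "M.prob {\<omega> \<in> space M. x \<omega> \<in> SC} = M.prob {\<omega> \<in> space M. coords x N \<omega> \<in> C}"
      by (intro arg_cong[where f = M.prob]) (auto simp: SC_def coords_def sp)
    have pA: "M.prob {\<omega> \<in> space M. A \<omega> \<in> SA} = (\<Prod>p\<in>JA. ?N (E p))"
    proof -
      have "M.prob {\<omega> \<in> space M. \<forall>p\<in>JA. sqrt n * A \<omega> $$ p \<in> E p} = (\<Prod>p\<in>JA. ?N (E p))"
        by (rule indep_normal_box[where v = "1 / real n", OF M fin(1) A_indep[folded JA_def] A_law[folded JA_def]])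
           (use E J(1) n in \<open>auto simp: real_sqrt_divide\<close>)
      then show ?thesis using sp by (simp add: SA_def cong: conj_cong)
    qed
    have pe: "M.prob {\<omega> \<in> space M. e \<omega> \<in> Se} = (\<Prod>p\<in>Je. ?N (E p))"
    proof (cases "\<sigma> = 0")
      case True
      then have "{\<omega> \<in> space M. e \<omega> \<in> Se} = space M" using sp by (auto simp: Se_def Je_def)
      then show ?thesis using True by (simp add: Je_def M.prob_space)
    next
      case False
      \<comment> \<open>The noise entries have standard deviation \<sigma> / sqrt n, hence the
        scaling in \<open>noise_cols\<close>.\<close>
      have s: "sqrt n / \<sigma> * sqrt (\<sigma>\<^sup>2 / real n) = 1" using False sigma n by (simp add: real_sqrt_divide)
      have "M.prob {\<omega> \<in> space M. \<forall>i\<in>{..<n}. sqrt n / \<sigma> * e \<omega> $ i \<in> E (i, N + k)} = (\<Prod>i<n. ?N (E (i, N + k)))"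
        by (rule indep_normal_box[OF M _ e_indep e_law s]) (use E in auto)
      moreover have "{\<omega> \<in> space M. e \<omega> \<in> Se} = {\<omega> \<in> space M. \<forall>i\<in>{..<n}. sqrt n / \<sigma> * e \<omega> $ i \<in> E (i, N + k)}"
        using False sp by (auto simp: Se_def Je_def)
      moreover have "(\<Prod>p\<in>Je. ?N (E p)) = (\<Prod>i<n. ?N (E (i, N + k)))"
      proof -
        have "Je = (\<lambda>i. (i, N + k)) ` {..<n}" using False by (auto simp: Je_def)
        then show ?thesis by (simp add: prod.reindex inj_on_def)
      qed
      ultimately show ?thesis by simp
    qed
    have pt: "measure (gauss UNIV) B2 = (\<Prod>p\<in>Jt. ?N (E p))"
      unfolding B2_def by (rule measure_gauss_reindex_box[OF fin(3) idx]) (use E J(1) in auto)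
    \<comment> \<open>The two independence hypotheses act in turn: first e against (A, x), then A
      against x.\<close>
    have pB1: "M.prob B1 = M.prob {\<omega> \<in> space M. coords x N \<omega> \<in> C} * ((\<Prod>p\<in>JA. ?N (E p)) * (\<Prod>p\<in>Je. ?N (E p)))"
    proof -
      have "M.prob B1 = M.prob {\<omega> \<in> space M. e \<omega> \<in> Se} * M.prob {\<omega> \<in> space M. (A \<omega>, x \<omega>) \<in> SA \<times> SC}"
        unfolding B1_def by (rule indep_rv_prob[OF M eAx Se pair_measureI[OF SA SC]])
      moreover have "M.prob {\<omega> \<in> space M. (A \<omega>, x \<omega>) \<in> SA \<times> SC} =
          M.prob {\<omega> \<in> space M. A \<omega> \<in> SA} * M.prob {\<omega> \<in> space M. x \<omega> \<in> SC}"
        using indep_rv_prob[OF M Ax SA SC] by simp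
      ultimately show ?thesis by (simp add: pA pe C_eq)
    qed
    \<comment> \<open>The event separates into a condition on M and one on the auxiliary sequence,
      so it is a rectangle of the product.\<close>
    have eq: "{\<omega> \<in> space (enlarged M). coords x N (fst \<omega>) \<in> C \<and> (\<forall>p\<in>?J. \<alpha> \<omega> p \<in> E p)} = B1 \<times> B2"
    proof -
      have "(\<forall>p\<in>?J. \<alpha> \<omega> p \<in> E p) \<longleftrightarrow> (\<forall>p\<in>JA. sqrt n * A (fst \<omega>) $$ p \<in> E p) \<and>
          (\<forall>p\<in>Je. sqrt n / \<sigma> * e (fst \<omega>) $ fst p \<in> E p) \<and> (\<forall>p\<in>Jt. snd \<omega> (idx p) \<in> E p)" for \<omega>
      proof -
        have "\<alpha> \<omega> p = sqrt n * A (fst \<omega>) $$ p" if "p \<in> JA" for p using that by (auto simp: JA_def \<alpha>_def)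
        moreover have "\<alpha> \<omega> p = sqrt n / \<sigma> * e (fst \<omega>) $ fst p" if "p \<in> Je" for p
          using that by (auto simp: Je_def \<alpha>_def split: if_splits)
        moreover have "\<alpha> \<omega> p = snd \<omega> (idx p)" if "p \<in> Jt" for p
          using that by (auto simp: Jt_def JA_def Je_def \<alpha>_def split: if_splits)
        ultimately show ?thesis unfolding J(1) ball_Un by auto
      qed
      then show ?thesis
        by (auto simp: enlarged_def space_pair_measure B1_def B2_def SA_def SC_def Se_def coords_def sp)
    qed
    have B1m: "B1 \<in> sets M"
    proof -
      have "B1 = (e -` Se \<inter> space M) \<inter> ((A -` SA \<inter> space M) \<inter> (x -` SC \<inter> space M))" by (auto simp: B1_def)
      then show ?thesis using measurable_sets[OF A SA] measurable_sets[OF e Se] measurable_sets[OF x SC] by auto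
    qed
    have B2m: "B2 \<in> sets (gauss UNIV)"
      unfolding B2_def
    proof (rule sets.sets_Collect_finite_All[OF _ fin(3)])
      fix p assume "p \<in> Jt"
      then have [measurable]: "E p \<in> sets borel" using E[of p] J(1) by auto
      show "{\<tau> \<in> space (gauss UNIV). \<tau> (idx p) \<in> E p} \<in> sets (gauss UNIV)" by measurable
    qed
    have prod: "measure (enlarged M) (X1 \<times> X2) = M.prob X1 * G.prob X2" if "X1 \<in> sets M" "X2 \<in> sets (gauss UNIV)" for X1 X2
      using G.emeasure_pair_measure_Times[OF that] unfolding enlarged_def
      by (simp add: measure_def enn2real_mult)
    have "measure (enlarged M) {\<omega> \<in> space (enlarged M). coords x N (fst \<omega>) \<in> C} = M.prob {\<omega> \<in> space M. coords x N \<omega> \<in> C}"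
    proof -
      have "{\<omega> \<in> space M. coords x N \<omega> \<in> C} \<in> sets M"
        using measurable_sets[OF measurable_coords C] by (simp add: vimage_def Int_def conj_commute)
      moreover have "{\<omega> \<in> space (enlarged M). coords x N (fst \<omega>) \<in> C} = {\<omega> \<in> space M. coords x N \<omega> \<in> C} \<times> space (gauss UNIV)"
        by (auto simp: enlarged_def space_pair_measure)
      ultimately show ?thesis using prod by (simp add: G.prob_space)
    qed
    moreover have "(\<Prod>p\<in>?J. ?N (E p)) = (\<Prod>p\<in>JA. ?N (E p)) * (\<Prod>p\<in>Je. ?N (E p)) * (\<Prod>p\<in>Jt. ?N (E p))"
      unfolding J(1) using fin J(2,3) by (simp add: prod.union_disjoint)
    ultimately show "measure (enlarged M) {\<omega> \<in> space (enlarged M). coords x N (fst \<omega>) \<in> C \<and> (\<forall>p\<in>?J. \<alpha> \<omega> p \<in> E p)} =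
        measure (enlarged M) {\<omega> \<in> space (enlarged M). coords x N (fst \<omega>) \<in> C} * (\<Prod>p\<in>?J. ?N (E p))"
      unfolding eq using prod[OF B1m B2m] by (simp add: pB1 pt)
  qed
  then show "distr (enlarged M) (?S \<Otimes>\<^sub>M gauss ?J) (\<lambda>\<omega>. (coords x N (fst \<omega>), noise_cols A e k n N \<sigma> \<omega>)) =
      distr M ?S (coords x N) \<Otimes>\<^sub>M gauss ?J"
    unfolding noise law1 .
  have "(\<lambda>\<omega>. \<lambda>p\<in>?J. \<alpha> \<omega> p) \<in> enlarged M \<rightarrow>\<^sub>M gauss ?J"
    by (rule measurable_restrict) (simp add: \<alpha>m)
  with cm show "(\<lambda>\<omega>. (coords x N (fst \<omega>), noise_cols A e k n N \<sigma> \<omega>)) \<in> enlarged M \<rightarrow>\<^sub>M ?S \<Otimes>\<^sub>M gauss ?J"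
    unfolding noise by (rule measurable_Pair)
qed

end

section \<open>Submatrices and pseudoinverses\<close>

text \<open>Turns sums over positions in a submatrix into sums over the index set itself, which
  removes the ordering from all norms and products.\<close>

lemma bij_betw_pick: "finite J \<Longrightarrow> bij_betw (pick J) {..<card J} J"
proof -
  assume J: "finite J"
  have inj: "inj_on (pick J) {..<card J}"
    by (intro strict_mono_on_imp_inj_on strict_mono_onI pick_mono_le) auto
  have sub: "pick J ` {..<card J} \<subseteq> J" by (auto intro: pick_in_set_le)
  have "card (pick J ` {..<card J}) = card J" using inj by (simp add: card_image)
  with sub have "pick J ` {..<card J} = J" by (intro card_subset_eq[OF J])
  with inj show ?thesis by (simp add: bij_betw_def)
qed

lemma vnorm_vec: "vnorm (Matrix.vec m f) = sqrt (\<Sum>i<m. (f i)\<^sup>2)"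
  by (simp add: vnorm_def scalar_prod_def atLeast0LessThan power2_eq_square)

context
  fixes B :: "real Matrix.mat" and n N :: nat and J :: "nat set"
  assumes B: "B \<in> carrier_mat n N" and J: "J \<subseteq> {..<N}"
begin

lemma restrict_cols_eq: "restrict_cols B J = mat n (card J) (\<lambda>(i, a). B $$ (i, pick J a))"
proof -
  have "{j. j < dim_col B \<and> j \<in> J} = J" "{i. i < dim_row B \<and> i \<in> UNIV} = {..<n}" using B J by auto
  then show ?thesis using B by (simp add: restrict_cols_def submatrix_def pick_UNIV)
qed

lemma restrict_cols_mult_subvec:
  assumes "x \<in> carrier_vec N"
  shows "restrict_cols B J *\<^sub>v subvec x J = Matrix.vec n (\<lambda>i. \<Sum>j\<in>J. B $$ (i, j) * x $ j)"
proof -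
  have fin: "finite J" using J finite_subset by blast
  have "{j. j < dim_vec x \<and> j \<in> J} = J" using assms J by auto
  then have s: "subvec x J = Matrix.vec (card J) (\<lambda>i. x $ pick J i)" by (simp add: subvec_def)
  have "(\<Sum>a<card J. B $$ (i, pick J a) * x $ pick J a) = (\<Sum>j\<in>J. B $$ (i, j) * x $ j)" for i
    by (rule sum.reindex_bij_betw[OF bij_betw_pick[OF fin]])
  then show ?thesis
    by (intro eq_vecI) (simp_all add: restrict_cols_eq s scalar_prod_def atLeast0LessThan)
qed

lemma vnorm_subvec:
  assumes "x \<in> carrier_vec N"
  shows "vnorm (subvec x J) = sqrt (\<Sum>j\<in>J. (x $ j)\<^sup>2)"
proof -
  have fin: "finite J" using J finite_subset by blast
  have "{j. j < dim_vec x \<and> j \<in> J} = J" using assms J by auto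
  then have s: "subvec x J = Matrix.vec (card J) (\<lambda>i. x $ pick J i)" by (simp add: subvec_def)
  show ?thesis unfolding s vnorm_vec
    by (simp add: sum.reindex_bij_betw[OF bij_betw_pick[OF fin], of "\<lambda>j. (x $ j)\<^sup>2"])
qed

lemma vnorm_restrict_cols_transpose:
  "vnorm (transpose_mat (restrict_cols B J) *\<^sub>v Matrix.vec n v) = sqrt (\<Sum>j\<in>J. (\<Sum>i<n. B $$ (i, j) * v i)\<^sup>2)"
proof -
  have fin: "finite J" using J finite_subset by blast
  have "transpose_mat (restrict_cols B J) *\<^sub>v Matrix.vec n v =
      Matrix.vec (card J) (\<lambda>a. \<Sum>i<n. B $$ (i, pick J a) * v i)"
    by (intro eq_vecI) (simp_all add: restrict_cols_eq scalar_prod_def atLeast0LessThan)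
  then show ?thesis
    by (simp add: vnorm_vec sum.reindex_bij_betw[OF bij_betw_pick[OF fin], of "\<lambda>j. (\<Sum>i<n. B $$ (i, j) * v i)\<^sup>2"])
qed

end

lemma lscoef_scale: "lscoef n k w (\<lambda>i. c * z i) a = c * lscoef n k w z a"
  by (simp add: lscoef_def sum_distrib_left mult_ac)

lemma lsres_scale: "lsres n k w (\<lambda>i. c * z i) i = c * lsres n k w z i"
  by (simp add: lsres_def lscoef_scale right_diff_distrib sum_distrib_left mult_ac)

text \<open>z is the residual plus a combination of the columns, and the residual is orthogonal to
  the latter.\<close>

lemma sum_lsres_mult:
  assumes "Determinant.det (gram n k w) \<noteq> 0"
  shows "(\<Sum>i<n. lsres n k w z i * z i) = (\<Sum>i<n. (lsres n k w z i)\<^sup>2)"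
proof -
  define r b where "r = lsres n k w z" and "b = lscoef n k w z"
  have "r i * z i = (r i)\<^sup>2 + (\<Sum>a<k. b a * (w (i, a) * r i))" for i
  proof -
    have "z i = r i + (\<Sum>a<k. w (i, a) * b a)" by (simp add: lsres_def r_def b_def)
    then have "r i * z i = r i * (r i + (\<Sum>a<k. w (i, a) * b a))" by simp
    then show ?thesis by (simp add: distrib_left power2_eq_square sum_distrib_left mult_ac)
  qed
  then have "(\<Sum>i<n. r i * z i) = (\<Sum>i<n. (r i)\<^sup>2) + (\<Sum>a<k. b a * (\<Sum>i<n. w (i, a) * r i))"
    by (simp add: sum.distrib sum_distrib_left sum.swap[of _ "{..<n}" "{..<k}"])
  then show ?thesis by (simp add: lsres_orthogonal[OF assms] r_def)
qed

section \<open>Rescaling the matrix by a nonzero constant\<close>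

context
  fixes n k :: nat and w :: "nat \<times> nat \<Rightarrow> real" and c :: real
  assumes det: "Determinant.det (gram n k w) \<noteq> 0" and c: "c \<noteq> 0"
begin

lemma gram_scale: "gram n k (\<lambda>q. c * w q) = c\<^sup>2 \<cdot>\<^sub>m gram n k w"
  by (rule eq_matI) (auto simp: gram_def sum_distrib_left power2_eq_square mult_ac)

lemma det_gram_scale: "Determinant.det (gram n k (\<lambda>q. c * w q)) \<noteq> 0"
  using det c by (simp add: gram_scale)

text \<open>The inverse Gram matrix scales by c^-2. This is read off from Y H X, with adjugates X, Y
  and determinants d, f before and after scaling: it equals c^2 d Y when grouped one way and f X
  when grouped the other way.\<close>

lemma lsinv_scale: "a < k \<Longrightarrow> lsinv n k (\<lambda>q. c * w q) a i = lsinv n k w a i / c"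
proof -
  assume a: "a < k"
  let ?G = "gram n k w" and ?H = "gram n k (\<lambda>q. c * w q)"
  let ?X = "adj_mat ?G" and ?Y = "adj_mat ?H" and ?d = "Determinant.det ?G" and ?f = "Determinant.det ?H"
  note adj = adj_mat[OF gram_carrier(1)[of n k w]] and adj0 = adj_mat[OF gram_carrier(1)[of n k "\<lambda>q. c * w q"]]
  have "?H * ?X = (c\<^sup>2 * ?d) \<cdot>\<^sub>m 1\<^sub>m k"
    unfolding gram_scale using adj by (simp add: mult_smult_assoc_mat[of _ k k _ k]) (intro eq_matI, auto)
  then have "(c\<^sup>2 * ?d) \<cdot>\<^sub>m ?Y = ?Y * (?H * ?X)"
    using adj0 by (simp add: mult_smult_distrib[of _ k k _ k])
  also have "\<dots> = (?Y * ?H) * ?X"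
    using adj adj0
    by (intro assoc_mult_mat[symmetric, where ?n\<^sub>1 = k and ?n\<^sub>2 = k and ?n\<^sub>3 = k and ?n\<^sub>4 = k]) auto
  also have "\<dots> = ?f \<cdot>\<^sub>m ?X"
    using adj adj0 by (simp add: mult_smult_assoc_mat[of _ k k _ k])
  finally have e: "(c\<^sup>2 * ?d) \<cdot>\<^sub>m ?Y = ?f \<cdot>\<^sub>m ?X" .
  have ent: "?Y $$ (a, b) / ?f = ?X $$ (a, b) / (c\<^sup>2 * ?d)" if "b < k" for b
  proof -
    have "c\<^sup>2 * ?d * ?Y $$ (a, b) = ?f * ?X $$ (a, b)"
      using arg_cong[OF e, of "\<lambda>M. M $$ (a, b)"] a that carrier_matD[OF adj(1)] carrier_matD[OF adj0(1)] by simp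
    then show ?thesis using det det_gram_scale c by (simp add: field_simps)
  qed
  have "lsinv n k (\<lambda>q. c * w q) a i = (\<Sum>b<k. (?Y $$ (a, b) / ?f) * (c * w (i, b)))"
    by (simp add: lsinv_def sum_divide_distrib)
  also have "\<dots> = (\<Sum>b<k. ?X $$ (a, b) / (c\<^sup>2 * ?d) * (c * w (i, b)))"
    by (intro sum.cong refl) (simp add: ent)
  also have "\<dots> = lsinv n k w a i / c"
    using c by (simp add: lsinv_def sum_divide_distrib power2_eq_square mult_ac)
  finally show ?thesis .
qed

lemma pinv_mult_vec:
  "pinv (mat n k (\<lambda>q. c * w q)) *\<^sub>v Matrix.vec n z = Matrix.vec k (\<lambda>a. lscoef n k w z a / c)"
  unfolding pinv_eq_lsinv[OF det_gram_scale]
  by (intro eq_vecI) (simp_all add: scalar_prod_def atLeast0LessThan lsinv_scale lscoef_def sum_divide_distrib)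

text \<open>The factor c cancels in the projection: it enters through the matrix and inversely
  through its pseudoinverse.\<close>

lemma residual_mult_vec:
  "(1\<^sub>m n - mat n k (\<lambda>q. c * w q) * pinv (mat n k (\<lambda>q. c * w q))) *\<^sub>v Matrix.vec n z =
    Matrix.vec n (lsres n k w z)"
proof -
  let ?B = "mat n k (\<lambda>q. c * w q)"
  have P: "pinv ?B \<in> carrier_mat k n" by (simp add: pinv_eq_lsinv[OF det_gram_scale])
  have "(1\<^sub>m n - ?B * pinv ?B) *\<^sub>v Matrix.vec n z = 1\<^sub>m n *\<^sub>v Matrix.vec n z - (?B * pinv ?B) *\<^sub>v Matrix.vec n z"
    by (rule minus_mult_distrib_mat_vec[of _ n n]) (use P in auto)
  also have "(?B * pinv ?B) *\<^sub>v Matrix.vec n z = ?B *\<^sub>v (pinv ?B *\<^sub>v Matrix.vec n z)"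
    by (rule assoc_mult_mat_vec[of _ n k _ n]) (use P in auto)
  also have "\<dots> = Matrix.vec n (\<lambda>i. \<Sum>a<k. w (i, a) * lscoef n k w z a)"
    unfolding pinv_mult_vec using c
    by (intro eq_vecI) (simp_all add: scalar_prod_def atLeast0LessThan)
  finally show ?thesis by (auto simp: lsres_def)
qed

end

section \<open>Bounds for a fixed realization\<close>

lemma has_law_scale: "has_law M X D \<Longrightarrow> has_law M (\<lambda>\<omega>. c * X \<omega>) (scale_law c D)"
proof -
  assume "has_law M X D"
  then have X: "X \<in> borel_measurable M" "distr M borel X = D" by (auto simp: has_law_def)
  have "distr M borel (\<lambda>\<omega>. c * X \<omega>) = distr (distr M borel X) borel (\<lambda>x. c * x)"
    by (subst distr_distr[OF _ X(1)]) (auto simp: comp_def)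
  then show ?thesis using X by (simp add: has_law_def scale_law_def)
qed

lemma AE_has_law_normal_0:
  assumes "has_law M X (normal_law 0)"
  shows "AE \<omega> in M. X \<omega> = 0"
proof -
  have "AE z in distr std_normal_distribution borel (\<lambda>z::real. 0 :: real). z = 0"
    by (simp add: AE_distr_iff)
  then have "AE z in distr M borel X. z = 0"
    using assms by (simp only: has_law_def normal_law_def real_sqrt_zero mult_zero_left)
  then show ?thesis using assms by (auto simp: has_law_def dest: AE_distrD[rotated])
qed

section \<open>Signal off \<Gamma>, padded support and noise residual\<close>

definition off_coords :: "nat set \<Rightarrow> nat \<Rightarrow> (nat \<Rightarrow> real) \<Rightarrow> nat \<Rightarrow> real" where
  "off_coords \<Gamma> N s j = (if j < N \<and> j \<notin> \<Gamma> then s j else 0)"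

definition off_supp :: "nat set \<Rightarrow> nat \<Rightarrow> (nat \<Rightarrow> real) \<Rightarrow> nat set" where
  "off_supp \<Gamma> N s = {j \<in> {..<N}. j \<notin> \<Gamma> \<and> s j \<noteq> 0}"

text \<open>\<open>off_supp\<close> topped up to \<open>k\<close> elements by indices of auxiliary columns.\<close>

definition padded_supp :: "nat set \<Rightarrow> nat \<Rightarrow> nat \<Rightarrow> (nat \<Rightarrow> real) \<Rightarrow> nat set" where
  "padded_supp \<Gamma> k N s = off_supp \<Gamma> N s \<union> {N..<N + k - card (off_supp \<Gamma> N s)}"

text \<open>Column N + k of \<open>noise_cols\<close> holds the rescaled noise or, for \<sigma> = 0,
  its auxiliary substitute.\<close>

definition resid :: "nat set \<Rightarrow> nat \<Rightarrow> nat \<Rightarrow> nat \<Rightarrow> (nat \<times> nat \<Rightarrow> real) \<Rightarrow> nat \<Rightarrow> real" where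
  "resid \<Gamma> k n N \<alpha> = lsres n k (select_cols n k (pick \<Gamma>) \<alpha>) (\<lambda>i. \<alpha> (i, N + k))"

text \<open>This becomes k times the T of the last claim: dividing by the squared residual norm
  makes each inner product standard normal.\<close>

definition padded_corr :: "nat set \<Rightarrow> nat \<Rightarrow> nat \<Rightarrow> nat \<Rightarrow> (nat \<Rightarrow> real) \<Rightarrow> (nat \<times> nat \<Rightarrow> real) \<Rightarrow> real" where
  "padded_corr \<Gamma> k n N s \<alpha> = (\<Sum>j\<in>padded_supp \<Gamma> k N s. (\<Sum>i<n. \<alpha> (i, j) * resid \<Gamma> k n N \<alpha> i)\<^sup>2) / (\<Sum>i<n. (resid \<Gamma> k n N \<alpha> i)\<^sup>2)"

context
  fixes \<Gamma> :: "nat set" and k n N :: nat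
  assumes k: "0 < k" "k < n" and \<Gamma>: "\<Gamma> \<subseteq> {..<N}" "card \<Gamma> = k"
begin

lemma pick_\<Gamma>:
  "inj_on (pick \<Gamma>) {..<k}" "pick \<Gamma> ` {..<k} = \<Gamma>" "pick \<Gamma> ` {..<k} \<subseteq> {..<N + k + 1}"
  "a < k \<Longrightarrow> pick \<Gamma> a < N" "a < k \<Longrightarrow> pick \<Gamma> a \<in> \<Gamma>"
proof -
  have "finite \<Gamma>" using \<Gamma>(1) finite_subset by blast
  from bij_betw_pick[OF this] show *: "inj_on (pick \<Gamma>) {..<k}" "pick \<Gamma> ` {..<k} = \<Gamma>"
    by (auto simp: bij_betw_def \<Gamma>(2))
  then show "pick \<Gamma> ` {..<k} \<subseteq> {..<N + k + 1}" "a < k \<Longrightarrow> pick \<Gamma> a < N" "a < k \<Longrightarrow> pick \<Gamma> a \<in> \<Gamma>"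
    using \<Gamma>(1) by auto
qed

lemma off_supp: "finite (off_supp \<Gamma> N s)" "off_supp \<Gamma> N s \<subseteq> {..<N}" "off_supp \<Gamma> N s \<inter> \<Gamma> = {}"
  by (auto simp: off_supp_def)

lemma sum_off_coords: "(\<Sum>j<N + k + 1. f j * off_coords \<Gamma> N s j) = (\<Sum>j\<in>off_supp \<Gamma> N s. f j * s j)"
  by (rule sum.mono_neutral_cong_right) (auto simp: off_coords_def off_supp_def)

lemma sum_off_coords_sq: "(\<Sum>j<N + k + 1. (off_coords \<Gamma> N s j)\<^sup>2) = (\<Sum>j\<in>off_supp \<Gamma> N s. (s j)\<^sup>2)"
  by (rule sum.mono_neutral_cong_right) (auto simp: off_coords_def off_supp_def)

lemma measurable_padded_corr:
  "(\<lambda>(s, \<alpha>). padded_corr \<Gamma> k n N s \<alpha>) \<in> borel_measurable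
    (Pi\<^sub>M {..<N} (\<lambda>_. borel) \<Otimes>\<^sub>M gauss ({..<n} \<times> {..<N + k + 1}))"
proof -
  let ?S = "Pi\<^sub>M {..<N} (\<lambda>_. borel :: real measure)" and ?G = "gauss ({..<n} \<times> {..<N + k + 1})"
  have a: "(\<lambda>\<alpha>. \<alpha> (i, j)) \<in> borel_measurable ?G" if "i < n" "j < N + k + 1" for i j
    using that by (intro gauss_component) auto
  have r: "(\<lambda>\<alpha>. resid \<Gamma> k n N \<alpha> i) \<in> borel_measurable ?G" if "i < n" for i
    unfolding resid_def select_cols_def
    by (rule borel_measurable_lsres) (use that pick_\<Gamma>(4) in \<open>auto intro!: a simp: less_Suc_eq trans_less_add1\<close>)
  have off: "{s \<in> space ?S. j \<in> off_supp \<Gamma> N s} \<in> sets ?S" for j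
  proof (cases "j < N")
    case True
    then have [measurable]: "(\<lambda>s. s j) \<in> borel_measurable ?S"
      by (intro measurable_component_singleton) simp
    show ?thesis using True by (simp add: off_supp_def) measurable
  qed (simp add: off_supp_def)
  have card: "(\<lambda>s. card (off_supp \<Gamma> N s)) \<in> measurable ?S (count_space UNIV)"
    by (rule measurable_card) (rule off)
  have pad: "{s \<in> space ?S. j \<in> padded_supp \<Gamma> k N s} \<in> sets ?S" for j
  proof -
    have [measurable]: "Measurable.pred ?S (\<lambda>s. j \<in> off_supp \<Gamma> N s)" "(\<lambda>s. card (off_supp \<Gamma> N s)) \<in> measurable ?S (count_space UNIV)"
      using off[of j] card by (auto simp: pred_def)
    show ?thesis unfolding padded_supp_def Un_iff atLeastLessThan_iff by measurable
  qed
  \<comment> \<open>The summation set depends on s; indicators turn the sum into one over a fixed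
    range.\<close>
  have "padded_corr \<Gamma> k n N s \<alpha> = (\<Sum>j<N + k + 1. indicator {s \<in> space ?S. j \<in> padded_supp \<Gamma> k N s} s * (\<Sum>i<n. \<alpha> (i, j) * resid \<Gamma> k n N \<alpha> i)\<^sup>2) /
      (\<Sum>i<n. (resid \<Gamma> k n N \<alpha> i)\<^sup>2)" if "s \<in> space ?S" for s \<alpha>
  proof -
    have "padded_supp \<Gamma> k N s \<subseteq> {..<N + k + 1}" by (auto simp: padded_supp_def dest!: subsetD[OF off_supp(2)])
    then have "(\<Sum>j\<in>padded_supp \<Gamma> k N s. (\<Sum>i<n. \<alpha> (i, j) * resid \<Gamma> k n N \<alpha> i)\<^sup>2) =
        (\<Sum>j<N + k + 1. indicator {s \<in> space ?S. j \<in> padded_supp \<Gamma> k N s} s * (\<Sum>i<n. \<alpha> (i, j) * resid \<Gamma> k n N \<alpha> i)\<^sup>2)"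
      using that by (intro sum.mono_neutral_cong_left) (auto simp: indicator_def)
    then show ?thesis by (simp add: padded_corr_def)
  qed
  moreover have "(\<lambda>q. (\<Sum>j<N + k + 1. indicator {s \<in> space ?S. j \<in> padded_supp \<Gamma> k N s} (fst q) *
      (\<Sum>i<n. snd q (i, j) * resid \<Gamma> k n N (snd q) i)\<^sup>2) / (\<Sum>i<n. (resid \<Gamma> k n N (snd q) i)\<^sup>2)) \<in> borel_measurable (?S \<Otimes>\<^sub>M ?G)"
    by (intro borel_measurable_divide borel_measurable_sum borel_measurable_times borel_measurable_power
        measurable_compose[OF measurable_fst borel_measurable_indicator] pad
        measurable_compose[OF measurable_snd a] measurable_compose[OF measurable_snd r]) auto
  ultimately show ?thesis
    by (subst measurable_cong[where g = "\<lambda>q. (\<Sum>j<N + k + 1. indicator {s \<in> space ?S. j \<in> padded_supp \<Gamma> k N s} (fst q) *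
      (\<Sum>i<n. snd q (i, j) * resid \<Gamma> k n N (snd q) i)\<^sup>2) / (\<Sum>i<n. (resid \<Gamma> k n N (snd q) i)\<^sup>2)"])
      (auto simp: space_pair_measure)
qed

text \<open>Padding brings the index set to exactly k columns for each admissible s, so the degrees
  of freedom do not vary with the support.\<close>

lemma chi_squared_padded_corr:
  assumes "card (off_supp \<Gamma> N s) \<le> k"
  shows "distr (gauss ({..<n} \<times> {..<N + k + 1})) borel (padded_corr \<Gamma> k n N s) = chi_squared k"
proof -
  have "card (padded_supp \<Gamma> k N s) = card (off_supp \<Gamma> N s) + card {N..<N + k - card (off_supp \<Gamma> N s)}"
    unfolding padded_supp_def using off_supp[of s] by (intro card_Un_disjoint) auto
  then have c: "card (padded_supp \<Gamma> k N s) = k" using assms by simp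
  have "distr (gauss ({..<n} \<times> {..<N + k + 1})) borel (padded_corr \<Gamma> k n N s) = chi_squared (card (padded_supp \<Gamma> k N s))"
    unfolding padded_corr_def[abs_def] resid_def
  proof (rule chi_squared_cols_lsres)
    show "padded_supp \<Gamma> k N s \<subseteq> {..<N + k + 1}" "padded_supp \<Gamma> k N s \<inter> pick \<Gamma> ` {..<k} = {}" "N + k \<notin> padded_supp \<Gamma> k N s"
      "N + k \<notin> pick \<Gamma> ` {..<k}"
      using off_supp[of s] \<Gamma>(1) k by (auto simp: padded_supp_def pick_\<Gamma>(2))
  qed (use pick_\<Gamma>(1,3) k in auto)
  then show ?thesis unfolding c .
qed

lemma select_cols_\<Gamma>: "i < n \<Longrightarrow> a < k \<Longrightarrow> select_cols n k (pick \<Gamma>) \<alpha> (i, a) = \<alpha> (i, pick \<Gamma> a)"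
  by (simp add: select_cols_def)

text \<open>\<open>B\<close>, \<open>v\<close> and \<open>u\<close> are realizations of matrix, signal and noise, and \<open>\<alpha>\<close> is one of \<open>noise_cols\<close>.\<close>

context
  fixes B :: "real Matrix.mat" and v u :: "real Matrix.vec" and \<alpha> :: "nat \<times> nat \<Rightarrow> real" and \<sigma> :: real and s :: "nat \<Rightarrow> real"
  assumes B: "B \<in> carrier_mat n N" and v: "v \<in> carrier_vec N" and u: "u \<in> carrier_vec n"
    and \<sigma>: "\<sigma> \<ge> 0"
    and \<alpha>: "\<And>i j. i < n \<Longrightarrow> j < N \<Longrightarrow> \<alpha> (i, j) = sqrt n * B $$ (i, j)"
    and s: "\<And>j. j < N \<Longrightarrow> s j = v $ j"
    and det: "Determinant.det (gram n k (select_cols n k (pick \<Gamma>) \<alpha>)) \<noteq> 0"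
begin

private abbreviation (input) "W \<equiv> select_cols n k (pick \<Gamma>) \<alpha>"
private abbreviation (input) "g \<equiv> unit_comb n (N + k + 1) (off_coords \<Gamma> N s) \<alpha>"
private abbreviation (input) "\<Delta> \<equiv> vsupp v - \<Gamma>"
private abbreviation (input) "len \<equiv> sqrt (\<Sum>j\<in>off_supp \<Gamma> N s. (s j)\<^sup>2)"

lemma vsupp_diff_eq_off_supp: "\<Delta> = off_supp \<Gamma> N s" "\<Delta> \<subseteq> {..<N}"
  using v s by (auto simp: vsupp_def off_supp_def)

lemma B_entry: "i < n \<Longrightarrow> j < N \<Longrightarrow> B $$ (i, j) = \<alpha> (i, j) / sqrt n"
  using \<alpha> k by simp

lemma restrict_cols_\<Gamma>: "restrict_cols B \<Gamma> = mat n k (\<lambda>q. 1 / sqrt n * W q)"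
  unfolding restrict_cols_eq[OF B \<Gamma>(1)] \<Gamma>(2)
  by (rule eq_matI) (auto simp: select_cols_\<Gamma> B_entry pick_\<Gamma>(4))

lemma inverse_sqrt_neq_0: "1 / sqrt (real n) \<noteq> 0" using k by simp

lemma vnorm_signal: "vnorm (subvec v \<Delta>) = len"
  unfolding vnorm_subvec[OF B vsupp_diff_eq_off_supp(2) v] unfolding vsupp_diff_eq_off_supp(1)
  using off_supp[of s] by (intro arg_cong[where f = sqrt] sum.cong refl) (auto simp: s subset_iff)

lemma restrict_cols_mult_signal:
  assumes "len \<noteq> 0"
  shows "restrict_cols B \<Delta> *\<^sub>v subvec v \<Delta> = Matrix.vec n (\<lambda>i. len / sqrt n * g i)"
proof -
  have "(\<Sum>j\<in>\<Delta>. B $$ (i, j) * v $ j) = len / sqrt n * g i" if "i < n" for i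
  proof -
    have "(\<Sum>j\<in>\<Delta>. B $$ (i, j) * v $ j) = (\<Sum>j\<in>off_supp \<Gamma> N s. \<alpha> (i, j) * s j) / sqrt n"
      unfolding vsupp_diff_eq_off_supp(1) sum_divide_distrib
      using off_supp[of s] that by (intro sum.cong refl) (auto simp: B_entry s subset_iff)
    then show ?thesis
      using assms that unfolding unit_comb_def sum_off_coords sum_off_coords_sq by simp
  qed
  then show ?thesis unfolding restrict_cols_mult_subvec[OF B vsupp_diff_eq_off_supp(2) v] by auto
qed

text \<open>The 1 / sqrt n in the image of the signal cancels against the sqrt n from the
  pseudoinverse of the rescaled matrix, and the length of the signal cancels in the ratio.\<close>

lemma coefficient_ratio:
  assumes "len \<noteq> 0"
  shows "vnorm (pinv (restrict_cols B \<Gamma>) *\<^sub>v (restrict_cols B \<Delta> *\<^sub>v subvec v \<Delta>)) / vnorm (subvec v \<Delta>) =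
    sqrt (\<Sum>a<k. (lscoef n k W g a)\<^sup>2)"
proof -
  have "pinv (restrict_cols B \<Gamma>) *\<^sub>v (restrict_cols B \<Delta> *\<^sub>v subvec v \<Delta>) =
      Matrix.vec k (\<lambda>a. len * lscoef n k W g a)"
    unfolding restrict_cols_\<Gamma> restrict_cols_mult_signal[OF assms] pinv_mult_vec[OF det inverse_sqrt_neq_0] lscoef_scale
    using k by simp
  then show ?thesis
    using assms by (simp add: vnorm_vec vnorm_signal power_mult_distrib real_sqrt_mult sum_nonneg flip: sum_distrib_left)
qed

text \<open>Cauchy-Schwarz against the signal itself: if h is the transposed matrix applied to the
  residual of the image of the signal, then h . x is the squared norm of that residual, so |h| is at
  least this number divided by |x|.\<close>

lemma residual_ratio:
  assumes "len \<noteq> 0"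
  shows "vnorm (transpose_mat (restrict_cols B \<Delta>) *\<^sub>v ((1\<^sub>m n - restrict_cols B \<Gamma> * pinv (restrict_cols B \<Gamma>)) *\<^sub>v
      (restrict_cols B \<Delta> *\<^sub>v subvec v \<Delta>))) / vnorm (subvec v \<Delta>) \<ge> (\<Sum>i<n. (lsres n k W g i)\<^sup>2) / n"
proof -
  define r where "r = lsres n k W g"
  define h where "h j = (\<Sum>i<n. B $$ (i, j) * (len / sqrt n * r i))" for j
  have len0: "len > 0" using assms sum_nonneg[of "off_supp \<Gamma> N s" "\<lambda>j. (s j)\<^sup>2"] by (simp add: less_le)
  have scale: "(\<Sum>i<n. l / sqrt n * r i * (l / sqrt n * f i)) = l\<^sup>2 / n * (\<Sum>i<n. r i * f i)" for l and f :: "nat \<Rightarrow> real"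
    unfolding sum_distrib_left using k by (intro sum.cong refl) (simp add: power2_eq_square field_simps)
  have "(\<Sum>j\<in>off_supp \<Gamma> N s. h j * s j) = (\<Sum>i<n. len / sqrt n * r i * ((\<Sum>j\<in>off_supp \<Gamma> N s. \<alpha> (i, j) * s j) / sqrt n))"
  proof -
    have scale: "(\<Sum>i<n. l / sqrt n * r i * (l / sqrt n * f i)) = l\<^sup>2 / n * (\<Sum>i<n. r i * f i)" for l and f :: "nat \<Rightarrow> real"
    unfolding sum_distrib_left using k by (intro sum.cong refl) (simp add: power2_eq_square field_simps)
  have "(\<Sum>j\<in>off_supp \<Gamma> N s. h j * s j) = (\<Sum>i<n. len / sqrt n * r i * (\<Sum>j\<in>off_supp \<Gamma> N s. B $$ (i, j) * s j))"
      unfolding h_def sum_distrib_left sum_distrib_right by (subst sum.swap) (simp add: mult_ac)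
    also have "\<dots> = (\<Sum>i<n. len / sqrt n * r i * (\<Sum>j\<in>off_supp \<Gamma> N s. \<alpha> (i, j) / sqrt n * s j))"
      using off_supp[of s] by (intro sum.cong refl arg_cong2[where f = "(*)"]) (auto simp: B_entry subset_iff)
    finally show ?thesis by (simp add: sum_divide_distrib)
  qed
  also have "\<dots> = (\<Sum>i<n. len / sqrt n * r i * (len / sqrt n * g i))"
    using len0 unfolding unit_comb_def sum_off_coords sum_off_coords_sq by simp
  also have "\<dots> = len\<^sup>2 / n * (\<Sum>i<n. r i * g i)"
    by (rule scale)
  also have "(\<Sum>i<n. r i * g i) = (\<Sum>i<n. (r i)\<^sup>2)"
    unfolding r_def by (rule sum_lsres_mult[OF det])
  finally have "len\<^sup>2 / n * (\<Sum>i<n. (r i)\<^sup>2) = (\<Sum>j\<in>off_supp \<Gamma> N s. h j * s j)" by simp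
  also have "\<dots> \<le> L2_set h (off_supp \<Gamma> N s) * L2_set s (off_supp \<Gamma> N s)"
    by (rule order_trans[OF sum_mono L2_set_mult_ineq]) (simp add: abs_mult[symmetric])
  finally have "len\<^sup>2 / n * (\<Sum>i<n. (r i)\<^sup>2) \<le> sqrt (\<Sum>j\<in>off_supp \<Gamma> N s. (h j)\<^sup>2) * len" by (simp add: L2_set_def)
  \<comment> \<open>Of the two factors \<open>len\<close> on the left, one is cancelled and the
    other becomes the denominator.\<close>
  then have "len * ((\<Sum>i<n. (r i)\<^sup>2) / n * len) \<le> len * sqrt (\<Sum>j\<in>off_supp \<Gamma> N s. (h j)\<^sup>2)"
    by (simp only: power2_eq_square mult_ac times_divide_eq_right times_divide_eq_left)
  then have "(\<Sum>i<n. (r i)\<^sup>2) / n \<le> sqrt (\<Sum>j\<in>off_supp \<Gamma> N s. (h j)\<^sup>2) / len"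
    unfolding mult_le_cancel_left_pos[OF len0] pos_le_divide_eq[OF len0] .
  moreover have "lsres n k W (\<lambda>i. len / sqrt n * g i) i = len / sqrt n * r i" for i
    unfolding r_def by (rule lsres_scale)
  ultimately show ?thesis
    unfolding restrict_cols_\<Gamma> restrict_cols_mult_signal[OF assms] residual_mult_vec[OF det inverse_sqrt_neq_0] vnorm_restrict_cols_transpose[OF B vsupp_diff_eq_off_supp(2)]
      vnorm_signal r_def[symmetric]
    unfolding vsupp_diff_eq_off_supp(1) by (simp add: h_def)
qed

context
  assumes u_eq: "\<And>i. i < n \<Longrightarrow> u $ i = \<sigma> / sqrt n * \<alpha> (i, N + k)"
begin

lemma noise_eq_vec: "u = Matrix.vec n (\<lambda>i. \<sigma> / sqrt n * \<alpha> (i, N + k))"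
  using u u_eq by (intro eq_vecI) auto

lemma noise_coefficients:
  "vnorm (pinv (restrict_cols B \<Gamma>) *\<^sub>v u) = \<sigma> * sqrt (\<Sum>a<k. (lscoef n k W (\<lambda>i. \<alpha> (i, N + k)) a)\<^sup>2)"
proof -
  have "pinv (restrict_cols B \<Gamma>) *\<^sub>v u = Matrix.vec k (\<lambda>a. \<sigma> * lscoef n k W (\<lambda>i. \<alpha> (i, N + k)) a)"
    unfolding restrict_cols_\<Gamma> noise_eq_vec pinv_mult_vec[OF det inverse_sqrt_neq_0] lscoef_scale using k by simp
  then show ?thesis
    using \<sigma> by (simp add: vnorm_vec power_mult_distrib real_sqrt_mult sum_nonneg flip: sum_distrib_left)
qed

text \<open>Padding only adds squares to the norm on the left; taking out the squared length of the
  residual then splits the bound into two factors.\<close>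

lemma noise_residual:
  "vnorm (transpose_mat (restrict_cols B \<Delta>) *\<^sub>v ((1\<^sub>m n - restrict_cols B \<Gamma> * pinv (restrict_cols B \<Gamma>)) *\<^sub>v u)) \<le>
    \<sigma> * sqrt ((\<Sum>i<n. (resid \<Gamma> k n N \<alpha> i)\<^sup>2) * padded_corr \<Gamma> k n N s \<alpha> / (real n)\<^sup>2)"
proof -
  define r where "r = resid \<Gamma> k n N \<alpha>"
  have "lsres n k W (\<lambda>i. \<sigma> / sqrt n * \<alpha> (i, N + k)) i = \<sigma> / sqrt n * r i" for i
    unfolding r_def resid_def by (rule lsres_scale)
  then have eq: "vnorm (transpose_mat (restrict_cols B \<Delta>) *\<^sub>v ((1\<^sub>m n - restrict_cols B \<Gamma> * pinv (restrict_cols B \<Gamma>)) *\<^sub>v u)) =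
      sqrt (\<Sum>j\<in>off_supp \<Gamma> N s. (\<Sum>i<n. B $$ (i, j) * (\<sigma> / sqrt n * r i))\<^sup>2)"
    unfolding restrict_cols_\<Gamma> noise_eq_vec residual_mult_vec[OF det inverse_sqrt_neq_0] vnorm_restrict_cols_transpose[OF B vsupp_diff_eq_off_supp(2)]
    unfolding vsupp_diff_eq_off_supp(1) by simp
  have "(\<Sum>j\<in>off_supp \<Gamma> N s. (\<Sum>i<n. B $$ (i, j) * (\<sigma> / sqrt n * r i))\<^sup>2) =
      (\<Sum>j\<in>off_supp \<Gamma> N s. (\<sigma> / n)\<^sup>2 * (\<Sum>i<n. \<alpha> (i, j) * r i)\<^sup>2)"
  proof (rule sum.cong[OF refl])
    fix j assume "j \<in> off_supp \<Gamma> N s"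
    then have "j < N" using off_supp[of s] by auto
    then have "(\<Sum>i<n. B $$ (i, j) * (\<sigma> / sqrt n * r i)) = \<sigma> / n * (\<Sum>i<n. \<alpha> (i, j) * r i)"
      unfolding sum_distrib_left by (intro sum.cong refl) (simp add: B_entry field_simps)
    then show "(\<Sum>i<n. B $$ (i, j) * (\<sigma> / sqrt n * r i))\<^sup>2 = (\<sigma> / n)\<^sup>2 * (\<Sum>i<n. \<alpha> (i, j) * r i)\<^sup>2"
      by (simp only: power_mult_distrib)
  qed
  also have "\<dots> \<le> (\<sigma> / n)\<^sup>2 * (\<Sum>j\<in>padded_supp \<Gamma> k N s. (\<Sum>i<n. \<alpha> (i, j) * r i)\<^sup>2)"
    unfolding sum_distrib_left[symmetric] using off_supp(1)[of s]
    by (intro mult_left_mono sum_mono2) (auto simp: padded_supp_def)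
  also have "(\<Sum>j\<in>padded_supp \<Gamma> k N s. (\<Sum>i<n. \<alpha> (i, j) * r i)\<^sup>2) = (\<Sum>i<n. (r i)\<^sup>2) * padded_corr \<Gamma> k n N s \<alpha>"
  proof (cases "(\<Sum>i<n. (r i)\<^sup>2) = 0")
    \<comment> \<open>A vanishing residual makes the quotient in \<open>padded_corr\<close> equal to
      0 / 0 = 0, and the left side is 0 as well.\<close>
    case True
    then have "\<forall>i\<in>{..<n}. r i = 0" by (subst (asm) sum_nonneg_eq_0_iff) auto
    then show ?thesis using True by simp
  qed (simp add: padded_corr_def r_def)
  finally have "sqrt (\<Sum>j\<in>off_supp \<Gamma> N s. (\<Sum>i<n. B $$ (i, j) * (\<sigma> / sqrt n * r i))\<^sup>2) \<le>
      sqrt (\<sigma>\<^sup>2 * ((\<Sum>i<n. (r i)\<^sup>2) * padded_corr \<Gamma> k n N s \<alpha> / (real n)\<^sup>2))"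
    by (simp add: power_divide)
  also have "\<dots> = \<sigma> * sqrt ((\<Sum>i<n. (r i)\<^sup>2) * padded_corr \<Gamma> k n N s \<alpha> / (real n)\<^sup>2)"
    using \<sigma> by (simp only: real_sqrt_mult real_sqrt_abs abs_of_nonneg)
  finally show ?thesis unfolding eq r_def .
qed

end

end

end

theorem lemma4p4:
  fixes M :: "'w measure"
    and A :: "'w \<Rightarrow> real Matrix.mat"
    and x e :: "'w \<Rightarrow> real Matrix.vec"
    and \<Lambda> :: "'w \<Rightarrow> nat set"
    and \<Gamma> :: "nat set"
    and k n N :: nat
    and \<sigma> :: real
  assumes "prob_space M"
    and "0 < 2 * k" and "2 * k \<le> n" and "n \<le> N" and "k < n"
    and "\<sigma> \<ge> 0"
    and "A \<in> M \<rightarrow>\<^sub>M mat_borel n N"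
    and "prob_space.indep_vars M (\<lambda>_. borel) (\<lambda>p \<omega>. A \<omega> $$ p) ({..<n} \<times> {..<N})"
    and "\<And>p. p \<in> {..<n} \<times> {..<N} \<Longrightarrow> has_law M (\<lambda>\<omega>. A \<omega> $$ p) (normal_law (1 / real n))"
    and "x \<in> M \<rightarrow>\<^sub>M vec_borel N"
    and "AE \<omega> in M. vsupp (x \<omega>) = \<Lambda> \<omega> \<and> card (\<Lambda> \<omega>) = k"
    and "indep_rv M (mat_borel n N) A (vec_borel N) x"
    and "e \<in> M \<rightarrow>\<^sub>M vec_borel n"
    and "prob_space.indep_vars M (\<lambda>_. borel) (\<lambda>i \<omega>. vec_index (e \<omega>) i) {..<n}"
    and "\<And>i. i < n \<Longrightarrow> has_law M (\<lambda>\<omega>. vec_index (e \<omega>) i) (normal_law (\<sigma>\<^sup>2 / real n))"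
    and "indep_rv M (vec_borel n) e (mat_borel n N \<Otimes>\<^sub>M vec_borel N) (\<lambda>\<omega>. (A \<omega>, x \<omega>))"
    and "\<Gamma> \<subseteq> {..<N}" and "card \<Gamma> = k" and "AE \<omega> in M. \<Gamma> \<noteq> \<Lambda> \<omega>"
  shows
    "(\<exists>(M' :: ('w \<times> (nat \<Rightarrow> real)) measure) \<pi> F. enlargement M M' \<pi> \<and>
        has_law M' F (scale_law (real k / real (n - k + 1)) (F_law k (n - k + 1))) \<and>
        (AE \<omega>' in M'. let \<omega> = \<pi> \<omega>'; A\<^sub>\<Gamma> = restrict_cols (A \<omega>) \<Gamma>; A\<^sub>\<Delta> = restrict_cols (A \<omega>) (\<Lambda> \<omega> - \<Gamma>);
             x\<^sub>\<Delta> = subvec (x \<omega>) (\<Lambda> \<omega> - \<Gamma>)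
           in vnorm (pinv A\<^sub>\<Gamma> *\<^sub>v (A\<^sub>\<Delta> *\<^sub>v x\<^sub>\<Delta>)) / vnorm x\<^sub>\<Delta> = sqrt (F \<omega>')))
   \<and> (\<exists>(M' :: ('w \<times> (nat \<Rightarrow> real)) measure) \<pi> R. enlargement M M' \<pi> \<and>
        has_law M' R (scale_law (1 / real (n - k)) (chi_squared (n - k))) \<and>
        (AE \<omega>' in M'. let \<omega> = \<pi> \<omega>'; A\<^sub>\<Gamma> = restrict_cols (A \<omega>) \<Gamma>; A\<^sub>\<Delta> = restrict_cols (A \<omega>) (\<Lambda> \<omega> - \<Gamma>);
             x\<^sub>\<Delta> = subvec (x \<omega>) (\<Lambda> \<omega> - \<Gamma>)
           in vnorm (transpose_mat A\<^sub>\<Delta> *\<^sub>v ((1\<^sub>m n - A\<^sub>\<Gamma> * pinv A\<^sub>\<Gamma>) *\<^sub>v (A\<^sub>\<Delta> *\<^sub>v x\<^sub>\<Delta>))) / vnorm x\<^sub>\<Delta>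
               \<ge> real (n - k) / real n * R \<omega>'))
   \<and> (\<exists>(M' :: ('w \<times> (nat \<Rightarrow> real)) measure) \<pi> G. enlargement M M' \<pi> \<and>
        has_law M' G (scale_law (real k / real (n - k + 1)) (F_law k (n - k + 1))) \<and>
        (AE \<omega>' in M'. let \<omega> = \<pi> \<omega>'; A\<^sub>\<Gamma> = restrict_cols (A \<omega>) \<Gamma>
           in vnorm (pinv A\<^sub>\<Gamma> *\<^sub>v e \<omega>) \<le> \<sigma> * sqrt (G \<omega>')))
   \<and> (\<exists>(M' :: ('w \<times> (nat \<Rightarrow> real)) measure) \<pi> S T. enlargement M M' \<pi> \<and>
        has_law M' S (scale_law (1 / real (n - k)) (chi_squared (n - k))) \<and>
        has_law M' T (scale_law (1 / real k) (chi_squared k)) \<and>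
        (AE \<omega>' in M'. let \<omega> = \<pi> \<omega>'; A\<^sub>\<Gamma> = restrict_cols (A \<omega>) \<Gamma>; A\<^sub>\<Delta> = restrict_cols (A \<omega>) (\<Lambda> \<omega> - \<Gamma>)
           in vnorm (transpose_mat A\<^sub>\<Delta> *\<^sub>v ((1\<^sub>m n - A\<^sub>\<Gamma> * pinv A\<^sub>\<Gamma>) *\<^sub>v e \<omega>))
               \<le> \<sigma> * sqrt (real k * real (n - k) / (real n)\<^sup>2 * (S \<omega>' * T \<omega>'))))"
proof -
  note M = assms(1) and A = assms(7) and x = assms(10) and e = assms(13)
  interpret M: prob_space M by (rule M)
  have k: "0 < k" "k < n" using assms by auto
  have n: "0 < n" and kn: "k \<le> n" using k by simp_all
  note \<Gamma> = assms(17,18)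
  let ?L = "N + k + 1"

  \<comment> \<open>Transfer to the product of the signal law and a Gaussian matrix\<close>
  define S where "S = Pi\<^sub>M {..<N} (\<lambda>_. borel :: real measure)"
  define \<G> where "\<G> = gauss ({..<n} \<times> {..<?L})"
  \<comment> \<open>The same enlargement serves all four claims.\<close>
  define \<E> where "\<E> = enlarged M"
  define s where "s \<omega> = coords x N (fst \<omega>)" for \<omega> :: "'w \<times> (nat \<Rightarrow> real)"
  define \<alpha> where "\<alpha> = noise_cols A e k n N \<sigma>"
  define \<mu> where "\<mu> = distr M S (coords x N)"
  note asm = M n assms(6-10,12-16)
  note defs = off_supp_def off_coords_def coords_def noise_cols_def
  have enl: "enlargement M \<E> fst"
    unfolding \<E>_def by (rule enlargement_enlarged[OF asm])
  have sm: "coords x N \<in> M \<rightarrow>\<^sub>M S"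
    unfolding S_def by (rule measurable_coords[OF asm])
  have jm: "(\<lambda>\<omega>. (s \<omega>, \<alpha> \<omega>)) \<in> \<E> \<rightarrow>\<^sub>M S \<Otimes>\<^sub>M \<G>"
    unfolding s_def \<alpha>_def \<E>_def S_def \<G>_def by (rule measurable_coords_noise_cols[OF asm])
  have jlaw: "distr \<E> (S \<Otimes>\<^sub>M \<G>) (\<lambda>\<omega>. (s \<omega>, \<alpha> \<omega>)) = \<mu> \<Otimes>\<^sub>M \<G>"
    unfolding s_def \<alpha>_def \<E>_def \<mu>_def S_def \<G>_def by (rule distr_coords_noise_cols[OF asm])
  have \<mu>: "prob_space \<mu>" unfolding \<mu>_def by (rule M.prob_space_distr[OF sm])
  have sets\<mu>: "sets (\<mu> \<Otimes>\<^sub>M \<G>) = sets (S \<Otimes>\<^sub>M \<G>)"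
    by (intro sets_pair_measure_cong) (auto simp: \<mu>_def)
  \<comment> \<open>Functions of signal and matrix can be studied on the product
    \<open>\<mu> \<Otimes>\<^sub>M \<G>\<close> instead of the enlarged space.\<close>
  have law: "has_law \<E> (\<lambda>\<omega>. f (s \<omega>, \<alpha> \<omega>)) D"
    if "f \<in> borel_measurable (\<mu> \<Otimes>\<^sub>M \<G>)" "distr (\<mu> \<Otimes>\<^sub>M \<G>) borel f = D" for f D
  proof -
    have f: "f \<in> borel_measurable (S \<Otimes>\<^sub>M \<G>)"
      using that(1) by (simp add: measurable_cong_sets[OF sets\<mu> refl])
    have "distr \<E> borel (\<lambda>\<omega>. f (s \<omega>, \<alpha> \<omega>)) = distr (\<mu> \<Otimes>\<^sub>M \<G>) borel f"
      unfolding jlaw[symmetric] by (subst distr_distr[OF f jm]) (simp add: comp_def)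
    then show ?thesis using that(2) measurable_compose[OF jm f] by (simp add: has_law_def)
  qed
  have AE_j: "AE \<omega> in \<E>. P (s \<omega>, \<alpha> \<omega>)" if "AE q in \<mu> \<Otimes>\<^sub>M \<G>. P q" for P
    using that unfolding jlaw[symmetric] by (rule AE_distrD[OF jm])
  have AE_M: "AE \<omega> in \<E>. P (fst \<omega>)" if "AE \<omega> in M. P \<omega>" for P
  proof -
    have f: "fst \<in> \<E> \<rightarrow>\<^sub>M M" "distr \<E> M fst = M" using enl by (simp_all add: enlargement_def)
    have "AE \<omega> in distr \<E> M fst. P \<omega>" unfolding f(2) by (rule that)
    from AE_distrD[OF f(1) this] show ?thesis .
  qed
  have carr: "A \<omega> \<in> carrier_mat n N" "x \<omega> \<in> carrier_vec N" "e \<omega> \<in> carrier_vec n" if "\<omega> \<in> space M" for \<omega>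
    using measurable_space[OF A that] measurable_space[OF x that] measurable_space[OF e that]
    by (simp_all add: mat_borel_def vec_borel_def)
  have off: "off_supp \<Gamma> N (coords x N \<omega>) = vsupp (x \<omega>) - \<Gamma>" if "\<omega> \<in> space M" for \<omega>
  proof -
    have cx: "coords x N \<omega> j = x \<omega> $ j" if "j < N" for j
      unfolding defs(3) using that by simp
    have d: "dim_vec (x \<omega>) = N" using carr(2)[OF that] by (rule carrier_vecD)
    have "j \<in> off_supp \<Gamma> N (coords x N \<omega>) \<longleftrightarrow> j \<in> vsupp (x \<omega>) - \<Gamma>" for j
      using cx[of j] by (cases "j < N") (auto simp: defs(1) vsupp_def d)
    then show ?thesis by blast
  qed
  have fin\<Gamma>: "finite \<Gamma>" using \<Gamma>(1) finite_subset by blast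
  have AE_off: "AE \<omega> in M. (\<Sum>j\<in>off_supp \<Gamma> N (coords x N \<omega>). (coords x N \<omega> j)\<^sup>2) \<noteq> 0 \<and>
      card (off_supp \<Gamma> N (coords x N \<omega>)) \<le> k"
    using assms(11,19) AE_space
  proof eventually_elim
    case (elim \<omega>)
    have sp: "vsupp (x \<omega>) = \<Lambda> \<omega>" "card (vsupp (x \<omega>)) = k" using elim(1) by simp_all
    have fin: "finite (vsupp (x \<omega>))" by (simp add: vsupp_def)
    \<comment> \<open>Both sets have k elements, so an inclusion would make them equal, against
      \<Gamma> \<noteq> \<Lambda>. This keeps the norms in the denominators away from 0.\<close>
    have "vsupp (x \<omega>) - \<Gamma> \<noteq> {}"
    proof
      assume "vsupp (x \<omega>) - \<Gamma> = {}"
      then have "vsupp (x \<omega>) = \<Gamma>"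
        by (intro card_subset_eq[OF fin\<Gamma>]) (simp_all only: sp(2) \<Gamma>(2) Diff_eq_empty_iff)
      then show False using elim(2) sp(1) by argo
    qed
    then obtain j where j: "j \<in> off_supp \<Gamma> N (coords x N \<omega>)" unfolding off[OF elim(3), symmetric] by blast
    have "card (vsupp (x \<omega>) - \<Gamma>) \<le> card (vsupp (x \<omega>))" using fin by (intro card_mono) auto
    moreover have "(\<Sum>j\<in>off_supp \<Gamma> N (coords x N \<omega>). (coords x N \<omega> j)\<^sup>2) \<noteq> 0"
    proof
      assume "(\<Sum>j\<in>off_supp \<Gamma> N (coords x N \<omega>). (coords x N \<omega> j)\<^sup>2) = 0"
      then have "(coords x N \<omega> j)\<^sup>2 = 0"
        using j by (subst (asm) sum_nonneg_eq_0_iff) (auto simp: defs(1))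
      then show False using j by (simp add: defs(1))
    qed
    ultimately show ?case unfolding off[OF elim(3)] sp(2) by blast
  qed
  \<comment> \<open>First choice of coefficients: the signal off \<Gamma>, extended by 0 to the
    auxiliary columns and the noise column.\<close>
  define y where "y = off_coords \<Gamma> N"
  have ym: "(\<lambda>s. y s j) \<in> borel_measurable \<mu>" for j
    unfolding y_def defs \<mu>_def S_def
    by (cases "j < N \<and> j \<notin> \<Gamma>") (auto intro!: measurable_component_singleton)
  note p = pick_\<Gamma>(1,3)[OF k \<Gamma>]
  have yp: "\<forall>a<k. y t (pick \<Gamma> a) = 0" for t
    using pick_\<Gamma>(5)[OF k \<Gamma>] by (simp add: y_def defs)
  have y0: "AE t in \<mu>. (\<Sum>j<?L. (y t j)\<^sup>2) \<noteq> 0"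
  proof -
    have "Measurable.pred \<mu> (\<lambda>t. (\<Sum>j<?L. (y t j)\<^sup>2) \<noteq> 0)"
      using ym by measurable
    then have "{t \<in> space S. (\<Sum>j<?L. (y t j)\<^sup>2) \<noteq> 0} \<in> sets S" by (simp add: pred_def \<mu>_def)
    moreover have "AE \<omega> in M. (\<Sum>j<?L. (y (coords x N \<omega>) j)\<^sup>2) \<noteq> 0"
      using AE_off unfolding y_def sum_off_coords_sq[OF k \<Gamma>] by auto
    ultimately show ?thesis unfolding \<mu>_def by (subst AE_distr_iff[OF sm]) auto
  qed
  \<comment> \<open>Second choice: the constant unit vector at column N + k. Its unit combination is
    the rescaled noise, so the results for random combinations cover signal and noise alike.\<close>
  define z where "z t j = (if j = N + k then 1 else 0 :: real)" for t :: "nat \<Rightarrow> real" and j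
  have zm: "(\<lambda>s. z s j) \<in> borel_measurable \<mu>" for j by (simp add: z_def)
  have zp: "\<forall>a<k. z t (pick \<Gamma> a) = 0" for t
    using pick_\<Gamma>(4)[OF k \<Gamma>] by (fastforce simp: z_def)
  have z1: "(\<Sum>j<?L. (z t j)\<^sup>2) = 1" for t by (simp add: z_def if_distrib[of "\<lambda>x. x\<^sup>2"] cong: if_cong)
  then have z0: "AE t in \<mu>. (\<Sum>j<?L. (z t j)\<^sup>2) \<noteq> 0" by simp
  have uz: "unit_comb n ?L (z t) a i = a (i, N + k)" if "i < n" for t a i
    using that by (simp only: unit_comb_def z1) (simp add: z_def if_distrib[of "\<lambda>x. _ * x"] cong: if_cong)
  \<comment> \<open>For \<sigma> = 0 column N + k is auxiliary, but the right side is 0 and the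
    noise vanishes almost surely, its law being a point mass.\<close>
  have AE_e: "AE \<omega> in \<E>. \<forall>i<n. e (fst \<omega>) $ i = \<sigma> / sqrt n * \<alpha> \<omega> (i, N + k)"
  proof (cases "\<sigma> = 0")
    case True
    have "AE \<omega> in M. \<forall>i\<in>{..<n}. e \<omega> $ i = 0"
      using assms(15) True by (intro AE_finite_allI) (auto intro!: AE_has_law_normal_0)
    from AE_M[OF this] show ?thesis using True by (simp add: Ball_def)
  next
    case False
    then show ?thesis using n by (simp add: \<alpha>_def defs)
  qed
  define W where "W = select_cols n k (pick \<Gamma>)"
  have AE_det: "AE \<omega> in \<E>. Determinant.det (gram n k (W (\<alpha> \<omega>))) \<noteq> 0"
  proof -
    have "AE q in \<mu> \<Otimes>\<^sub>M \<G>. Determinant.det (gram n k (W (snd q))) \<noteq> 0"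
      unfolding \<G>_def W_def by (rule AE_random_cols_det_gram[OF p \<mu> ym yp y0 kn])
    from AE_j[OF this] show ?thesis by simp
  qed
  have good: "AE \<omega> in \<E>. fst \<omega> \<in> space M \<and> Determinant.det (gram n k (W (\<alpha> \<omega>))) \<noteq> 0 \<and>
      vsupp (x (fst \<omega>)) = \<Lambda> (fst \<omega>) \<and> sqrt (\<Sum>j\<in>off_supp \<Gamma> N (s \<omega>). (s \<omega> j)\<^sup>2) \<noteq> 0 \<and>
      (\<forall>i<n. e (fst \<omega>) $ i = \<sigma> / sqrt n * \<alpha> \<omega> (i, N + k))"
    using AE_M[OF AE_space] AE_det AE_M[OF assms(11)] AE_M[OF AE_off] AE_e
    by eventually_elim (auto simp: s_def)
  have \<alpha>A: "\<alpha> \<omega> (i, j) = sqrt n * A (fst \<omega>) $$ (i, j)" if "i < n" "j < N" for \<omega> i j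
    using that by (simp add: \<alpha>_def defs)
  have sx: "s \<omega> j = x (fst \<omega>) $ j" if "j < N" for \<omega> j using that by (simp add: s_def defs)

  \<comment> \<open>Laws of the five random variables\<close>
  let ?Flaw = "scale_law (real k / real (n - k + 1)) (F_law k (n - k + 1))"
  have lscoef_law: "has_law \<E> (\<lambda>\<omega>. \<Sum>a<k. (lscoef n k (W (\<alpha> \<omega>)) (unit_comb n ?L (y (s \<omega>)) (\<alpha> \<omega>)) a)\<^sup>2) ?Flaw"
    if y: "\<And>j. (\<lambda>s. y s j) \<in> borel_measurable \<mu>" "\<And>t. \<forall>a<k. y t (pick \<Gamma> a) = 0"
      "AE t in \<mu>. (\<Sum>j<?L. (y t j)\<^sup>2) \<noteq> 0" for y
  proof -
    let ?f = "\<lambda>(t, a). \<Sum>b<k. (lscoef n k (W a) (unit_comb n ?L (y t) a) b)\<^sup>2"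
    have "?f \<in> borel_measurable (\<mu> \<Otimes>\<^sub>M \<G>)"
      unfolding W_def \<G>_def by (rule measurable_random_lscoef[OF p \<mu> y])
    moreover have "distr (\<mu> \<Otimes>\<^sub>M \<G>) borel ?f = ?Flaw"
      unfolding W_def \<G>_def by (rule F_law_random_lscoef[OF p \<mu> y k(1) kn])
    ultimately have "has_law \<E> (\<lambda>\<omega>. ?f (s \<omega>, \<alpha> \<omega>)) ?Flaw" by (rule law)
    then show ?thesis by simp
  qed
  have lsres_law: "has_law \<E> (\<lambda>\<omega>. 1 / real (n - k) *
      (\<Sum>i<n. (lsres n k (W (\<alpha> \<omega>)) (unit_comb n ?L (y (s \<omega>)) (\<alpha> \<omega>)) i)\<^sup>2))
      (scale_law (1 / real (n - k)) (chi_squared (n - k)))"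
    if y: "\<And>j. (\<lambda>s. y s j) \<in> borel_measurable \<mu>" "\<And>t. \<forall>a<k. y t (pick \<Gamma> a) = 0"
      "AE t in \<mu>. (\<Sum>j<?L. (y t j)\<^sup>2) \<noteq> 0" for y
  proof -
    let ?f = "\<lambda>(t, a). \<Sum>i<n. (lsres n k (W a) (unit_comb n ?L (y t) a) i)\<^sup>2"
    have "?f \<in> borel_measurable (\<mu> \<Otimes>\<^sub>M \<G>)"
      unfolding W_def \<G>_def by (rule measurable_random_lsres[OF p \<mu> y])
    moreover have "distr (\<mu> \<Otimes>\<^sub>M \<G>) borel ?f = chi_squared (n - k)"
      unfolding W_def \<G>_def by (rule chi_squared_random_lsres[OF p \<mu> y kn])
    ultimately have "has_law \<E> (\<lambda>\<omega>. ?f (s \<omega>, \<alpha> \<omega>)) (chi_squared (n - k))" by (rule law)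
    from has_law_scale[OF this, of "1 / real (n - k)"] show ?thesis by simp
  qed
  define F where "F \<omega> = (\<Sum>a<k. (lscoef n k (W (\<alpha> \<omega>)) (unit_comb n ?L (y (s \<omega>)) (\<alpha> \<omega>)) a)\<^sup>2)" for \<omega>
  have F: "has_law \<E> F ?Flaw"
    unfolding F_def[abs_def] by (rule lscoef_law[OF ym yp y0])
  define R where "R \<omega> = 1 / real (n - k) * (\<Sum>i<n. (lsres n k (W (\<alpha> \<omega>)) (unit_comb n ?L (y (s \<omega>)) (\<alpha> \<omega>)) i)\<^sup>2)" for \<omega>
  have R: "has_law \<E> R (scale_law (1 / real (n - k)) (chi_squared (n - k)))"
    unfolding R_def[abs_def] by (rule lsres_law[OF ym yp y0])
  define G where "G \<omega> = (\<Sum>a<k. (lscoef n k (W (\<alpha> \<omega>)) (unit_comb n ?L (z (s \<omega>)) (\<alpha> \<omega>)) a)\<^sup>2)" for \<omega>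
  have G: "has_law \<E> G ?Flaw"
    unfolding G_def[abs_def] by (rule lscoef_law[OF zm zp z0])
  \<comment> \<open>The S of the last claim; the letter \<open>S\<close> already denotes the space
    of signals.\<close>
  define H where "H \<omega> = 1 / real (n - k) * (\<Sum>i<n. (lsres n k (W (\<alpha> \<omega>)) (unit_comb n ?L (z (s \<omega>)) (\<alpha> \<omega>)) i)\<^sup>2)" for \<omega>
  have H: "has_law \<E> H (scale_law (1 / real (n - k)) (chi_squared (n - k)))"
    unfolding H_def[abs_def] by (rule lsres_law[OF zm zp z0])
  define T where "T \<omega> = 1 / real k * padded_corr \<Gamma> k n N (s \<omega>) (\<alpha> \<omega>)" for \<omega>
  have T: "has_law \<E> T (scale_law (1 / real k) (chi_squared k))"
  proof -
    have m: "(\<lambda>(t, a). padded_corr \<Gamma> k n N t a) \<in> borel_measurable (\<mu> \<Otimes>\<^sub>M \<G>)"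
      using measurable_padded_corr[OF k \<Gamma>] unfolding measurable_cong_sets[OF sets\<mu> refl] by (simp add: S_def \<G>_def)
    have "AE t in \<mu>. card (off_supp \<Gamma> N t) \<le> k"
    proof -
      have "{t \<in> space S. j \<in> off_supp \<Gamma> N t} \<in> sets S" for j
      proof (cases "j < N")
        case True
        then have [measurable]: "(\<lambda>s. s j) \<in> borel_measurable S"
          unfolding S_def by (intro measurable_component_singleton) simp
        show ?thesis using True by (simp add: defs) measurable
      qed (simp add: defs)
      then have [measurable]: "(\<lambda>t. card (off_supp \<Gamma> N t)) \<in> measurable S (count_space UNIV)"
        by (rule measurable_card)
      show ?thesis unfolding \<mu>_def by (subst AE_distr_iff[OF sm]) (use AE_off in auto)
    qed
    \<comment> \<open>Given the signal, the padded set is fixed with k elements, and the conditional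
      law is the same for almost all signals.\<close>
    then have "AE t in \<mu>. distr \<G> borel (\<lambda>a. case (t, a) of (t, a) \<Rightarrow> padded_corr \<Gamma> k n N t a) = chi_squared k"
      by eventually_elim (simp only: \<G>_def prod.case chi_squared_padded_corr[OF k \<Gamma>])
    then have "distr (\<mu> \<Otimes>\<^sub>M \<G>) borel (\<lambda>(t, a). padded_corr \<Gamma> k n N t a) = chi_squared k"
      by (intro distr_pair_kernel[OF \<mu> _ m]) (auto simp: \<G>_def prob_space_gauss)
    from has_law_scale[OF law[OF m this], of "1 / real k"] show ?thesis by (simp add: T_def[abs_def])
  qed
  have Gz: "G \<omega> = (\<Sum>a<k. (lscoef n k (W (\<alpha> \<omega>)) (\<lambda>i. \<alpha> \<omega> (i, N + k)) a)\<^sup>2)" for \<omega>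
    unfolding G_def by (intro sum.cong refl arg_cong2[where f = power] lscoef_cong) (auto simp: uz[simplified])
  have Hz: "H \<omega> = 1 / real (n - k) * (\<Sum>i<n. (resid \<Gamma> k n N (\<alpha> \<omega>) i)\<^sup>2)" for \<omega>
    unfolding H_def resid_def W_def
    by (intro sum.cong refl arg_cong2[where f = power] arg_cong2[where f = "(*)"] lsres_cong) (auto simp: uz[simplified])

  \<comment> \<open>Almost sure validity of the four relations\<close>
  have 1: "AE \<omega>' in \<E>. let \<omega> = fst \<omega>'; A\<^sub>\<Gamma> = restrict_cols (A \<omega>) \<Gamma>; A\<^sub>\<Delta> = restrict_cols (A \<omega>) (\<Lambda> \<omega> - \<Gamma>);
             x\<^sub>\<Delta> = subvec (x \<omega>) (\<Lambda> \<omega> - \<Gamma>)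
           in vnorm (pinv A\<^sub>\<Gamma> *\<^sub>v (A\<^sub>\<Delta> *\<^sub>v x\<^sub>\<Delta>)) / vnorm x\<^sub>\<Delta> = sqrt (F \<omega>')"
    using good
  proof eventually_elim
    case (elim \<omega>)
    let ?w = "fst \<omega>" and ?\<Delta> = "vsupp (x (fst \<omega>)) - \<Gamma>"
    have c: "A ?w \<in> carrier_mat n N" "x ?w \<in> carrier_vec N" "e ?w \<in> carrier_vec n" using elim carr by auto
    have "vnorm (pinv (restrict_cols (A ?w) \<Gamma>) *\<^sub>v (restrict_cols (A ?w) ?\<Delta> *\<^sub>v subvec (x ?w) ?\<Delta>)) /
        vnorm (subvec (x ?w) ?\<Delta>) = sqrt (F \<omega>)"
      unfolding F_def W_def y_def
      by (rule coefficient_ratio[OF k \<Gamma> c assms(6) \<alpha>A sx]) (use elim in \<open>simp_all add: W_def\<close>)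
    then show ?case using elim by (simp add: Let_def)
  qed
  have 2: "AE \<omega>' in \<E>. let \<omega> = fst \<omega>'; A\<^sub>\<Gamma> = restrict_cols (A \<omega>) \<Gamma>; A\<^sub>\<Delta> = restrict_cols (A \<omega>) (\<Lambda> \<omega> - \<Gamma>);
             x\<^sub>\<Delta> = subvec (x \<omega>) (\<Lambda> \<omega> - \<Gamma>)
           in vnorm (transpose_mat A\<^sub>\<Delta> *\<^sub>v ((1\<^sub>m n - A\<^sub>\<Gamma> * pinv A\<^sub>\<Gamma>) *\<^sub>v (A\<^sub>\<Delta> *\<^sub>v x\<^sub>\<Delta>))) / vnorm x\<^sub>\<Delta>
               \<ge> real (n - k) / real n * R \<omega>'"
    using good
  proof eventually_elim
    case (elim \<omega>)
    let ?w = "fst \<omega>" and ?\<Delta> = "vsupp (x (fst \<omega>)) - \<Gamma>"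
    have c: "A ?w \<in> carrier_mat n N" "x ?w \<in> carrier_vec N" "e ?w \<in> carrier_vec n" using elim carr by auto
    have "(\<Sum>i<n. (lsres n k (W (\<alpha> \<omega>)) (unit_comb n ?L (y (s \<omega>)) (\<alpha> \<omega>)) i)\<^sup>2) / n \<le>
        vnorm (transpose_mat (restrict_cols (A ?w) ?\<Delta>) *\<^sub>v
          ((1\<^sub>m n - restrict_cols (A ?w) \<Gamma> * pinv (restrict_cols (A ?w) \<Gamma>)) *\<^sub>v
            (restrict_cols (A ?w) ?\<Delta> *\<^sub>v subvec (x ?w) ?\<Delta>))) / vnorm (subvec (x ?w) ?\<Delta>)"
      unfolding W_def y_def
      by (rule residual_ratio[OF k \<Gamma> c assms(6) \<alpha>A sx]) (use elim in \<open>simp_all add: W_def\<close>)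
    \<comment> \<open>n - k cancels against the normalization of \<open>R\<close>; the remaining 1 /
      n stems from the variance of the entries of A.\<close>
    moreover have "real (n - k) / real n * R \<omega> =
        (\<Sum>i<n. (lsres n k (W (\<alpha> \<omega>)) (unit_comb n ?L (y (s \<omega>)) (\<alpha> \<omega>)) i)\<^sup>2) / n"
      using k by (simp add: R_def)
    ultimately show ?case using elim by (simp only: Let_def)
  qed
  have 3: "AE \<omega>' in \<E>. let \<omega> = fst \<omega>'; A\<^sub>\<Gamma> = restrict_cols (A \<omega>) \<Gamma>
           in vnorm (pinv A\<^sub>\<Gamma> *\<^sub>v e \<omega>) \<le> \<sigma> * sqrt (G \<omega>')"
    using good
  proof eventually_elim
    case (elim \<omega>)
    let ?w = "fst \<omega>" and ?\<Delta> = "vsupp (x (fst \<omega>)) - \<Gamma>"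
    have c: "A ?w \<in> carrier_mat n N" "x ?w \<in> carrier_vec N" "e ?w \<in> carrier_vec n" using elim carr by auto
    \<comment> \<open>This relation holds with equality.\<close>
    have "vnorm (pinv (restrict_cols (A ?w) \<Gamma>) *\<^sub>v e ?w) = \<sigma> * sqrt (G \<omega>)"
      unfolding Gz W_def
      by (rule noise_coefficients[OF k \<Gamma> c assms(6) \<alpha>A sx]) (use elim in \<open>simp_all add: W_def\<close>)
    then show ?case by (simp add: Let_def)
  qed
  have 4: "AE \<omega>' in \<E>. let \<omega> = fst \<omega>'; A\<^sub>\<Gamma> = restrict_cols (A \<omega>) \<Gamma>; A\<^sub>\<Delta> = restrict_cols (A \<omega>) (\<Lambda> \<omega> - \<Gamma>)
           in vnorm (transpose_mat A\<^sub>\<Delta> *\<^sub>v ((1\<^sub>m n - A\<^sub>\<Gamma> * pinv A\<^sub>\<Gamma>) *\<^sub>v e \<omega>))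
               \<le> \<sigma> * sqrt (real k * real (n - k) / (real n)\<^sup>2 * (H \<omega>' * T \<omega>'))"
    using good
  proof eventually_elim
    case (elim \<omega>)
    let ?w = "fst \<omega>" and ?\<Delta> = "vsupp (x (fst \<omega>)) - \<Gamma>"
    have c: "A ?w \<in> carrier_mat n N" "x ?w \<in> carrier_vec N" "e ?w \<in> carrier_vec n" using elim carr by auto
    have "vnorm (transpose_mat (restrict_cols (A ?w) ?\<Delta>) *\<^sub>v
          ((1\<^sub>m n - restrict_cols (A ?w) \<Gamma> * pinv (restrict_cols (A ?w) \<Gamma>)) *\<^sub>v e ?w)) \<le>
        \<sigma> * sqrt ((\<Sum>i<n. (resid \<Gamma> k n N (\<alpha> \<omega>) i)\<^sup>2) * padded_corr \<Gamma> k n N (s \<omega>) (\<alpha> \<omega>) / (real n)\<^sup>2)"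
      by (rule noise_residual[OF k \<Gamma> c assms(6) \<alpha>A sx]) (use elim in \<open>simp_all add: W_def\<close>)
    \<comment> \<open>k and n - k cancel against the normalizations of \<open>T\<close> and
      \<open>H\<close>; n^2 collects the factors 1 / n from the variances of matrix and
      noise.\<close>
    moreover have "real k * real (n - k) / (real n)\<^sup>2 * (H \<omega> * T \<omega>) =
        (\<Sum>i<n. (resid \<Gamma> k n N (\<alpha> \<omega>) i)\<^sup>2) * padded_corr \<Gamma> k n N (s \<omega>) (\<alpha> \<omega>) / (real n)\<^sup>2"
      using k by (simp add: Hz T_def)
    ultimately show ?case using elim by (simp only: Let_def)
  qed
  show ?thesis
    using enl F R G H T 1 2 3 4 by blast
qed

end
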